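(* Let $d\ge 1$, let $A\in GL_d(\mathbb{Q})$ have no (complex) eigenvalue of norm $1$, and let $G=\mathbb{Z}\ltimes_A H$, where $H\subset\mathbb{Q}^d$ is a subgroup with $A(H)=H$ and $\mathrm{rank}_{\mathbb{Q}}(H)=d$. Then every action of $G$ by orientation-preserving $C^1$ diffeomorphisms of $[0,1]$ with no global fixed point in $(0,1)$ and having non-Abelian image is minimal on $(0,1)$, i.e. every $G$-orbit of a point of $(0,1)$ is dense in $(0,1)$.
   Context: The $\mathbb{Q}$-rank of $H$, $\mathrm{rank}_{\mathbb{Q}}(H)$, is the smallest $d'$ such that $H$ embeds into $\mathbb{Q}^{d'}$. $\mathbb{Z}\ltimes_A H$ is the semidirect product in which the generator $a$ of $\mathbb{Z}$ acts on $H$ by $a\,b\,a^{-1}=A(b)$, $b\in H$. A global fixed point of a group is a point fixed by all its elements. *)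

theory Defs
  imports
    "HOL-Analysis.Analysis"
    "HOL-Algebra.Group_Action"
    "Jordan_Normal_Form.Char_Poly"
begin

abbreviation Q_space :: "nat \<Rightarrow> rat vec monoid"
  where "Q_space d \<equiv> \<lparr>carrier = carrier_vec d, mult = (+), one = 0\<^sub>v d\<rparr>"

abbreviation Q_subgroup :: "nat \<Rightarrow> rat vec set \<Rightarrow> rat vec monoid"
  where "Q_subgroup d H \<equiv> (Q_space d)\<lparr>carrier := H\<rparr>"

text \<open>
  \<^const>\<open>mon\<close> is the set of injective group homomorphisms.  The \<^const>\<open>Least\<close> is only
  meaningful when some embedding into a \<^term>\<open>Q_space d'\<close> exists; subgroups of
  \<^term>\<open>Q_space d\<close> always have one.
\<close>
definition rank_Q :: "('a, 'b) monoid_scheme \<Rightarrow> nat"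
  where "rank_Q K = (LEAST d'. mon K (Q_space d') \<noteq> {})"

text \<open>
  The pair \<open>(m, x)\<close> stands for \<open>x a\<^sup>m\<close>, where \<open>a = (1, \<one>)\<close> is the generator of the
  integers; the product rule is then forced by \<open>a x a\<^sup>-\<^sup>1 = \<theta> x\<close>.  The integer power of the
  automorphism \<open>\<theta>\<close> is taken in the group of bijections of the carrier, so negative powers
  are powers of the inverse of \<open>\<theta>\<close> as a map of the carrier onto itself.
\<close>
definition int_semidirect ::
    "('a, 'b) monoid_scheme \<Rightarrow> ('a \<Rightarrow> 'a) \<Rightarrow> (int \<times> 'a) monoid"
  where "int_semidirect K \<theta> =
    \<lparr>carrier = UNIV \<times> carrier K,
     mult = (\<lambda>(m, x) (n, y).
       (m + n, x \<otimes>\<^bsub>K\<^esub> (restrict \<theta> (carrier K) [^]\<^bsub>BijGroup (carrier K)\<^esub> m) y)),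
     one = (0, \<one>\<^bsub>K\<^esub>)\<rparr>"

text \<open>
  One-sided derivatives at the end points; \<open>C1_differentiable_on\<close> does not fit because it
  asks for two-sided ones.
\<close>
definition C1_on_unit :: "(real \<Rightarrow> real) \<Rightarrow> bool"
  where "C1_on_unit f \<longleftrightarrow>
    (\<exists>f'. (\<forall>x\<in>{0..1}. (f has_real_derivative f' x) (at x within {0..1})) \<and>
          continuous_on {0..1} f')"

definition C1_diffeo_plus :: "(real \<Rightarrow> real) \<Rightarrow> bool"
  where "C1_diffeo_plus f \<longleftrightarrow>
    bij_betw f {0..1} {0..1} \<and> strict_mono_on {0..1} f \<and>
    C1_on_unit f \<and> C1_on_unit (inv_into {0..1} f)"

definition C1_action :: "('g, 'b) monoid_scheme \<Rightarrow> ('g \<Rightarrow> real \<Rightarrow> real) \<Rightarrow> bool"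
  where "C1_action G \<phi> \<longleftrightarrow>
    group_action G {0..1} \<phi> \<and> (\<forall>g\<in>carrier G. C1_diffeo_plus (\<phi> g))"

definition global_fixed_point :: "('g, 'b) monoid_scheme \<Rightarrow> ('g \<Rightarrow> 'x \<Rightarrow> 'x) \<Rightarrow> 'x \<Rightarrow> bool"
  where "global_fixed_point G \<phi> x \<longleftrightarrow> (\<forall>g\<in>carrier G. \<phi> g x = x)"

definition action_image :: "('g, 'b) monoid_scheme \<Rightarrow> ('g \<Rightarrow> real \<Rightarrow> real) \<Rightarrow> (real \<Rightarrow> real) monoid"
  where "action_image G \<phi> = (BijGroup {0..1})\<lparr>carrier := \<phi> ` carrier G\<rparr>"

definition minimal_on ::
    "('g, 'b) monoid_scheme \<Rightarrow> ('g \<Rightarrow> 'x::topological_space \<Rightarrow> 'x) \<Rightarrow> 'x set \<Rightarrow> bool"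
  where "minimal_on G \<phi> S \<longleftrightarrow>
    (\<forall>x\<in>S. orbit G \<phi> x \<subseteq> S \<and> S \<subseteq> closure (orbit G \<phi> x))"

end

theory Submission
  imports Defs
    "HOL-Algebra.Generated_Groups"
    "Jordan_Normal_Form.Schur_Decomposition"
begin

text \<open>
  Write \<open>a\<close> for the generator of the integers and \<open>K\<close> for the copy of \<open>H\<close> in the group.  Since \<open>A\<close>
  has no eigenvalue of modulus 1, a homomorphism \<open>\<tau>\<close> from \<open>K\<close> to the reals whose orbit under \<open>A\<close>
  grows subexponentially in both directions vanishes (triangularize \<open>A\<close> over the complex numbers
  and treat the coordinates one by one).  In particular the logarithm of the derivative at an end
  point is trivial on \<open>K\<close>, so near the end points the displacement \<open>h x - x\<close> is almost additive
  in \<open>h\<close>.  Full rank provides finitely many elements of \<open>K\<close> that generate a subgroup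
  with torsion quotient; hence the ordering of the \<open>K\<close>-orbit of a point \<open>x\<close> not fixed by \<open>K\<close> yields,
  as in Hoelder's theorem, a nonzero homomorphism \<open>\<tau>\<close> such that \<open>\<tau> h > 0\<close> implies \<open>h x > x\<close>.

  Suppose that \<open>K\<close> is nontrivial and fixes some \<open>p\<close> in the interior.  Comparing displacements along
  the orbit of \<open>x\<close> under \<open>a\<close>, which is squeezed against both end points by that of \<open>p\<close>, shows that
  \<open>\<tau>\<close> has subexponential orbit, a contradiction.  So \<open>K\<close> has no interior fixed point; then \<open>a\<close>
  multiplies \<open>\<tau>\<close> by a factor \<open>\<nu> \<noteq> 1\<close>.  If a \<open>K\<close>-orbit were not dense, a complementary gap near 0
  would have length at most a displacement, while \<open>a\<close> multiplies their ratio by about \<open>\<nu>\<close>.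
\<close>

text \<open>\<open>A\<close> may have eigenvalues both inside and outside the unit circle, and
  growth in one direction detects only one kind. This is why a fixed point of \<open>K\<close> has
  to be exploited at both ends of the interval. Each estimate is nevertheless made only near 0, for
  a map contracting towards 0: conjugation by the reflection exchanges the ends, and the data of
  \<open>a\<close> and of its inverse enter symmetrically. The C^1 hypothesis is used only through a
  two-point estimate at the end points. It gives no distortion control for long compositions, so
  displacements are compared one application of \<open>a\<close> at a time, each time at the cost of
  a factor arbitrarily close to 1. Only an exponential rate beats these losses, and hyperbolicity
  provides one. \<open>H\<close> need not be finitely generated (take Z[1/2]). A finite set
  generating it up to torsion still permits maxima over generators, which suffices because the reals
  are torsion-free and a monotone map fixes its periodic points. The non-Abelian image serves to
  make \<open>K\<close> act nontrivially.\<close>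

section \<open>Homomorphisms to the reals and Hoelder's theorem\<close>

definition real_hom :: "('h, 'b) monoid_scheme \<Rightarrow> ('h \<Rightarrow> real) \<Rightarrow> bool"
  where "real_hom K \<tau> \<longleftrightarrow> (\<forall>h\<in>carrier K. \<forall>k\<in>carrier K. \<tau> (h \<otimes>\<^bsub>K\<^esub> k) = \<tau> h + \<tau> k)"

context group
begin

lemma real_hom_mult:
  "\<lbrakk>real_hom G \<tau>; h \<in> carrier G; k \<in> carrier G\<rbrakk> \<Longrightarrow> \<tau> (h \<otimes> k) = \<tau> h + \<tau> k"
  by (simp add: real_hom_def)

lemma real_hom_one: "real_hom G \<tau> \<Longrightarrow> \<tau> \<one> = 0"
  using real_hom_mult[of \<tau> \<one> \<one>] by simp

lemma real_hom_inv: "\<lbrakk>real_hom G \<tau>; h \<in> carrier G\<rbrakk> \<Longrightarrow> \<tau> (inv h) = - \<tau> h"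
  using real_hom_mult[of \<tau> h "inv h"] real_hom_one[of \<tau>] by simp

lemma real_hom_pow: "\<lbrakk>real_hom G \<tau>; h \<in> carrier G\<rbrakk> \<Longrightarrow> \<tau> (h [^] (n::nat)) = n * \<tau> h"
  by (induction n) (simp_all add: real_hom_one real_hom_mult algebra_simps)

lemma real_hom_int_pow: "\<lbrakk>real_hom G \<tau>; h \<in> carrier G\<rbrakk> \<Longrightarrow> \<tau> (h [^] (n::int)) = n * \<tau> h"
  by (cases n rule: int_cases2)
    (simp_all add: int_pow_int int_pow_neg real_hom_inv real_hom_pow)

lemma real_hom_uminus: "real_hom G \<tau> \<Longrightarrow> real_hom G (\<lambda>h. - \<tau> h)"
  by (simp add: real_hom_def)

lemma real_hom_compose: "\<lbrakk>real_hom G \<tau>; \<theta> \<in> hom G G\<rbrakk> \<Longrightarrow> real_hom G (\<lambda>h. \<tau> (\<theta> h))"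
  by (auto simp: real_hom_def hom_def Pi_iff)

end

text \<open>A rational \<open>m / n\<close> strictly between the two normalized values of
  \<open>h\<close> would make \<open>h [^] n \<otimes> f [^] (-m)\<close> positive for
  \<open>\<sigma>\<close> and negative for \<open>\<tau>\<close>. The inequality so obtained,
  applied to \<open>inv h\<close> as well, is an equality. With \<open>\<sigma>\<close> the
  composition of \<open>\<tau>\<close> and an automorphism, \<open>c\<close> becomes the scaling
  factor of that automorphism.\<close>

lemma (in group) real_homs_proportional:
  assumes \<tau>: "real_hom G \<tau>" and \<sigma>: "real_hom G \<sigma>"
    and sign: "\<And>h. \<lbrakk>h \<in> carrier G; \<sigma> h > 0\<rbrakk> \<Longrightarrow> \<tau> h \<ge> 0"
    and f: "f \<in> carrier G" "\<tau> f > 0" and g: "g \<in> carrier G" "\<sigma> g > 0"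
  obtains c where "c > 0" "\<And>h. h \<in> carrier G \<Longrightarrow> \<sigma> h = c * \<tau> h"
proof
  note hom_simps = real_hom_mult real_hom_inv real_hom_int_pow
  have f0: "\<sigma> f \<ge> 0"
    using sign[of "inv f"] f by (force simp: hom_simps \<tau> \<sigma>)
  have fpos: "\<sigma> f > 0"
  proof (rule ccontr)
    assume "\<not> \<sigma> f > 0"
    then have z: "\<sigma> f = 0" using f0 by simp
    \<comment> \<open>If \<open>\<sigma> f\<close> vanished, dividing \<open>g\<close> by powers of
      \<open>f\<close> would keep \<open>\<sigma>\<close> positive and push \<open>\<tau>\<close>
      below 0.\<close>
    obtain n :: nat where n: "n * \<tau> f > \<tau> g"
      using f(2) ex_less_of_nat_mult by blast
    have "\<sigma> (g \<otimes> f [^] (- int n)) = \<sigma> g" "\<tau> (g \<otimes> f [^] (- int n)) = \<tau> g - n * \<tau> f"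
      using f g z by (simp_all add: hom_simps \<tau> \<sigma>)
    then show False using sign[of "g \<otimes> f [^] (- int n)"] f g n by simp
  qed
  have le: "\<sigma> h / \<sigma> f \<le> \<tau> h / \<tau> f" if h: "h \<in> carrier G" for h
  proof (rule ccontr)
    assume "\<not> ?thesis"
    then obtain r where r: "r \<in> \<rat>" "\<tau> h / \<tau> f < r" "r < \<sigma> h / \<sigma> f"
      using Rats_dense_in_real by (meson not_le)
    then obtain m n :: int where mn: "n > 0" "r = m / n"
      by (metis Rats_cases')
    have "\<tau> h * n < m * \<tau> f" "m * \<sigma> f < \<sigma> h * n"
      using r mn f fpos by (simp_all add: field_simps)
    then have "\<sigma> (h [^] n \<otimes> f [^] (-m)) > 0" "\<tau> (h [^] n \<otimes> f [^] (-m)) < 0"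
      using h f by (simp_all add: hom_simps \<tau> \<sigma> algebra_simps)
    then show False using sign[of "h [^] n \<otimes> f [^] (-m)"] h f by simp
  qed
  show "\<sigma> f / \<tau> f > 0" using fpos f by simp
  show "\<sigma> h = \<sigma> f / \<tau> f * \<tau> h" if h: "h \<in> carrier G" for h
  proof -
    have "\<sigma> (inv h) / \<sigma> f \<le> \<tau> (inv h) / \<tau> f" using le h by blast
    then have "\<sigma> h / \<sigma> f = \<tau> h / \<tau> f" using le[OF h] h by (simp add: hom_simps \<tau> \<sigma>)
    then show ?thesis using fpos f(2) by (simp add: field_simps)
  qed
qed

text \<open>
  Hoelder's embedding for a total preorder with positive cone \<open>P\<close> in which \<open>f\<close> is cofinal:
  \<open>\<tau> h\<close> is the supremum of the rationals \<open>p / q\<close> such that \<open>f\<^sup>p \<le> h\<^sup>q\<close>.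
\<close>
lemma (in comm_group) hoelder_functional:
  assumes P: "P \<subseteq> carrier G" and f: "f \<in> carrier G"
    and Pm: "\<And>h k. \<lbrakk>h \<in> P; k \<in> P\<rbrakk> \<Longrightarrow> h \<otimes> k \<in> P"
    and tot: "\<And>h. h \<in> carrier G \<Longrightarrow> h \<in> P \<or> inv h \<in> P"
    and fP: "f \<in> P" "inv f \<notin> P"
    and cof: "\<And>h. h \<in> carrier G \<Longrightarrow> \<exists>n::nat. f [^] n \<otimes> inv h \<in> P"
  obtains \<tau> where "real_hom G \<tau>" "\<tau> f > 0"
    "\<And>h. \<lbrakk>h \<in> carrier G; \<tau> h > 0\<rbrakk> \<Longrightarrow> inv h \<notin> P"
proof -
  have cancel: "inv b \<otimes> (b \<otimes> c) = c" if "b \<in> carrier G" "c \<in> carrier G" for b c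
    using that by (simp add: m_assoc[symmetric])
  have one: "\<one> \<in> P" using tot[of \<one>] by simp
  have Ppow: "h [^] (n::nat) \<in> P" if "h \<in> P" for h n
  proof (induction n)
    case 0
    show ?case using one by simp
  next
    case (Suc n)
    then show ?case using Pm[OF Suc that] by simp
  qed
  have Pipow: "h [^] (n::int) \<in> P" if "h \<in> P" "n \<ge> 0" for h n
    using Ppow[OF that(1), of "nat n"] that(2) by (metis int_nat_eq int_pow_int)
  \<comment> \<open>\<open>inv f\<close> is a negative power of \<open>f\<close> times a nonnegative
    one, so a negative power in \<open>P\<close> would put \<open>inv f\<close> there. The bounds on
    \<open>S\<close> below reduce to this.\<close>
  have fneg: "n \<ge> 0" if "f [^] (n::int) \<in> P" for n
  proof (rule ccontr)
    assume n: "\<not> n \<ge> 0"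
    have "f [^] n \<otimes> f [^] (- n - 1) \<in> P"
      using Pm[OF that] Pipow[OF fP(1), of "- n - 1"] n by simp
    moreover have "f [^] n \<otimes> f [^] (- n - 1) = inv f"
      using f by (simp add: int_pow_mult[symmetric] int_pow_neg)
    ultimately show False using fP by simp
  qed
  define S where "S h = {real_of_int p / real_of_int q | p q. q > 0 \<and> h [^] q \<otimes> f [^] (- p) \<in> P}" for h
  have SI: "real_of_int p / real_of_int q \<in> S h"
    if "q > 0" "h [^] q \<otimes> f [^] (- p) \<in> P" for h p q
    using that unfolding S_def by blast
  define \<tau> where "\<tau> h = Sup (S h)" for h
  have ne: "S h \<noteq> {}" if h: "h \<in> carrier G" for h
  proof -
    obtain n :: nat where "f [^] n \<otimes> inv (inv h) \<in> P" using cof[of "inv h"] h by auto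
    then have "h [^] (1::int) \<otimes> f [^] (- (- int n)) \<in> P"
      using h f by (simp add: m_comm int_pow_int)
    then have "real_of_int (- int n) / real_of_int 1 \<in> S h"
      by (intro SI) auto
    then show ?thesis by blast
  qed
  have bd: "\<exists>B. \<forall>r\<in>S h. r \<le> B" if h: "h \<in> carrier G" for h
  proof -
    obtain n :: nat where n: "f [^] n \<otimes> inv h \<in> P" using cof h by auto
    have "real_of_int p / real_of_int q \<le> n" if pq: "q > 0" "h [^] q \<otimes> f [^] (- p) \<in> P" for p q
    proof -
      have "(f [^] n \<otimes> inv h) [^] q \<otimes> (h [^] q \<otimes> f [^] (- p)) \<in> P"
        using Pm Pipow[OF n, of q] pq by simp
      also have "(f [^] n \<otimes> inv h) [^] q = f [^] (int n * q) \<otimes> inv (h [^] q)"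
        using h f by (simp add: int_pow_distrib int_pow_pow int_pow_int[symmetric] int_pow_inv)
      also have "f [^] (int n * q) \<otimes> inv (h [^] q) \<otimes> (h [^] q \<otimes> f [^] (- p))
          = f [^] (int n * q) \<otimes> f [^] (- p)"
        using h f by (simp add: m_assoc cancel)
      also have "\<dots> = f [^] (int n * q - p)" using f by (simp add: int_pow_mult[symmetric])
      finally have "p \<le> int n * q" using fneg by fastforce
      then have "real_of_int p \<le> real n * real_of_int q" by (metis of_int_le_iff of_int_mult of_int_of_nat_eq)
      then show ?thesis using pq by (simp add: field_simps)
    qed
    then show ?thesis unfolding S_def by blast
  qed
  have up: "r \<le> \<tau> h" if "h \<in> carrier G" "r \<in> S h" for h r
    unfolding \<tau>_def using bd[OF that(1)] that(2) by (auto intro!: cSup_upper bdd_aboveI)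
  have add: "r + s \<in> S (h \<otimes> k)" if hk: "h \<in> carrier G" "k \<in> carrier G" and rs: "r \<in> S h" "s \<in> S k" for h k r s
  proof -
    obtain p q p' q' where pq: "r = real_of_int p / real_of_int q" "q > 0" "h [^] q \<otimes> f [^] (- p) \<in> P"
      and pq': "s = real_of_int p' / real_of_int q'" "q' > 0" "k [^] q' \<otimes> f [^] (- p') \<in> P"
      using rs unfolding S_def by blast
    have "(h [^] q \<otimes> f [^] (- p)) [^] q' \<otimes> (k [^] q' \<otimes> f [^] (- p')) [^] q \<in> P"
      using Pm Pipow pq pq' by simp
    also have "(h [^] q \<otimes> f [^] (- p)) [^] q' = h [^] (q * q') \<otimes> f [^] (- p * q')"
      using hk f by (simp add: int_pow_distrib int_pow_pow)
    also have "(k [^] q' \<otimes> f [^] (- p')) [^] q = k [^] (q * q') \<otimes> f [^] (- p' * q)"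
      using hk f by (simp add: int_pow_distrib int_pow_pow mult.commute)
    also have "h [^] (q * q') \<otimes> f [^] (- p * q') \<otimes> (k [^] (q * q') \<otimes> f [^] (- p' * q))
       = (h [^] (q * q') \<otimes> k [^] (q * q')) \<otimes> (f [^] (- p * q') \<otimes> f [^] (- p' * q))"
      using hk f by (simp add: m_ac)
    also have "\<dots> = (h \<otimes> k) [^] (q * q') \<otimes> f [^] (- (p * q' + p' * q))"
      using hk f by (simp add: int_pow_distrib int_pow_mult[symmetric])
    finally have "real_of_int (p * q' + p' * q) / real_of_int (q * q') \<in> S (h \<otimes> k)"
      using pq(2) pq'(2) by (intro SI) (auto simp: mult_pos_pos)
    moreover have "real_of_int (p * q' + p' * q) / real_of_int (q * q') = r + s"
      unfolding pq(1) pq'(1) using pq(2) pq'(2) by (simp add: field_simps)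
    ultimately show ?thesis by simp
  qed
  have super: "\<tau> h + \<tau> k \<le> \<tau> (h \<otimes> k)" if hk: "h \<in> carrier G" "k \<in> carrier G" for h k
  proof -
    have "r + s \<le> \<tau> (h \<otimes> k)" if "r \<in> S h" "s \<in> S k" for r s
      using up add hk that by blast
    then have "s \<le> \<tau> (h \<otimes> k) - \<tau> h" if "s \<in> S k" for s
      using that cSup_least[OF ne[OF hk(1)], of "\<tau> (h \<otimes> k) - s"] unfolding \<tau>_def by (force simp: algebra_simps)
    then show ?thesis using cSup_least[OF ne[OF hk(2)], of "\<tau> (h \<otimes> k) - \<tau> h"] unfolding \<tau>_def by force
  qed
  have tone: "\<tau> \<one> \<le> 0"
  proof -
    have "r \<le> 0" if "r \<in> S \<one>" for r
      using that fneg f unfolding S_def by (force simp: divide_le_0_iff)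
    then show ?thesis unfolding \<tau>_def using cSup_least[OF ne] by blast
  qed
  \<comment> \<open>Suprema give only superadditivity; totality supplies the other half. A rational
    \<open>r\<close> in a gap between \<open>\<tau> h\<close> and \<open>- \<tau> (inv h)\<close> is
    not in \<open>S h\<close>, so by totality \<open>- r\<close> is in \<open>S (inv h)\<close>,
    beyond its supremum. Additivity follows by superadditivity at \<open>h \<otimes> k\<close> and
    \<open>inv h\<close>.\<close>
  have tinv: "\<tau> (inv h) = - \<tau> h" if h: "h \<in> carrier G" for h
  proof (rule antisym)
    show "\<tau> (inv h) \<le> - \<tau> h" using super[of h "inv h"] h tone by simp
    show "- \<tau> h \<le> \<tau> (inv h)"
    proof (rule ccontr)
      assume "\<not> ?thesis"
      then obtain r where r: "r \<in> \<rat>" "\<tau> h < r" "\<tau> (inv h) < - r"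
        using Rats_dense_in_real[of "\<tau> h" "- \<tau> (inv h)"] by force
      obtain p q :: int where pq: "q > 0" "r = p / q"
        using r(1) by (metis Rats_cases')
      have "r \<notin> S h" using up[OF h] r(2) by force
      then have "h [^] q \<otimes> f [^] (- p) \<notin> P" using pq unfolding S_def by blast
      then have "inv (h [^] q \<otimes> f [^] (- p)) \<in> P"
        using tot[of "h [^] q \<otimes> f [^] (- p)"] h f by simp
      also have "inv (h [^] q \<otimes> f [^] (- p)) = inv h [^] q \<otimes> f [^] (- (- p))"
        using h f by (simp only: inv_mult int_pow_closed int_pow_inv int_pow_neg inv_closed inv_inv)
      finally have "real_of_int (- p) / real_of_int q \<in> S (inv h)"
        using pq by (intro SI) auto
      then show False using up[of "inv h" "- r"] h r pq by simp
    qed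
  qed
  have hom: "real_hom G \<tau>"
    unfolding real_hom_def
  proof (intro ballI)
    fix h k assume hk: "h \<in> carrier G" "k \<in> carrier G"
    have "\<tau> (h \<otimes> k) + \<tau> (inv h) \<le> \<tau> ((h \<otimes> k) \<otimes> inv h)" using super hk by simp
    also have "(h \<otimes> k) \<otimes> inv h = k" using hk by (simp add: m_comm[of h k] m_assoc)
    finally show "\<tau> (h \<otimes> k) = \<tau> h + \<tau> k" using super[OF hk] tinv[OF hk(1)] by simp
  qed
  have "f [^] (1::int) \<otimes> f [^] (- (1::int)) \<in> P"
    using f one by (simp add: int_pow_neg)
  then have "real_of_int 1 / real_of_int 1 \<in> S f"
    by (intro SI) auto
  then have "\<tau> f > 0" using up[OF f] by force
  \<comment> \<open>A positive value provides \<open>p > 0\<close> with \<open>f [^] p\<close> below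
    \<open>h [^] q\<close>; with \<open>inv h\<close> in the cone, \<open>f [^] (- p)\<close> would
    be in it too.\<close>
  moreover have "inv h \<notin> P" if h: "h \<in> carrier G" "\<tau> h > 0" for h
  proof
    assume i: "inv h \<in> P"
    obtain r where r: "r \<in> S h" "r > 0"
      using h ne[OF h(1)] unfolding \<tau>_def by (meson less_cSupE)
    then obtain p q where pq: "r = real_of_int p / real_of_int q" "q > 0" "h [^] q \<otimes> f [^] (- p) \<in> P"
      unfolding S_def by blast
    have "inv h [^] q \<otimes> (h [^] q \<otimes> f [^] (- p)) \<in> P"
      using Pm Pipow[OF i] pq by simp
    also have "inv h [^] q \<otimes> (h [^] q \<otimes> f [^] (- p)) = f [^] (- p)"
      using h f by (simp add: int_pow_inv m_assoc[symmetric])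
    finally have "p \<le> 0" using fneg by fastforce
    then show False using r(2) pq(1,2) by (simp add: zero_less_divide_iff)
  qed
  ultimately show thesis using that hom by blast
qed

section \<open>Strict differentiability at 0\<close>

text \<open>Strong differentiability from the right: \<open>f\<close> minus its linear part is
  Lipschitz near 0 with arbitrarily small constant. Comparing displacements at two nearby points
  needs this two-point form; differentiability at 0 alone says nothing about such
  differences.\<close>

definition strict_deriv0 :: "(real \<Rightarrow> real) \<Rightarrow> real \<Rightarrow> bool"
  where "strict_deriv0 f c \<longleftrightarrow>
    (\<forall>\<epsilon>>0. \<exists>\<delta>>0. \<forall>x y. 0 \<le> x \<longrightarrow> x \<le> y \<longrightarrow> y \<le> \<delta> \<longrightarrow> \<bar>f y - f x - c * (y - x)\<bar> \<le> \<epsilon> * (y - x))"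

lemma strict_deriv0D:
  assumes "strict_deriv0 f c" "\<epsilon> > 0"
  obtains \<delta> where "\<delta> > 0" "\<delta> \<le> 1"
    "\<And>x y. \<lbrakk>0 \<le> x; x \<le> \<delta>; 0 \<le> y; y \<le> \<delta>\<rbrakk> \<Longrightarrow> \<bar>f y - f x - c * (y - x)\<bar> \<le> \<epsilon> * \<bar>y - x\<bar>"
proof -
  obtain \<delta> where \<delta>: "\<delta> > 0"
    "\<And>x y. \<lbrakk>0 \<le> x; x \<le> y; y \<le> \<delta>\<rbrakk> \<Longrightarrow> \<bar>f y - f x - c * (y - x)\<bar> \<le> \<epsilon> * (y - x)"
    using assms unfolding strict_deriv0_def by meson
  have "\<bar>f y - f x - c * (y - x)\<bar> \<le> \<epsilon> * \<bar>y - x\<bar>"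
    if "0 \<le> x" "x \<le> min \<delta> 1" "0 \<le> y" "y \<le> min \<delta> 1" for x y
  proof (cases "x \<le> y")
    case True
    then show ?thesis using \<delta>(2)[of x y] that by simp
  next
    case False
    have "f y - f x - c * (y - x) = - (f x - f y - c * (x - y))" by (simp add: algebra_simps)
    then show ?thesis using \<delta>(2)[of y x] that False by simp
  qed
  then show thesis using that[of "min \<delta> 1"] \<delta>(1) by simp
qed

lemma strict_deriv0_unique:
  assumes "strict_deriv0 f c" "strict_deriv0 f d"
  shows "c = d"
proof (rule ccontr)
  assume ne: "c \<noteq> d"
  define e where "e = \<bar>c - d\<bar> / 3"
  have e: "e > 0" using ne by (simp add: e_def)
  obtain \<delta>1 where 1: "\<delta>1 > 0" "\<And>x y. \<lbrakk>0 \<le> x; x \<le> \<delta>1; 0 \<le> y; y \<le> \<delta>1\<rbrakk> \<Longrightarrow> \<bar>f y - f x - c * (y - x)\<bar> \<le> e * \<bar>y - x\<bar>"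
    using strict_deriv0D[OF assms(1) e] by metis
  obtain \<delta>2 where 2: "\<delta>2 > 0" "\<And>x y. \<lbrakk>0 \<le> x; x \<le> \<delta>2; 0 \<le> y; y \<le> \<delta>2\<rbrakk> \<Longrightarrow> \<bar>f y - f x - d * (y - x)\<bar> \<le> e * \<bar>y - x\<bar>"
    using strict_deriv0D[OF assms(2) e] by metis
  define y where "y = min \<delta>1 \<delta>2"
  have y: "y > 0" using 1 2 by (simp add: y_def)
  have "\<bar>(c - d) * y\<bar> \<le> \<bar>f y - f 0 - c * y\<bar> + \<bar>f y - f 0 - d * y\<bar>" by (simp add: algebra_simps)
  also have "\<dots> \<le> 2 * e * y" using 1(2)[of 0 y] 2(2)[of 0 y] y by (simp add: y_def)
  finally have "\<bar>c - d\<bar> \<le> 2 * e" using y by (simp add: abs_mult)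
  then show False using e by (simp add: e_def)
qed

lemma strict_deriv0_compose:
  assumes f: "strict_deriv0 f c" and g: "strict_deriv0 g d"
    and g0: "g 0 = 0" and mono: "mono_on {0..1} g"
  shows "strict_deriv0 (\<lambda>x. f (g x)) (c * d)"
  unfolding strict_deriv0_def
proof (intro allI impI)
  fix e :: real assume e: "e > 0"
  define B where "B = \<bar>d\<bar> + 1"
  have B: "B > 0" by (simp add: B_def)
  \<comment> \<open>\<open>e2 \<le> 1\<close> makes \<open>B\<close> a Lipschitz constant of
    \<open>g\<close> near 0. The errors of \<open>f\<close> and of \<open>g\<close> then contribute
    at most half of \<open>e\<close> each; the 1 added to \<open>\<bar>c\<bar>\<close> avoids a zero
    denominator.\<close>
  define e1 where "e1 = e / (2 * B)"
  define e2 where "e2 = min 1 (e / (2 * (\<bar>c\<bar> + 1)))"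
  have e1: "e1 > 0" and e2: "e2 > 0" using e B by (simp_all add: e1_def e2_def)
  obtain \<delta>1 where 1: "\<delta>1 > 0" "\<And>x y. \<lbrakk>0 \<le> x; x \<le> \<delta>1; 0 \<le> y; y \<le> \<delta>1\<rbrakk> \<Longrightarrow> \<bar>f y - f x - c * (y - x)\<bar> \<le> e1 * \<bar>y - x\<bar>"
    using strict_deriv0D[OF f e1] by metis
  obtain \<delta>2 where 2: "\<delta>2 > 0" "\<delta>2 \<le> 1" "\<And>x y. \<lbrakk>0 \<le> x; x \<le> \<delta>2; 0 \<le> y; y \<le> \<delta>2\<rbrakk> \<Longrightarrow> \<bar>g y - g x - d * (y - x)\<bar> \<le> e2 * \<bar>y - x\<bar>"
    using strict_deriv0D[OF g e2] by metis
  have lip: "\<bar>g y - g x\<bar> \<le> B * \<bar>y - x\<bar>" if "0 \<le> x" "x \<le> \<delta>2" "0 \<le> y" "y \<le> \<delta>2" for x y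
  proof -
    have "\<bar>g y - g x\<bar> \<le> \<bar>g y - g x - d * (y - x)\<bar> + \<bar>d * (y - x)\<bar>" by simp
    also have "\<dots> \<le> e2 * \<bar>y - x\<bar> + \<bar>d\<bar> * \<bar>y - x\<bar>" using 2(3)[OF that] by (simp add: abs_mult)
    also have "\<dots> \<le> 1 * \<bar>y - x\<bar> + \<bar>d\<bar> * \<bar>y - x\<bar>"
      by (intro add_right_mono mult_right_mono) (simp_all add: e2_def)
    finally show ?thesis by (simp add: B_def algebra_simps)
  qed
  define \<delta> where "\<delta> = min \<delta>2 (\<delta>1 / B)"
  have \<delta>: "\<delta> > 0" "\<delta> \<le> \<delta>2" "B * \<delta> \<le> \<delta>1" using 1 2 B by (auto simp: \<delta>_def min_def field_simps)
  show "\<exists>\<delta>>0. \<forall>x y. 0 \<le> x \<longrightarrow> x \<le> y \<longrightarrow> y \<le> \<delta> \<longrightarrow>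
      \<bar>f (g y) - f (g x) - c * d * (y - x)\<bar> \<le> e * (y - x)"
  proof (intro exI[of _ \<delta>] conjI allI impI)
    fix x y assume xy: "0 \<le> x" "x \<le> y" "y \<le> \<delta>"
    \<comment> \<open>Monotonicity and \<open>g 0 = 0\<close> keep the inner values nonnegative,
      where the one-sided estimate for \<open>f\<close> applies.\<close>
    have g01: "0 \<le> g z \<and> g z \<le> \<delta>1" if "0 \<le> z" "z \<le> \<delta>" for z
    proof -
      have "g 0 \<le> g z" using that \<delta> 2(2) by (intro mono_onD[OF mono]) auto
      moreover have "\<bar>g z - g 0\<bar> \<le> B * z" using lip[of 0 z] that \<delta> 2(1) by simp
      moreover have "B * z \<le> B * \<delta>" using that B by simp
      ultimately show ?thesis using g0 \<delta> by simp
    qed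
    have "\<bar>f (g y) - f (g x) - c * d * (y - x)\<bar>
        \<le> \<bar>f (g y) - f (g x) - c * (g y - g x)\<bar> + \<bar>c * (g y - g x - d * (y - x))\<bar>"
      by (simp add: algebra_simps)
    also have "\<dots> \<le> e1 * \<bar>g y - g x\<bar> + \<bar>c\<bar> * (e2 * (y - x))"
      using 1(2)[of "g x" "g y"] g01[of x] g01[of y] xy 2(3)[of x y] \<delta>
      by (intro add_mono) (auto simp: abs_mult intro: mult_left_mono)
    also have "\<dots> \<le> e1 * (B * (y - x)) + \<bar>c\<bar> * (e / (2 * (\<bar>c\<bar> + 1)) * (y - x))"
      using lip[of x y] xy \<delta> e1
      by (intro add_mono mult_left_mono mult_right_mono) (auto simp: e2_def)
    also have "e1 * (B * (y - x)) = e / 2 * (y - x)" using B by (simp add: e1_def)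
    also have "\<bar>c\<bar> * (e / (2 * (\<bar>c\<bar> + 1)) * (y - x)) = (\<bar>c\<bar> / (\<bar>c\<bar> + 1)) * (e / 2 * (y - x))" by simp
    also have "\<dots> \<le> 1 * (e / 2 * (y - x))"
      using e xy by (intro mult_right_mono) auto
    finally show "\<bar>f (g y) - f (g x) - c * d * (y - x)\<bar> \<le> e * (y - x)" by (simp add: field_simps)
  qed (use \<delta> in auto)
qed

section \<open>Order-preserving actions on the unit interval\<close>

text \<open>Only values on the unit interval are constrained, so that the conjugate of an action by
  the reflection is again an instance although its maps need not be extensional.\<close>

locale interval_action = group K for K :: "('h, 'b) monoid_scheme" (structure) +
  fixes \<alpha> :: "'h \<Rightarrow> real \<Rightarrow> real"
  assumes bij: "h \<in> carrier K \<Longrightarrow> bij_betw (\<alpha> h) {0..1} {0..1}"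
    and mono: "h \<in> carrier K \<Longrightarrow> strict_mono_on {0..1} (\<alpha> h)"
    and act_mult: "\<lbrakk>h \<in> carrier K; k \<in> carrier K; x \<in> {0..1}\<rbrakk> \<Longrightarrow> \<alpha> (h \<otimes> k) x = \<alpha> h (\<alpha> k x)"
begin

lemma act_closed [simp]: "\<lbrakk>h \<in> carrier K; 0 \<le> x; x \<le> 1\<rbrakk> \<Longrightarrow> 0 \<le> \<alpha> h x \<and> \<alpha> h x \<le> 1"
  using bij[of h] by (force simp: bij_betw_def)

lemma act_less_iff:
  "\<lbrakk>h \<in> carrier K; x \<in> {0..1}; y \<in> {0..1}\<rbrakk> \<Longrightarrow> \<alpha> h x < \<alpha> h y \<longleftrightarrow> x < y"
  using mono[of h] by (metis strict_mono_on_less)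

lemma act_le_iff:
  "\<lbrakk>h \<in> carrier K; x \<in> {0..1}; y \<in> {0..1}\<rbrakk> \<Longrightarrow> \<alpha> h x \<le> \<alpha> h y \<longleftrightarrow> x \<le> y"
  using act_less_iff[of h y x] by (simp add: not_less[symmetric])

lemma act_one: assumes "x \<in> {0..1}" shows "\<alpha> \<one> x = x"
proof -
  have "\<alpha> \<one> (\<alpha> \<one> x) = \<alpha> \<one> x" using act_mult[of \<one> \<one> x] assms by simp
  then show ?thesis using bij[of \<one>] assms act_closed[of \<one> x]
    by (metis atLeastAtMost_iff bij_betw_def inj_onD one_closed)
qed

lemma act_inv: "\<lbrakk>h \<in> carrier K; x \<in> {0..1}\<rbrakk> \<Longrightarrow> \<alpha> (inv h) (\<alpha> h x) = x"
  using act_mult[of "inv h" h x] by (simp add: act_one)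

lemma act_inv': "\<lbrakk>h \<in> carrier K; x \<in> {0..1}\<rbrakk> \<Longrightarrow> \<alpha> h (\<alpha> (inv h) x) = x"
  using act_mult[of h "inv h" x] by (simp add: act_one)

lemma act_0: assumes h: "h \<in> carrier K" shows "\<alpha> h 0 = 0"
proof -
  have "\<alpha> h 0 \<le> \<alpha> h (\<alpha> (inv h) 0)" using h act_closed[of "inv h" 0] by (subst act_le_iff) auto
  then have "\<alpha> h 0 \<le> 0" using h by (simp add: act_inv')
  then show ?thesis using h by (intro antisym) simp_all
qed

lemma act_1: assumes h: "h \<in> carrier K" shows "\<alpha> h 1 = 1"
proof -
  have "\<alpha> h (\<alpha> (inv h) 1) \<le> \<alpha> h 1" using h act_closed[of "inv h" 1] by (subst act_le_iff) auto
  then have "1 \<le> \<alpha> h 1" using h by (simp add: act_inv')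
  then show ?thesis using h by (intro antisym) simp_all
qed

lemma act_interior: "\<lbrakk>h \<in> carrier K; x \<in> {0<..<1}\<rbrakk> \<Longrightarrow> \<alpha> h x \<in> {0<..<1}"
  using act_less_iff[of h 0 x] act_less_iff[of h x 1] by (simp add: act_0 act_1)

lemma act_inv_less_iff:
  assumes "h \<in> carrier K" "x \<in> {0..1}" "y \<in> {0..1}"
  shows "\<alpha> (inv h) x < y \<longleftrightarrow> x < \<alpha> h y"
  using act_less_iff[of h "\<alpha> (inv h) x" y] act_closed[of "inv h" x] assms by (simp add: act_inv')

lemma less_act_inv_iff:
  assumes "h \<in> carrier K" "x \<in> {0..1}" "y \<in> {0..1}"
  shows "y < \<alpha> (inv h) x \<longleftrightarrow> \<alpha> h y < x"
  using act_less_iff[of h y "\<alpha> (inv h) x"] act_closed[of "inv h" x] assms by (simp add: act_inv')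

lemma act_pow_le:
  assumes "h \<in> carrier K" "x \<in> {0..1}" "x \<le> \<alpha> h x"
  shows "x \<le> \<alpha> (h [^] (n::nat)) x"
proof (induction n)
  case (Suc n)
  have "x \<le> \<alpha> (h [^] n) x" by fact
  also have "\<dots> \<le> \<alpha> (h [^] n) (\<alpha> h x)" using assms by (subst act_le_iff) auto
  finally show ?case using assms by (simp add: act_mult)
qed (use act_one[of x] assms in simp)

text \<open>The infimum of an orbit is fixed by the whole group, hence is 0. If \<open>h\<close>
  raised it, some orbit point would lie below its image and \<open>inv h\<close> would carry that
  point below the infimum; the opposite inequality is the same argument for
  \<open>inv h\<close>.\<close>

lemma orbit_reaches_0:
  assumes nofix: "\<And>y. y \<in> {0<..<1} \<Longrightarrow> \<exists>h\<in>carrier K. \<alpha> h y \<noteq> y"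
    and x: "x \<in> {0<..<1}" and y: "y > 0"
  shows "\<exists>h\<in>carrier K. \<alpha> h x < y"
proof -
  define L where "L = Inf ((\<lambda>h. \<alpha> h x) ` carrier K)"
  have bdd: "bdd_below ((\<lambda>h. \<alpha> h x) ` carrier K)"
    using act_closed x by (intro bdd_belowI[of _ 0]) auto
  have L: "L \<le> \<alpha> h x" if "h \<in> carrier K" for h
    unfolding L_def using bdd that by (intro cInf_lower) auto
  have L1: "L < 1" using L[OF one_closed] act_one[of x] x by auto
  have L0: "L \<ge> 0" unfolding L_def using act_closed x by (intro cInf_greatest) auto
  have ex: "\<exists>h\<in>carrier K. \<alpha> h x < z" if "L < z" for z
    using that cInf_lessD[of "(\<lambda>h. \<alpha> h x) ` carrier K" z] unfolding L_def by auto
  have not: "\<not> L < \<alpha> h L" if h: "h \<in> carrier K" for h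
  proof
    assume "L < \<alpha> h L"
    then obtain k where k: "k \<in> carrier K" "\<alpha> k x < \<alpha> h L" using ex by blast
    then have "\<alpha> (inv h) (\<alpha> k x) < L"
      using act_inv_less_iff[of h "\<alpha> k x" L] L0 L1 h x by auto
    then have "\<alpha> (inv h \<otimes> k) x < L" using h k x by (simp add: act_mult)
    then show False using L[of "inv h \<otimes> k"] h k by simp
  qed
  have "\<alpha> h L = L" if h: "h \<in> carrier K" for h
  proof -
    have "\<not> \<alpha> h L < L" using not[of "inv h"] less_act_inv_iff[of h L L] h L0 L1 by simp
    then show ?thesis using not[OF h] by simp
  qed
  then have "L = 0" using nofix[of L] L0 L1 by force
  then show ?thesis using ex y by blast
qed

end

text \<open>Right continuity at 0, read off from the inverse: below
  \<open>\<alpha> (inv h) d\<close> all values stay below \<open>d\<close>.\<close>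

lemma (in interval_action) act_small:
  assumes h: "h \<in> carrier K" and \<delta>: "\<delta> > 0"
  shows "\<forall>\<^sub>F x in at_right 0. \<alpha> h x \<le> \<delta>"
proof -
  define d where "d = min \<delta> (1/2)"
  have d: "0 < d" "d < 1" "d \<le> \<delta>" using \<delta> by (auto simp: d_def)
  have b: "\<alpha> (inv h) d \<in> {0<..<1}" using act_interior[of "inv h" d] h d by simp
  have "\<alpha> h x \<le> \<delta>" if "0 < x" "x < \<alpha> (inv h) d" for x
    using less_act_inv_iff[of h d x] that h d b by auto
  then show ?thesis using b by (auto simp: eventually_at_right_field)
qed

section \<open>Displacements near a flat end point\<close>

locale flat_action = interval_action +
  assumes flat: "h \<in> carrier K \<Longrightarrow> strict_deriv0 (\<alpha> h) 1"
begin

lemma disp_lipschitz: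
  assumes "h \<in> carrier K" "\<epsilon> > 0"
  obtains \<delta> where "\<delta> > 0" "\<delta> \<le> 1"
    "\<And>x y. \<lbrakk>0 \<le> x; x \<le> \<delta>; 0 \<le> y; y \<le> \<delta>\<rbrakk> \<Longrightarrow> \<bar>(\<alpha> h y - y) - (\<alpha> h x - x)\<bar> \<le> \<epsilon> * \<bar>y - x\<bar>"
proof -
  obtain \<delta> where "\<delta> > 0" "\<delta> \<le> 1" and
    \<delta>: "\<And>x y. \<lbrakk>0 \<le> x; x \<le> \<delta>; 0 \<le> y; y \<le> \<delta>\<rbrakk> \<Longrightarrow> \<bar>\<alpha> h y - \<alpha> h x - 1 * (y - x)\<bar> \<le> \<epsilon> * \<bar>y - x\<bar>"
    using strict_deriv0D[OF flat[OF assms(1)] assms(2)] by metis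
  then show thesis using that[of \<delta>] by (simp add: algebra_simps)
qed

text \<open>The displacement of \<open>h [^] n\<close> is a sum of displacements of \<open>h\<close>
  at points whose distance from \<open>x\<close> is at most a multiple of the displacement at
  \<open>x\<close>. As the displacement has a small Lipschitz constant near 0, each summand differs
  from the first by a small fraction of it. The error is thus relative, which makes ratios of
  displacements meaningful.\<close>

lemma disp_pow:
  assumes h: "h \<in> carrier K" and "\<epsilon> > 0"
  shows "\<forall>\<^sub>F x in at_right 0. \<bar>\<alpha> (h [^] (n::nat)) x - x - n * (\<alpha> h x - x)\<bar> \<le> \<epsilon> * \<bar>\<alpha> h x - x\<bar>"
  using \<open>\<epsilon> > 0\<close>
proof (induction n arbitrary: \<epsilon>)
  case 0
  have "\<forall>\<^sub>F x in at_right (0::real). x \<in> {0<..<1}"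
    by (auto simp: eventually_at_right_field intro!: exI[of _ 1])
  then show ?case
    by eventually_elim (use 0 in \<open>simp add: act_one\<close>)
next
  case (Suc n)
  \<comment> \<open>Chosen so that \<open>\<eta> * (n + 1)\<close> is half of
    \<open>\<epsilon>\<close>. The induction hypothesis is taken with
    \<open>min 1 (\<epsilon>/2)\<close>: the 1 gives the crude bound \<open>zx\<close>, and
    \<open>\<epsilon>/2\<close> is the other half of the error.\<close>
  define \<eta> where "\<eta> = \<epsilon> / (2 * (real n + 1))"
  have \<eta>: "\<eta> > 0" using Suc.prems by (simp add: \<eta>_def)
  obtain \<delta> where \<delta>: "\<delta> > 0" "\<delta> \<le> 1"
    "\<And>x y. \<lbrakk>0 \<le> x; x \<le> \<delta>; 0 \<le> y; y \<le> \<delta>\<rbrakk> \<Longrightarrow> \<bar>(\<alpha> h y - y) - (\<alpha> h x - x)\<bar> \<le> \<eta> * \<bar>y - x\<bar>"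
    using disp_lipschitz[OF h \<eta>] by metis
  have small: "\<forall>\<^sub>F x in at_right 0. 0 < x \<and> x < \<delta>"
    using \<delta>(1) by (auto simp: eventually_at_right_field)
  have hn: "h [^] n \<in> carrier K" using h by simp
  have IH: "\<forall>\<^sub>F x in at_right 0. \<bar>\<alpha> (h [^] n) x - x - n * (\<alpha> h x - x)\<bar> \<le> min 1 (\<epsilon>/2) * \<bar>\<alpha> h x - x\<bar>"
    using Suc.prems by (intro Suc.IH) auto
  show ?case
    using IH small act_small[OF hn \<delta>(1)]
  proof eventually_elim
    case (elim x)
    define D where "D = \<alpha> h x - x"
    define z where "z = \<alpha> (h [^] n) x"
    have x: "x \<in> {0..1}" using elim \<delta> by simp
    have z: "0 \<le> z" "z \<le> \<delta>" using elim hn x by (auto simp: z_def)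
    have IH': "\<bar>z - x - n * D\<bar> \<le> min 1 (\<epsilon>/2) * \<bar>D\<bar>" using elim by (simp add: z_def D_def)
    have zx: "\<bar>z - x\<bar> \<le> (real n + 1) * \<bar>D\<bar>"
    proof -
      have "\<bar>z - x\<bar> \<le> \<bar>z - x - n * D\<bar> + \<bar>n * D\<bar>" by simp
      also have "\<dots> \<le> 1 * \<bar>D\<bar> + n * \<bar>D\<bar>"
        using IH' mult_right_mono[of "min 1 (\<epsilon>/2)" 1 "\<bar>D\<bar>"] by (simp add: abs_mult)
      finally show ?thesis by (simp add: algebra_simps)
    qed
    have "\<alpha> (h [^] Suc n) x = \<alpha> h z"
      using h x by (subst nat_pow_Suc2) (simp_all add: act_mult z_def)
    then have "\<bar>\<alpha> (h [^] Suc n) x - x - Suc n * D\<bar> = \<bar>(z - x - n * D) + ((\<alpha> h z - z) - (\<alpha> h x - x))\<bar>"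
      by (simp add: algebra_simps D_def)
    also have "\<dots> \<le> \<bar>z - x - n * D\<bar> + \<bar>(\<alpha> h z - z) - (\<alpha> h x - x)\<bar>" by simp
    also have "\<dots> \<le> \<epsilon>/2 * \<bar>D\<bar> + \<eta> * ((real n + 1) * \<bar>D\<bar>)"
    proof (intro add_mono)
      show "\<bar>z - x - n * D\<bar> \<le> \<epsilon>/2 * \<bar>D\<bar>"
        using IH' mult_right_mono[OF min.cobounded2[of 1 "\<epsilon>/2"] abs_ge_zero[of D]] by linarith
      have "\<bar>(\<alpha> h z - z) - (\<alpha> h x - x)\<bar> \<le> \<eta> * \<bar>z - x\<bar>"
        using \<delta>(3)[of x z] z elim by simp
      then show "\<bar>(\<alpha> h z - z) - (\<alpha> h x - x)\<bar> \<le> \<eta> * ((real n + 1) * \<bar>D\<bar>)"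
        using mult_left_mono[OF zx, of \<eta>] \<eta> by linarith
    qed
    also have "\<dots> = \<epsilon> * \<bar>D\<bar>" by (simp add: \<eta>_def field_simps)
    finally show ?case unfolding D_def .
  qed
qed

text \<open>
  The hypothesis says that \<open>g\<close> moves \<open>x\<close> at least \<open>\<rho>\<close> times as far as \<open>k\<close> does in the sense of
  iterates; near the flat end point this is inherited by the displacements.
\<close>
lemma disp_ratio:
  fixes a b \<kappa> :: real
  assumes g: "g \<in> carrier K" and k: "k \<in> carrier K" and \<kappa>: "\<kappa> < 1" and a: "0 < a"
  shows "\<forall>\<^sub>F x in at_right 0. \<forall>\<rho>\<in>{a..b}.
    (\<forall>(p::nat) (q::nat). real p < real q * \<rho> \<longrightarrow> \<alpha> (k [^] p) x < \<alpha> (g [^] q) x) \<longrightarrow> x \<le> \<alpha> k x \<longrightarrow> x \<le> \<alpha> g x \<longrightarrow>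
    \<kappa> * \<rho> * (\<alpha> k x - x) \<le> \<alpha> g x - x"
proof -
  \<comment> \<open>This makes \<open>\<kappa> * \<rho> * (q + 1) \<le> q * \<rho> - 2\<close> for
    all \<open>\<rho> \<ge> a\<close>. Of the 2, one unit is lost in rounding
    \<open>q * \<rho>\<close> down to \<open>p\<close> and one in the relative error for
    \<open>k\<close>; the relative error for \<open>g\<close> turns \<open>q\<close> into
    \<open>q + 1\<close>.\<close>
  obtain q :: nat where q: "q * (1 - \<kappa>) > 2 / a + 1"
    using \<kappa> ex_less_of_nat_mult[of "1 - \<kappa>" "2/a + 1"] by auto
  \<comment> \<open>For all \<open>\<rho> \<le> b\<close> together only exponents up to
    \<open>P\<close> occur, so finitely many applications of \<open>disp_pow\<close> give a
    neighbourhood independent of \<open>\<rho>\<close>.\<close>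
  define P where "P = nat \<lceil>q * b\<rceil>"
  have "\<forall>\<^sub>F x in at_right 0. \<forall>p\<in>{..P}. \<bar>\<alpha> (k [^] (p::nat)) x - x - p * (\<alpha> k x - x)\<bar> \<le> 1 * \<bar>\<alpha> k x - x\<bar>"
    using disp_pow[OF k, of 1] by (intro eventually_ball_finite) auto
  moreover have "\<forall>\<^sub>F x in at_right 0. \<bar>\<alpha> (g [^] q) x - x - q * (\<alpha> g x - x)\<bar> \<le> 1 * \<bar>\<alpha> g x - x\<bar>"
    by (intro disp_pow g) auto
  ultimately show ?thesis
  proof eventually_elim
    case (elim x)
    show ?case
    proof (intro ballI impI)
      fix \<rho> assume \<rho>: "\<rho> \<in> {a..b}"
        and iter: "\<forall>(p::nat) (q::nat). real p < real q * \<rho> \<longrightarrow> \<alpha> (k [^] p) x < \<alpha> (g [^] q) x"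
        and kx: "x \<le> \<alpha> k x" and gx: "x \<le> \<alpha> g x"
      have \<rho>0: "\<rho> > 0" using \<rho> a by simp
      have "2 / a + 1 > 0" using a by (simp add: add_pos_pos)
      then have qpos: "real q > 0" using q by (cases "q = 0") auto
      \<comment> \<open>The largest integer strictly below \<open>q * \<rho>\<close>, since the
        comparison of iterates assumes a strict inequality.\<close>
      define p where "p = nat (\<lceil>q * \<rho>\<rceil> - 1)"
      have c: "\<lceil>q * \<rho>\<rceil> \<ge> 1" using qpos \<rho>0 by simp
      have p1: "p < q * \<rho>" and p2: "p \<ge> q * \<rho> - 1"
        unfolding p_def using c ceiling_correct[of "q * \<rho>"] by (simp_all add: of_nat_nat)
      have "q * \<rho> \<le> q * b" using \<rho> by (intro mult_left_mono) auto
      then have pP: "p \<le> P" unfolding p_def P_def by (intro nat_mono) (smt (verit) ceiling_mono)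
      define Dk where "Dk = \<alpha> k x - x"
      define Dg where "Dg = \<alpha> g x - x"
      have D0: "Dk \<ge> 0" "Dg \<ge> 0" using kx gx by (simp_all add: Dk_def Dg_def)
      have "\<bar>\<alpha> (k [^] p) x - x - p * Dk\<bar> \<le> 1 * \<bar>Dk\<bar>"
        using elim(1) pP by (simp add: Dk_def)
      then have "(real p - 1) * Dk \<le> \<alpha> (k [^] p) x - x"
        using D0 by (simp add: algebra_simps abs_le_iff)
      also have "\<dots> \<le> \<alpha> (g [^] q) x - x" using iter p1 by (simp add: less_imp_le)
      also have "\<dots> \<le> (q + 1) * Dg" using elim(2) D0 by (simp add: Dg_def[symmetric] algebra_simps)
      finally have le: "(real p - 1) * Dk \<le> (q + 1) * Dg" by simp
      have "\<kappa> * \<rho> * (q + 1) \<le> q * \<rho> - 2"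
      proof -
        have "2 / \<rho> \<le> 2 / a" using \<rho> a by (intro divide_left_mono) auto
        then have "\<rho> * (2 / \<rho> + 1) \<le> \<rho> * (q * (1 - \<kappa>))"
          using q \<rho>0 by (intro mult_left_mono) auto
        then have "2 + \<rho> \<le> \<rho> * (q * (1 - \<kappa>))" using \<rho>0 by (simp add: algebra_simps)
        moreover have "\<kappa> * \<rho> \<le> \<rho>" using \<kappa> \<rho>0 by simp
        ultimately show ?thesis by (simp add: algebra_simps)
      qed
      also have "\<dots> \<le> real p - 1" using p2 by simp
      finally have "\<kappa> * \<rho> * (q + 1) * Dk \<le> (real p - 1) * Dk" using D0 by (intro mult_right_mono) auto
      with le have "(real q + 1) * (\<kappa> * \<rho> * Dk) \<le> (real q + 1) * Dg" by (simp add: algebra_simps)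
      then have "\<kappa> * \<rho> * Dk \<le> Dg" using qpos by simp
      then show "\<kappa> * \<rho> * (\<alpha> k x - x) \<le> \<alpha> g x - x" by (simp add: Dk_def Dg_def)
    qed
  qed
qed

end

section \<open>Groups finitely generated up to torsion and the ordering of an orbit\<close>

text \<open>Symmetry of \<open>E\<close> turns a maximum of values of a homomorphism over
  \<open>E\<close> into a maximum of absolute values.\<close>

locale finite_rank_group = comm_group K for K :: "('h, 'b) monoid_scheme" (structure) +
  fixes E :: "'h set"
  assumes E_fin: "finite E" and E_sub: "E \<subseteq> carrier K" and E_inv: "e \<in> E \<Longrightarrow> inv e \<in> E"
    and E_span: "h \<in> carrier K \<Longrightarrow> \<exists>q::nat. q > 0 \<and> h [^] q \<in> generate K E"
begin

text \<open>\<open>C\<close> is the length of a word in \<open>E\<close> for some power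
  \<open>h [^] q\<close>, divided by \<open>q\<close>. It does not depend on \<open>\<tau>\<close>,
  so one constant serves all compositions of a functional with iterates of an automorphism.\<close>

lemma real_hom_bound:
  assumes h: "h \<in> carrier K"
  obtains C :: real where "C \<ge> 0"
    "\<And>\<tau> B. \<lbrakk>real_hom K \<tau>; B \<ge> 0; \<And>e. e \<in> E \<Longrightarrow> \<bar>\<tau> e\<bar> \<le> B\<rbrakk> \<Longrightarrow> \<bar>\<tau> h\<bar> \<le> C * B"
proof -
  have *: "\<exists>C\<ge>0::real. \<forall>\<tau> B. real_hom K \<tau> \<longrightarrow> B \<ge> 0 \<longrightarrow> (\<forall>e\<in>E. \<bar>\<tau> e\<bar> \<le> B) \<longrightarrow> \<bar>\<tau> k\<bar> \<le> C * B"
    if "k \<in> generate K E" for k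
    using that
  proof (induction rule: generate.induct)
    case one
    show ?case by (intro exI[of _ 0]) (simp add: real_hom_one)
  next
    case (incl h)
    then show ?case by (intro exI[of _ 1]) simp
  next
    case (inv h)
    then have "h \<in> carrier K" using E_sub by blast
    with inv show ?case by (intro exI[of _ 1]) (simp add: real_hom_inv)
  next
    case (eng h1 h2)
    then obtain C1 C2 :: real where C: "C1 \<ge> 0" "C2 \<ge> 0"
      "\<And>\<tau> B. real_hom K \<tau> \<Longrightarrow> B \<ge> 0 \<Longrightarrow> (\<forall>e\<in>E. \<bar>\<tau> e\<bar> \<le> B) \<Longrightarrow> \<bar>\<tau> h1\<bar> \<le> C1 * B"
      "\<And>\<tau> B. real_hom K \<tau> \<Longrightarrow> B \<ge> 0 \<Longrightarrow> (\<forall>e\<in>E. \<bar>\<tau> e\<bar> \<le> B) \<Longrightarrow> \<bar>\<tau> h2\<bar> \<le> C2 * B" by metis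
    have car: "h1 \<in> carrier K" "h2 \<in> carrier K"
      using eng generate_in_carrier[OF E_sub] by blast+
    have "\<bar>\<tau> (h1 \<otimes> h2)\<bar> \<le> (C1 + C2) * B"
      if "real_hom K \<tau>" "B \<ge> 0" "\<forall>e\<in>E. \<bar>\<tau> e\<bar> \<le> B" for \<tau> B
      using C(3)[OF that] C(4)[OF that] real_hom_mult[OF that(1) car] by (simp add: algebra_simps)
    then show ?case using C(1,2) by (intro exI[of _ "C1 + C2"]) simp
  qed
  obtain q :: nat where q: "q > 0" "h [^] q \<in> generate K E" using E_span h by blast
  obtain C where C: "C \<ge> 0"
    "\<And>\<tau> B. real_hom K \<tau> \<Longrightarrow> B \<ge> 0 \<Longrightarrow> (\<forall>e\<in>E. \<bar>\<tau> e\<bar> \<le> B) \<Longrightarrow> \<bar>\<tau> (h [^] q)\<bar> \<le> C * B"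
    using *[OF q(2)] by auto
  have "\<bar>\<tau> h\<bar> \<le> (C / q) * B" if "real_hom K \<tau>" "B \<ge> 0" "\<And>e. e \<in> E \<Longrightarrow> \<bar>\<tau> e\<bar> \<le> B" for \<tau> B
    using C(2)[OF that(1,2)] that(3) real_hom_pow[OF that(1) h, of q] q(1)
    by (simp add: abs_mult field_simps)
  then show thesis using that[of "C / q"] C(1) by simp
qed

end

locale finite_rank_action = interval_action K \<alpha> + finite_rank_group K E
  for K :: "('h, 'b) monoid_scheme" (structure) and \<alpha> E
begin

text \<open>The elements that do not move \<open>x\<close> to the left form the cone for
  \<open>hoelder_functional\<close>. Its cofinal element is the member \<open>f\<close> of
  \<open>E\<close> that moves \<open>x\<close> farthest to the right.\<close>

lemma ordering_functional:
  assumes x: "x \<in> {0<..<1}" and moved: "\<exists>h\<in>carrier K. \<alpha> h x \<noteq> x"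
  obtains \<tau> f where "real_hom K \<tau>" "f \<in> carrier K" "\<tau> f > 0"
    "\<And>h. \<lbrakk>h \<in> carrier K; \<tau> h > 0\<rbrakk> \<Longrightarrow> x < \<alpha> h x"
    "\<And>h. h \<in> carrier K \<Longrightarrow> \<exists>n::nat. \<alpha> h x \<le> \<alpha> (f [^] n) x"
proof -
  have x01: "x \<in> {0..1}" using x by simp
  define P where "P = {h \<in> carrier K. x \<le> \<alpha> h x}"
  \<comment> \<open>A monotone map fixes its periodic points. Hence \<open>E\<close> must move
    \<open>x\<close>: otherwise the generated subgroup, and with it every root of its elements,
    would fix \<open>x\<close>.\<close>
  have fixpow: "\<alpha> h x = x" if h: "h \<in> carrier K" and q: "q > 0" "\<alpha> (h [^] (q::nat)) x = x" for h q
  proof -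
    have up: "\<not> x < \<alpha> k x" if k: "k \<in> carrier K" "\<alpha> (k [^] q) x = x" for k
    proof
      assume lt: "x < \<alpha> k x"
      obtain m where m: "q = Suc m" using q by (cases q) auto
      have "x \<le> \<alpha> (k [^] m) x" using act_pow_le[of k x m] k lt x01 by simp
      also have "\<dots> < \<alpha> (k [^] m) (\<alpha> k x)" using lt k x01 by (subst act_less_iff) auto
      also have "\<dots> = x" using k m x01 by (simp add: act_mult)
      finally show False by simp
    qed
    have "\<alpha> (inv h [^] q) x = x"
      using act_inv[of "h [^] q" x] q h x01 by (simp add: nat_pow_inv)
    then have "\<not> x < \<alpha> (inv h) x" using up[of "inv h"] h by simp
    then have "\<not> \<alpha> h x < x" using less_act_inv_iff[of h x x] h x01 by simp
    then show ?thesis using up[OF h q(2)] by simp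
  qed
  have "\<exists>e\<in>E. \<alpha> e x \<noteq> x"
  proof (rule ccontr)
    assume "\<not> ?thesis"
    then have e: "\<And>e. e \<in> E \<Longrightarrow> \<alpha> e x = x" by blast
    have "\<alpha> k x = x" if "k \<in> generate K E" for k
      using that
    proof (induction rule: generate.induct)
      case one
      show ?case using act_one x01 by simp
    next
      case (eng h1 h2)
      then show ?case using generate_in_carrier[OF E_sub] x01 by (simp add: act_mult)
    qed (use e E_inv in auto)
    then show False using moved E_span fixpow by blast
  qed
  then obtain e0 where e0: "e0 \<in> E" "\<alpha> e0 x \<noteq> x" by blast
  then have "Max ((\<lambda>e. \<alpha> e x) ` E) \<in> (\<lambda>e. \<alpha> e x) ` E" using E_fin by (intro Max_in) auto
  then obtain f where f: "f \<in> E" "Max ((\<lambda>e. \<alpha> e x) ` E) = \<alpha> f x" by auto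
  have fmax: "\<alpha> e x \<le> \<alpha> f x" if "e \<in> E" for e
    using that E_fin Max_ge[of "(\<lambda>e. \<alpha> e x) ` E" "\<alpha> e x"] f(2) by simp
  have fK: "f \<in> carrier K" using f E_sub by blast
  have fx: "x < \<alpha> f x"
  proof (cases "x < \<alpha> e0 x")
    case True
    then show ?thesis using fmax[OF e0(1)] by simp
  next
    case False
    then have "x < \<alpha> (inv e0) x" using less_act_inv_iff[of e0 x x] e0 E_sub x01 by auto
    then show ?thesis using fmax[OF E_inv[OF e0(1)]] by simp
  qed
  \<comment> \<open>Commutativity lets the power of \<open>f\<close> that bounds the second factor
    pass across the first, so exponents add up along a word.\<close>
  have cofgen: "\<exists>n::nat. \<alpha> k x \<le> \<alpha> (f [^] n) x" if "k \<in> generate K E" for k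
    using that
  proof (induction rule: generate.induct)
    case one
    show ?case by (intro exI[of _ 0]) simp
  next
    case (incl h)
    then show ?case using fmax fK by (intro exI[of _ 1]) simp
  next
    case (inv h)
    then show ?case using fmax E_inv fK by (intro exI[of _ 1]) simp
  next
    case (eng h1 h2)
    then obtain n1 n2 :: nat where n: "\<alpha> h1 x \<le> \<alpha> (f [^] n1) x" "\<alpha> h2 x \<le> \<alpha> (f [^] n2) x" by blast
    have car: "h1 \<in> carrier K" "h2 \<in> carrier K"
      using eng generate_in_carrier[OF E_sub] by blast+
    have "\<alpha> (h1 \<otimes> h2) x \<le> \<alpha> h1 (\<alpha> (f [^] n2) x)"
      using car n fK x01 by (simp add: act_mult act_le_iff)
    also have "\<dots> = \<alpha> (f [^] n2) (\<alpha> h1 x)"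
      using car fK x01 by (simp add: act_mult[symmetric] m_comm)
    also have "\<dots> \<le> \<alpha> (f [^] n2) (\<alpha> (f [^] n1) x)"
      using car n fK x01 by (simp add: act_le_iff)
    also have "\<dots> = \<alpha> (f [^] (n2 + n1)) x"
      using fK x01 by (simp add: act_mult[symmetric] nat_pow_mult)
    finally show ?case by blast
  qed
  have cof: "\<exists>n::nat. \<alpha> h x \<le> \<alpha> (f [^] n) x" if h: "h \<in> carrier K" for h
  proof (cases "\<alpha> h x \<le> x")
    case True
    then show ?thesis using act_one[OF x01] by (intro exI[of _ 0]) simp
  next
    case False
    obtain q :: nat where q: "q > 0" "h [^] q \<in> generate K E" using E_span h by blast
    then obtain m where m: "q = Suc m" by (cases q) auto
    have "x \<le> \<alpha> (h [^] m) x" using act_pow_le[of h x m] h x01 False by simp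
    then have "\<alpha> h x \<le> \<alpha> h (\<alpha> (h [^] m) x)" using h x01 by (simp add: act_le_iff)
    also have "\<dots> = \<alpha> (h [^] q) x"
      unfolding m using h x01 by (subst nat_pow_Suc2) (simp_all add: act_mult)
    finally show ?thesis using cofgen[OF q(2)] order_trans by blast
  qed
  have PK: "P \<subseteq> carrier K" by (auto simp: P_def)
  have Pm: "h \<otimes> k \<in> P" if hk: "h \<in> P" "k \<in> P" for h k
  proof -
    have "x \<le> \<alpha> h x" using hk by (simp add: P_def)
    also have "\<dots> \<le> \<alpha> h (\<alpha> k x)" using hk x01 by (simp add: P_def act_le_iff)
    finally show ?thesis using hk x01 by (simp add: P_def act_mult)
  qed
  have tot: "h \<in> P \<or> inv h \<in> P" if "h \<in> carrier K" for h
    using that less_act_inv_iff[of h x x] x01 by (auto simp: P_def)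
  have inv_notin: "inv h \<notin> P \<longleftrightarrow> x < \<alpha> h x" if "h \<in> carrier K" for h
    using that act_inv_less_iff[of h x x] x01 by (auto simp: P_def)
  have cofP: "\<exists>n::nat. f [^] n \<otimes> inv h \<in> P" if h: "h \<in> carrier K" for h
  proof -
    obtain n :: nat where n: "\<alpha> h x \<le> \<alpha> (f [^] n) x" using cof h by blast
    have "x \<le> \<alpha> (inv h) (\<alpha> (f [^] n) x)"
      using n act_inv_less_iff[of h "\<alpha> (f [^] n) x" x] h fK x01 by simp
    also have "\<dots> = \<alpha> (f [^] n \<otimes> inv h) x"
      using h fK x01 by (simp add: act_mult[symmetric] m_comm)
    finally show ?thesis using h fK by (auto simp: P_def)
  qed
  have fP: "f \<in> P" "inv f \<notin> P" using fx fK inv_notin by (auto simp: P_def)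
  obtain \<tau> where "real_hom K \<tau>" "\<tau> f > 0" "\<And>h. \<lbrakk>h \<in> carrier K; \<tau> h > 0\<rbrakk> \<Longrightarrow> inv h \<notin> P"
    using hoelder_functional[OF PK fK Pm tot fP cofP] by metis
  then show thesis using that fK inv_notin cof by blast
qed

end

section \<open>Growth of a functional along a contracted orbit\<close>

context group
begin

lemma hom_funpow: "\<theta> \<in> hom G G \<Longrightarrow> (\<theta> ^^ n) \<in> hom G G"
  by (induction n) (auto simp: hom_def Pi_iff)

lemma funpow_surj: "\<theta> ` carrier G = carrier G \<Longrightarrow> (\<theta> ^^ n) ` carrier G = carrier G"
  by (induction n) (simp_all only: funpow.simps image_comp[symmetric] image_id id_apply)

end

locale flat_finite_rank_action = flat_action K \<alpha> + finite_rank_action K \<alpha> E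
  for K :: "('h, 'b) monoid_scheme" (structure) and \<alpha> E
begin

text \<open>
  Along the contracted orbit \<open>x\<^sub>n = b\<^sup>n x\<^sub>0\<close>, the largest displacement \<open>D n\<close> of \<open>x\<^sub>n\<close> under \<open>E\<close> is
  to first order proportional to the size \<open>M n\<close> of \<open>\<tau> \<circ> \<theta>\<^sup>n\<close>, with a factor that shrinks like
  \<open>b'(0)\<^sup>n\<close>.  As the \<open>K\<close>-fixed points \<open>b\<^sup>n p\<close> bound \<open>D n\<close> and shrink at the same rate,
  \<open>M n\<close> cannot grow exponentially.
\<close>
lemma subexponential_growth:
  assumes b_mono: "strict_mono_on {0..1} b" and b_01: "\<And>x. x \<in> {0..1} \<Longrightarrow> b x \<in> {0..1}"
    and b0: "b 0 = 0" and b_der: "strict_deriv0 b c" and c: "c > 0"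
    and \<theta>: "\<theta> \<in> hom K K" "\<theta> ` carrier K = carrier K"
    and equiv: "\<And>h x. \<lbrakk>h \<in> carrier K; x \<in> {0..1}\<rbrakk> \<Longrightarrow> b (\<alpha> (\<theta> h) x) = \<alpha> h (b x)"
    and p: "p \<in> {0<..<1}" "\<And>h. h \<in> carrier K \<Longrightarrow> \<alpha> h p = p"
    and lim: "(\<lambda>n. (b ^^ n) p) \<longlonglongrightarrow> 0"
    and x0: "x0 \<in> {0<..<p}"
    and \<tau>: "real_hom K \<tau>" "h1 \<in> carrier K" "\<tau> h1 \<noteq> 0"
    and sign: "\<And>h. \<lbrakk>h \<in> carrier K; \<tau> h > 0\<rbrakk> \<Longrightarrow> x0 < \<alpha> h x0"
    and s: "s > 1" and h: "h \<in> carrier K"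
  shows "\<exists>C. \<forall>n. \<bar>\<tau> ((\<theta> ^^ n) h)\<bar> \<le> C * s ^ n"
proof -
  define x where "x n = (b ^^ n) x0" for n
  define y where "y n = (b ^^ n) p" for n
  define T where "T n k = \<tau> ((\<theta> ^^ n) k)" for n k
  have b_less: "b u < b v" if "0 \<le> u" "u < v" "v \<le> 1" for u v
    using strict_mono_onD[OF b_mono] that by simp
  have xy: "0 < x n \<and> x n < y n \<and> y n < 1" for n
  proof (induction n)
    case 0
    show ?case using x0 p by (simp add: x_def y_def)
  next
    case (Suc n)
    have "b (y n) < b 1" using b_less Suc by simp
    moreover have "b 1 \<le> 1" using b_01[of 1] by simp
    moreover have "b 0 < b (x n)" "b (x n) < b (y n)" using b_less Suc by simp_all
    ultimately show ?case using b0 by (simp add: x_def y_def)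
  qed
  have x01 [simp]: "x n \<in> {0..1}" and y01 [simp]: "y n \<in> {0..1}" for n
    using xy[of n] by simp_all
  have Suc_xy: "x (Suc n) = b (x n)" "y (Suc n) = b (y n)" for n by (simp_all add: x_def y_def)
  have yfix: "\<alpha> k (y n) = y n" if "k \<in> carrier K" for k n
    using that
  proof (induction n arbitrary: k)
    case 0
    then show ?case using p by (simp add: y_def)
  next
    case (Suc n)
    have "\<theta> k \<in> carrier K" using \<theta> Suc.prems by blast
    then show ?case using equiv[of k "y n"] Suc xy[of n] by (simp add: Suc_xy)
  qed
  have y_lim: "y \<longlonglongrightarrow> 0" using lim by (simp add: y_def[abs_def])
  have x_lim0: "x \<longlonglongrightarrow> 0"
    by (rule tendsto_sandwich[OF _ _ tendsto_const y_lim])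
      (use xy in \<open>auto intro!: always_eventually simp: less_imp_le\<close>)
  have x_lim: "filterlim x (at_right 0) sequentially"
  proof -
    have "x n \<in> {0<..} \<and> x n \<noteq> 0" for n using xy[of n] by simp
    then show ?thesis using x_lim0 by (auto simp: filterlim_at intro!: always_eventually)
  qed
  have act_lt: "\<alpha> k (x n) < y n" if "k \<in> carrier K" for k n
    using act_less_iff[OF that x01 y01, of n n] yfix[OF that] xy by simp
  have \<theta>n: "(\<theta> ^^ n) \<in> hom K K" "(\<theta> ^^ n) ` carrier K = carrier K" for n
    using hom_funpow[OF \<theta>(1)] funpow_surj[OF \<theta>(2)] by blast+
  have \<theta>K: "\<theta> k \<in> carrier K" if "k \<in> carrier K" for k using \<theta>(2) that by blast
  have T_hom: "real_hom K (T n)" for n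
    unfolding T_def by (rule real_hom_compose[OF \<tau>(1) \<theta>n(1)])
  have T_Suc: "T (Suc n) k = T n (\<theta> k)" for n k
    unfolding T_def by (simp only: funpow_Suc_right o_apply)
  \<comment> \<open>\<open>b\<close> conjugates \<open>\<theta> k\<close> to \<open>k\<close>, so
    composing \<open>\<tau>\<close> with \<open>\<theta>\<close> turns an ordering functional at
    \<open>x n\<close> into one at \<open>x (Suc n)\<close>.\<close>
  have T_sign: "x n < \<alpha> k (x n)" if "k \<in> carrier K" "T n k > 0" for k n
    using that
  proof (induction n arbitrary: k)
    case 0
    then show ?case using sign by (simp add: x_def T_def)
  next
    case (Suc n)
    have "x n < \<alpha> (\<theta> k) (x n)" using Suc \<theta>K by (simp add: T_Suc)
    then have "b (x n) < b (\<alpha> (\<theta> k) (x n))"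
      using b_less xy[of n] act_lt[of "\<theta> k" n] \<theta>K Suc.prems by force
    then show ?case using equiv[of k "x n"] Suc.prems xy[of n] by (simp add: Suc_xy)
  qed
  have T_nz: "\<exists>k\<in>carrier K. T n k \<noteq> 0" for n
    using \<tau>(2,3) \<theta>n(2)[of n] unfolding T_def by (metis imageE)

  have E_ne: "E \<noteq> {}"
  proof
    assume E: "E = {}"
    obtain C where "\<And>\<tau> B. \<lbrakk>real_hom K \<tau>; B \<ge> 0; \<And>e. e \<in> E \<Longrightarrow> \<bar>\<tau> e\<bar> \<le> B\<rbrakk> \<Longrightarrow> \<bar>\<tau> h1\<bar> \<le> C * B"
      using real_hom_bound[OF \<tau>(2)] by metis
    from this[OF \<tau>(1), of 0] show False using E \<tau>(3) by simp
  qed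
  define M where "M n = Max (T n ` E)" for n
  define D where "D n = Max ((\<lambda>e. \<alpha> e (x n) - x n) ` E)" for n
  have T_le: "T n e \<le> M n" if "e \<in> E" for n e
    unfolding M_def using that E_fin by (intro Max_ge) auto
  have T_abs: "\<bar>T n e\<bar> \<le> M n" if "e \<in> E" for n e
    using T_le[OF that, of n] T_le[OF E_inv[OF that], of n] real_hom_inv[OF T_hom, of e n] that E_sub
    by auto
  have M_ex: "\<exists>e\<in>E. M n = T n e" for n
  proof -
    have "M n \<in> T n ` E" unfolding M_def using E_fin E_ne by (intro Max_in) auto
    then show ?thesis by blast
  qed
  have D_ex: "\<exists>e\<in>E. D n = \<alpha> e (x n) - x n" for n
  proof -
    have "D n \<in> (\<lambda>e. \<alpha> e (x n) - x n) ` E" unfolding D_def using E_fin E_ne by (intro Max_in) auto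
    then show ?thesis by blast
  qed
  have D_ge: "\<alpha> e (x n) - x n \<le> D n" if "e \<in> E" for n e
    unfolding D_def using that E_fin by (intro Max_ge) auto
  have M_bound: "\<exists>C\<ge>0. \<forall>n. \<bar>T n k\<bar> \<le> C * M n" if k: "k \<in> carrier K" for k
  proof -
    obtain C where C: "C \<ge> 0"
      "\<And>\<tau> B. \<lbrakk>real_hom K \<tau>; B \<ge> 0; \<And>e. e \<in> E \<Longrightarrow> \<bar>\<tau> e\<bar> \<le> B\<rbrakk> \<Longrightarrow> \<bar>\<tau> k\<bar> \<le> C * B"
      using real_hom_bound[OF k] by metis
    have "M n \<ge> 0" for n using T_abs E_ne by (meson abs_ge_zero all_not_in_conv order_trans)
    then show ?thesis using C T_hom T_abs by blast
  qed
  have M_pos: "M n > 0" for n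
  proof -
    obtain k where k: "k \<in> carrier K" "T n k \<noteq> 0" using T_nz by blast
    obtain C where C: "C \<ge> 0" "\<bar>T n k\<bar> \<le> C * M n" using M_bound[OF k(1)] by blast
    then have "C * M n > 0" using k by linarith
    then show ?thesis using C(1) by (simp add: zero_less_mult_iff)
  qed
  have D_pos: "D n > 0" for n
  proof -
    obtain e where e: "e \<in> E" "M n = T n e" using M_ex by blast
    then have "x n < \<alpha> e (x n)" using T_sign M_pos E_sub by (metis subsetD)
    then show ?thesis using D_ge[OF e(1), of n] by simp
  qed
  have D_less: "D n < y n" for n
    using D_ex[of n] act_lt[of _ n] xy[of n] E_sub by force

  have unif: "\<exists>C>0. \<forall>e\<in>E. \<forall>n. \<bar>T n (g e)\<bar> \<le> C * M n" if g: "\<And>e. e \<in> E \<Longrightarrow> g e \<in> carrier K" for g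
  proof -
    have "\<forall>e\<in>E. \<exists>C\<ge>0. \<forall>n. \<bar>T n (g e)\<bar> \<le> C * M n" using M_bound g by blast
    then obtain F where F: "\<And>e n. e \<in> E \<Longrightarrow> F e \<ge> 0 \<and> \<bar>T n (g e)\<bar> \<le> F e * M n" by metis
    have "\<bar>T n (g e)\<bar> \<le> (1 + sum F E) * M n" if e: "e \<in> E" for e n
    proof -
      have "F e \<le> sum F E" using e E_fin F by (intro member_le_sum) auto
      then have "F e * M n \<le> (1 + sum F E) * M n" using M_pos[of n] by (intro mult_right_mono) auto
      then show ?thesis using F[OF e, of n] by linarith
    qed
    moreover have "1 + sum F E > 0" using F by (simp add: add_pos_nonneg sum_nonneg)
    ultimately show ?thesis by blast
  qed
  \<comment> \<open>The two bounds on consecutive values of \<open>M\<close> confine their ratio to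
    a fixed compact interval of positive numbers, over which \<open>disp_ratio\<close> is uniform.
    The lower one uses preimages of \<open>E\<close> under \<open>\<theta>\<close>.\<close>
  obtain C1 where C1: "C1 > 0" "\<And>e n. e \<in> E \<Longrightarrow> \<bar>T n (\<theta> e)\<bar> \<le> C1 * M n"
    using unif[of \<theta>] \<theta>K E_sub by (metis subsetD)
  have M_up: "M (Suc n) \<le> C1 * M n" for n
    using M_ex[of "Suc n"] C1(2)[of _ n] by (force simp: T_Suc)
  have "\<forall>e\<in>E. \<exists>e'\<in>carrier K. e = \<theta> e'" using \<theta>(2) E_sub by blast
  then obtain g where g: "\<And>e. e \<in> E \<Longrightarrow> g e \<in> carrier K \<and> \<theta> (g e) = e" by metis
  obtain C2 where C2: "C2 > 0" "\<And>e n. e \<in> E \<Longrightarrow> \<bar>T n (g e)\<bar> \<le> C2 * M n"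
    using unif[of g] g by metis
  have M_down: "M n \<le> C2 * M (Suc n)" for n
    using M_ex[of n] C2(2)[of _ "Suc n"] g by (force simp: T_Suc)

  \<comment> \<open>One step loses a factor \<open>\<kappa>\<close> three times: in comparing
    displacements at \<open>x n\<close>, in applying \<open>b\<close> to a displacement, and in
    applying \<open>b\<close> to \<open>y n\<close>. Together these cost exactly
    \<open>s\<close>.\<close>
  define \<kappa> where "\<kappa> = inverse (root 3 s)"
  have \<kappa>: "0 < \<kappa>" "\<kappa> < 1" "\<kappa> ^ 3 = inverse s"
    using s real_root_gt_1_iff[of 3 s] by (simp_all add: \<kappa>_def power_inverse inverse_less_1_iff)
  have ratio: "\<forall>\<^sub>F n in sequentially. \<forall>e\<in>E. \<forall>k\<in>E. \<forall>\<rho>\<in>{1/C2..C1}.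
    (\<forall>(p::nat) (q::nat). real p < real q * \<rho> \<longrightarrow> \<alpha> (k [^] p) (x n) < \<alpha> (\<theta> e [^] q) (x n)) \<longrightarrow>
    x n \<le> \<alpha> k (x n) \<longrightarrow> x n \<le> \<alpha> (\<theta> e) (x n) \<longrightarrow>
    \<kappa> * \<rho> * (\<alpha> k (x n) - x n) \<le> \<alpha> (\<theta> e) (x n) - x n"
    (is "\<forall>\<^sub>F n in sequentially. ?R (x n)")
  proof -
    have "\<forall>\<^sub>F u in at_right 0. ?R u"
      using E_fin E_sub \<kappa>(2) C2(1) \<theta>K
      by (intro eventually_ball_finite ballI disp_ratio) auto
    then show ?thesis by (rule eventually_compose_filterlim[OF _ x_lim])
  qed
  have "(1 - \<kappa>) * c > 0" using \<kappa> c by simp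
  then obtain \<delta>1 where \<delta>1: "\<delta>1 > 0"
      "\<And>u v. \<lbrakk>0 \<le> u; u \<le> \<delta>1; 0 \<le> v; v \<le> \<delta>1\<rbrakk> \<Longrightarrow> \<bar>b v - b u - c * (v - u)\<bar> \<le> ((1 - \<kappa>) * c) * \<bar>v - u\<bar>"
    using strict_deriv0D[OF b_der] by metis
  have "(1 / \<kappa> - 1) * c > 0" using \<kappa> c by (simp add: field_simps)
  then obtain \<delta>2 where \<delta>2: "\<delta>2 > 0"
      "\<And>u v. \<lbrakk>0 \<le> u; u \<le> \<delta>2; 0 \<le> v; v \<le> \<delta>2\<rbrakk> \<Longrightarrow> \<bar>b v - b u - c * (v - u)\<bar> \<le> ((1 / \<kappa> - 1) * c) * \<bar>v - u\<bar>"
    using strict_deriv0D[OF b_der] by metis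
  have "\<forall>\<^sub>F n in sequentially. y n < min \<delta>1 \<delta>2"
    using order_tendstoD(2)[OF y_lim, of "min \<delta>1 \<delta>2"] \<delta>1 \<delta>2 by simp
  with ratio have step: "\<forall>\<^sub>F n in sequentially.
    D (Suc n) * M n \<ge> \<kappa> * \<kappa> * c * D n * M (Suc n) \<and> \<kappa> * y (Suc n) \<le> c * y n"
  proof eventually_elim
    case (elim n)
    obtain e where e: "e \<in> E" "M (Suc n) = T (Suc n) e" using M_ex by blast
    obtain k where k: "k \<in> E" "D n = \<alpha> k (x n) - x n" using D_ex by blast
    have eK: "e \<in> carrier K" "\<theta> e \<in> carrier K" and kK: "k \<in> carrier K"
      using e k E_sub \<theta>K by auto
    define \<rho> where "\<rho> = M (Suc n) / M n"
    have \<rho>: "\<rho> \<in> {1/C2..C1}" using M_up[of n] M_down[of n] M_pos[of n] C2 C1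
      by (simp add: \<rho>_def field_simps)
    \<comment> \<open>Since \<open>T n k \<le> M n\<close>, the quotient of the two iterates has
      positive value under \<open>T n\<close>; this holds for the \<open>k\<close> realizing
      \<open>D n\<close> even if it does not realize \<open>M n\<close>.\<close>
    have iter: "\<alpha> (k [^] p) (x n) < \<alpha> (\<theta> e [^] q) (x n)" if "real p < real q * \<rho>" for p q :: nat
    proof -
      have "T n (inv (k [^] p) \<otimes> \<theta> e [^] q) = q * M (Suc n) - p * T n k"
        using eK kK e(2) by (simp add: real_hom_mult[OF T_hom] real_hom_inv[OF T_hom] real_hom_pow[OF T_hom] T_Suc)
      moreover have "p * T n k \<le> p * M n" using T_le[OF k(1)] by (intro mult_left_mono) auto
      moreover have "p * M n < q * M (Suc n)" using that M_pos[of n] by (simp add: \<rho>_def field_simps)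
      ultimately have "x n < \<alpha> (inv (k [^] p) \<otimes> \<theta> e [^] q) (x n)"
        using eK kK by (intro T_sign) auto
      then have "x n < \<alpha> (inv (k [^] p)) (\<alpha> (\<theta> e [^] q) (x n))"
        using eK kK x01[of n] by (simp only: act_mult inv_closed nat_pow_closed)
      then show ?thesis
        using less_act_inv_iff[of "k [^] p" "\<alpha> (\<theta> e [^] q) (x n)" "x n"] eK kK
          act_closed[of "\<theta> e [^] q" "x n"] xy[of n] by simp
    qed
    have ge: "x n < \<alpha> (\<theta> e) (x n)"
      using T_sign[OF eK(2), of n] e(2) M_pos[of "Suc n"] by (simp add: T_Suc)
    have kx: "x n \<le> \<alpha> k (x n)" using k(2) D_pos[of n] by simp
    have "\<kappa> * \<rho> * (\<alpha> k (x n) - x n) \<le> \<alpha> (\<theta> e) (x n) - x n"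
      using elim(1) e(1) k(1) \<rho> iter ge kx by (meson less_imp_le)
    then have 1: "\<kappa> * \<rho> * D n \<le> \<alpha> (\<theta> e) (x n) - x n" using k by simp
    have "\<bar>b (\<alpha> (\<theta> e) (x n)) - b (x n) - c * (\<alpha> (\<theta> e) (x n) - x n)\<bar> \<le> (1 - \<kappa>) * c * \<bar>\<alpha> (\<theta> e) (x n) - x n\<bar>"
      using \<delta>1(2)[of "x n" "\<alpha> (\<theta> e) (x n)"] xy[of n] ge act_lt[OF eK(2), of n] elim(2) by simp
    then have "b (\<alpha> (\<theta> e) (x n)) - b (x n) \<ge> \<kappa> * c * (\<alpha> (\<theta> e) (x n) - x n)"
      using ge by (simp add: abs_le_iff algebra_simps)
    moreover have "b (\<alpha> (\<theta> e) (x n)) - b (x n) \<le> D (Suc n)"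
      using equiv[OF eK(1), of "x n"] D_ge[OF e(1), of "Suc n"] xy[of n] by (simp add: Suc_xy)
    moreover have "\<kappa> * c * (\<kappa> * \<rho> * D n) \<le> \<kappa> * c * (\<alpha> (\<theta> e) (x n) - x n)"
      using 1 \<kappa> c by (intro mult_left_mono) auto
    ultimately have "\<kappa> * c * (\<kappa> * \<rho> * D n) \<le> D (Suc n)" by linarith
    then have A: "\<kappa> * \<kappa> * c * D n * M (Suc n) \<le> D (Suc n) * M n"
      using M_pos[of n] by (simp add: \<rho>_def field_simps)
    have "\<bar>b (y n) - b 0 - c * (y n - 0)\<bar> \<le> (1 / \<kappa> - 1) * c * \<bar>y n - 0\<bar>"
      using \<delta>2(2)[of 0 "y n"] \<delta>2(1) xy[of n] elim(2) by simp
    then have "b (y n) \<le> c * y n / \<kappa>"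
      using xy[of n] b0 by (simp add: abs_le_iff algebra_simps)
    then have "\<kappa> * y (Suc n) \<le> c * y n" using \<kappa> by (simp add: Suc_xy field_simps)
    with A show ?case by simp
  qed
  then obtain N where N: "\<And>n. n \<ge> N \<Longrightarrow> D (Suc n) * M n \<ge> \<kappa> * \<kappa> * c * D n * M (Suc n)"
      "\<And>n. n \<ge> N \<Longrightarrow> \<kappa> * y (Suc n) \<le> c * y n"
    by (auto simp: eventually_sequentially)
  have y_pos: "y n > 0" for n using xy[of n] by simp
  \<comment> \<open>\<open>D n < y n\<close> gives \<open>Q n * M n < 1\<close>, while
    \<open>Q\<close> shrinks at most by the factor \<open>s\<close> per step. Hence
    \<open>M n\<close> grows at most like \<open>s ^ n\<close>.\<close>
  define Q where "Q n = D n / (M n * y n)" for n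
  have Q_pos: "Q n > 0" for n using D_pos M_pos y_pos by (simp add: Q_def)
  have Q_step: "Q n \<le> s * Q (Suc n)" if "n \<ge> N" for n
  proof -
    have "\<kappa> ^ 3 * Q n \<le> Q (Suc n)"
    proof -
      have "(\<kappa> * \<kappa> * c * D n * M (Suc n)) * (\<kappa> * y (Suc n)) \<le> (D (Suc n) * M n) * (c * y n)"
        using D_pos M_pos y_pos \<kappa>(1) by (intro mult_mono[OF N(1)[OF that] N(2)[OF that]]) (auto simp: less_imp_le)
      then have "c * (\<kappa> ^ 3 * D n * M (Suc n) * y (Suc n)) \<le> c * (D (Suc n) * M n * y n)"
        by (simp add: power3_eq_cube algebra_simps)
      then have "\<kappa> ^ 3 * D n * M (Suc n) * y (Suc n) \<le> D (Suc n) * M n * y n" using c by simp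
      then show ?thesis using M_pos[of n] M_pos[of "Suc n"] y_pos[of n] y_pos[of "Suc n"]
        by (simp add: Q_def field_simps)
    qed
    then show ?thesis using s \<kappa>(3) by (simp add: field_simps)
  qed
  have Q_low: "Q N \<le> s ^ n * Q (N + n)" for n
  proof (induction n)
    case (Suc n)
    have "s ^ n * Q (N + n) \<le> s ^ n * (s * Q (Suc (N + n)))"
      using Q_step[of "N + n"] s by (intro mult_left_mono) auto
    then show ?case using Suc by (simp add: algebra_simps)
  qed simp
  have M_late: "M (N + n) \<le> s ^ n / Q N" for n
  proof -
    have "Q (N + n) * M (N + n) \<le> 1"
      using D_less[of "N + n"] M_pos[of "N + n"] y_pos[of "N + n"] by (simp add: Q_def field_simps)
    moreover have "Q N * M (N + n) \<le> s ^ n * Q (N + n) * M (N + n)"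
      using Q_low[of n] M_pos[of "N + n"] by (intro mult_right_mono) auto
    moreover have "s ^ n * (Q (N + n) * M (N + n)) \<le> s ^ n * 1"
      using calculation(1) s by (intro mult_left_mono) auto
    ultimately have "Q N * M (N + n) \<le> s ^ n" by (simp add: mult.assoc)
    then show ?thesis using Q_pos[of N] by (simp add: field_simps)
  qed
  \<comment> \<open>The sum covers the finitely many indices before the asymptotic estimates set
    in.\<close>
  define C where "C = 1 / Q N + (\<Sum>i<N. M i)"
  have M_all: "M n \<le> C * s ^ n" for n
  proof (cases "n < N")
    case True
    have "M n \<le> (\<Sum>i<N. M i)" using True M_pos by (intro member_le_sum) (auto simp: less_imp_le)
    also have "\<dots> \<le> C" using Q_pos[of N] by (simp add: C_def)
    also have "\<dots> \<le> C * s ^ n"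
    proof -
      have "0 \<le> C" using calculation M_pos[of n] by linarith
      then show ?thesis using s mult_left_mono[of 1 "s ^ n" C] one_le_power[of s n] by simp
    qed
    finally show ?thesis .
  next
    case False
    have "M n \<le> s ^ (n - N) / Q N" using M_late[of "n - N"] False by simp
    also have "\<dots> \<le> s ^ n / Q N"
      using s Q_pos[of N] by (intro divide_right_mono power_increasing) auto
    also have "\<dots> \<le> C * s ^ n"
    proof -
      have "(\<Sum>i<N. M i) \<ge> 0" using M_pos by (intro sum_nonneg) (auto simp: less_imp_le)
      then have "1 / Q N * s ^ n \<le> C * s ^ n" using s by (intro mult_right_mono) (auto simp: C_def)
      then show ?thesis by simp
    qed
    finally show ?thesis .
  qed
  obtain C' where C': "C' \<ge> 0" "\<And>n. \<bar>T n h\<bar> \<le> C' * M n" using M_bound[OF h] by blast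
  have "\<bar>\<tau> ((\<theta> ^^ n) h)\<bar> \<le> (C' * C) * s ^ n" for n
    using C'(2)[of n] mult_left_mono[OF M_all C'(1), of n] by (simp add: T_def mult.assoc)
  then show ?thesis by blast
qed

end

section \<open>Reflection of the interval\<close>

text \<open>Conjugation by the reflection of the unit interval; \<open>strict_deriv0\<close> of the
  conjugate describes \<open>f\<close> at the end point 1.\<close>

definition unit_flip :: "(real \<Rightarrow> real) \<Rightarrow> real \<Rightarrow> real"
  where "unit_flip f x = 1 - f (1 - x)"

lemma strict_mono_on_flip:
  assumes "strict_mono_on {0..1} f"
  shows "strict_mono_on {0..1} (unit_flip f)"
  using assms by (auto simp: strict_mono_on_def unit_flip_def)

lemma unit_flip_flip [simp]: "unit_flip (unit_flip f) = f"
  by (simp add: unit_flip_def fun_eq_iff)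

lemma funpow_flip: "(unit_flip f ^^ n) x = 1 - (f ^^ n) (1 - x)"
  by (induction n) (simp_all add: unit_flip_def)

lemma (in interval_action) flip: "interval_action K (\<lambda>h. unit_flip (\<alpha> h))"
proof
  fix h assume h: "h \<in> carrier K"
  show "strict_mono_on {0..1} (unit_flip (\<alpha> h))" using mono[OF h] by (rule strict_mono_on_flip)
  have "bij_betw (\<lambda>x. 1 - x) {0..1} {0..1::real}"
    by (rule bij_betwI[of _ _ _ "\<lambda>x. 1 - x"]) auto
  then have "bij_betw ((\<lambda>x. 1 - x) \<circ> (\<alpha> h \<circ> (\<lambda>x. 1 - x))) {0..1} {0..1}"
    using bij[OF h] by (intro bij_betw_trans)
  then show "bij_betw (unit_flip (\<alpha> h)) {0..1} {0..1}" by (simp add: unit_flip_def[abs_def] o_def)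
next
  fix h k and x :: real assume "h \<in> carrier K" "k \<in> carrier K" "x \<in> {0..1}"
  then show "unit_flip (\<alpha> (h \<otimes> k)) x = unit_flip (\<alpha> h) (unit_flip (\<alpha> k) x)"
    by (simp add: unit_flip_def act_mult)
qed

lemma (in interval_action) orbit_reaches_1:
  assumes nofix: "\<And>y. y \<in> {0<..<1} \<Longrightarrow> \<exists>h\<in>carrier K. \<alpha> h y \<noteq> y"
    and x: "x \<in> {0<..<1}" and y: "y < 1"
  shows "\<exists>h\<in>carrier K. y < \<alpha> h x"
proof -
  interpret F: interval_action K "\<lambda>h. unit_flip (\<alpha> h)" by (rule flip)
  have "\<exists>h\<in>carrier K. unit_flip (\<alpha> h) z \<noteq> z" if "z \<in> {0<..<1}" for z
    using nofix[of "1 - z"] that by (force simp: unit_flip_def)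
  then have "\<exists>h\<in>carrier K. unit_flip (\<alpha> h) (1 - x) < 1 - y"
    using x y by (intro F.orbit_reaches_0) auto
  then show ?thesis by (force simp: unit_flip_def)
qed

lemma strict_deriv0_cong:
  assumes "strict_deriv0 f c" "\<And>x. x \<in> {0..1} \<Longrightarrow> f x = g x"
  shows "strict_deriv0 g c"
  unfolding strict_deriv0_def
proof (intro allI impI)
  fix e :: real assume "e > 0"
  then obtain \<delta> where \<delta>: "\<delta> > 0" "\<delta> \<le> 1"
    "\<And>x y. \<lbrakk>0 \<le> x; x \<le> \<delta>; 0 \<le> y; y \<le> \<delta>\<rbrakk> \<Longrightarrow> \<bar>f y - f x - c * (y - x)\<bar> \<le> e * \<bar>y - x\<bar>"
    using strict_deriv0D[OF assms(1)] by metis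
  have "\<bar>g y - g x - c * (y - x)\<bar> \<le> e * (y - x)" if "0 \<le> x" "x \<le> y" "y \<le> \<delta>" for x y
    using \<delta>(3)[of x y] assms(2)[of x] assms(2)[of y] that \<delta>(2) by simp
  then show "\<exists>\<delta>>0. \<forall>x y. 0 \<le> x \<longrightarrow> x \<le> y \<longrightarrow> y \<le> \<delta> \<longrightarrow> \<bar>g y - g x - c * (y - x)\<bar> \<le> e * (y - x)"
    using \<delta>(1) by blast
qed

section \<open>Actions normalized by a map of the interval\<close>

text \<open>The inverses \<open>\<theta>'\<close> and \<open>a'\<close> are separate parameters and
  the assumptions are symmetric, so that \<open>swap\<close> (time reversal) and
  \<open>twisted_flip\<close> (reflection) yield new instances. The matrix survives only in
  \<open>hyperbolic\<close>.\<close>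

locale twisted_action = finite_rank_action K \<alpha> E
  for K :: "('h, 'b) monoid_scheme" (structure) and \<alpha> E +
  fixes \<theta> \<theta>' :: "'h \<Rightarrow> 'h" and a a' :: "real \<Rightarrow> real"
  assumes \<theta>_hom: "\<theta> \<in> hom K K" "\<theta>' \<in> hom K K"
    and \<theta>_inv: "h \<in> carrier K \<Longrightarrow> \<theta> (\<theta>' h) = h" "h \<in> carrier K \<Longrightarrow> \<theta>' (\<theta> h) = h"
    and a_mono: "strict_mono_on {0..1} a" "strict_mono_on {0..1} a'"
    and a_01: "x \<in> {0..1} \<Longrightarrow> a x \<in> {0..1}" "x \<in> {0..1} \<Longrightarrow> a' x \<in> {0..1}"
    and a_inv: "x \<in> {0..1} \<Longrightarrow> a (a' x) = x" "x \<in> {0..1} \<Longrightarrow> a' (a x) = x"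
    and equiv: "\<lbrakk>h \<in> carrier K; x \<in> {0..1}\<rbrakk> \<Longrightarrow> a (\<alpha> h x) = \<alpha> (\<theta> h) (a x)"
    and no_common_fixed: "\<lbrakk>x \<in> {0<..<1}; \<And>h. h \<in> carrier K \<Longrightarrow> \<alpha> h x = x\<rbrakk> \<Longrightarrow> a x \<noteq> x"
    and act_deriv: "h \<in> carrier K \<Longrightarrow> \<exists>c>0. strict_deriv0 (\<alpha> h) c"
      "h \<in> carrier K \<Longrightarrow> \<exists>c>0. strict_deriv0 (unit_flip (\<alpha> h)) c"
    and a_deriv: "\<exists>c>0. strict_deriv0 a c" "\<exists>c>0. strict_deriv0 (unit_flip a) c"
      "\<exists>c>0. strict_deriv0 a' c" "\<exists>c>0. strict_deriv0 (unit_flip a') c"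
    and hyperbolic: "\<lbrakk>real_hom K \<tau>;
      \<And>h s. \<lbrakk>h \<in> carrier K; s > 1\<rbrakk> \<Longrightarrow> \<exists>C. \<forall>n. \<bar>\<tau> ((\<theta> ^^ n) h)\<bar> \<le> C * s ^ n;
      \<And>h s. \<lbrakk>h \<in> carrier K; s > 1\<rbrakk> \<Longrightarrow> \<exists>C. \<forall>n. \<bar>\<tau> ((\<theta>' ^^ n) h)\<bar> \<le> C * s ^ n;
      h \<in> carrier K\<rbrakk> \<Longrightarrow> \<tau> h = 0"
begin

lemma \<theta>_closed [simp]: "h \<in> carrier K \<Longrightarrow> \<theta> h \<in> carrier K" "h \<in> carrier K \<Longrightarrow> \<theta>' h \<in> carrier K"
  using \<theta>_hom by (auto simp: hom_def Pi_iff)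

lemma a_less_iff: "\<lbrakk>x \<in> {0..1}; y \<in> {0..1}\<rbrakk> \<Longrightarrow> a x < a y \<longleftrightarrow> x < y"
  using a_mono(1) by (metis strict_mono_on_less)

lemma a_0: "a 0 = 0"
proof -
  have "a 0 \<le> a (a' 0)" using a_less_iff[of "a' 0" 0] a_01(2)[of 0] by force
  then show ?thesis using a_inv(1)[of 0] a_01(1)[of 0] by simp
qed

lemma a_1: "a 1 = 1"
proof -
  have "a (a' 1) \<le> a 1" using a_less_iff[of 1 "a' 1"] a_01(2)[of 1] by force
  then show ?thesis using a_inv(1)[of 1] a_01(1)[of 1] by simp
qed

lemma a_interior: "x \<in> {0<..<1} \<Longrightarrow> a x \<in> {0<..<1}"
  using a_less_iff[of 0 x] a_less_iff[of x 1] by (simp add: a_0 a_1)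

lemma equiv': 
  assumes "h \<in> carrier K" "x \<in> {0..1}"
  shows "a' (\<alpha> h x) = \<alpha> (\<theta>' h) (a' x)"
proof -
  have "a (\<alpha> (\<theta>' h) (a' x)) = \<alpha> h x"
    using equiv[of "\<theta>' h" "a' x"] a_01(2)[of x] assms by (simp add: \<theta>_inv a_inv)
  then show ?thesis
    using a_inv(2)[of "\<alpha> (\<theta>' h) (a' x)"] a_01(2)[of x] assms act_closed[of "\<theta>' h" "a' x"] by simp
qed

lemma swap: "twisted_action K \<alpha> E \<theta>' \<theta> a' a"
proof
  fix x :: real assume x: "x \<in> {0<..<1}" and f: "\<And>h. h \<in> carrier K \<Longrightarrow> \<alpha> h x = x"
  show "a' x \<noteq> x"
  proof
    assume "a' x = x"
    then have "a x = x" using a_inv(1)[of x] x by simp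
    then show False using no_common_fixed[OF x f] by simp
  qed
qed (use \<theta>_hom \<theta>_inv a_mono a_01 a_inv equiv' act_deriv a_deriv hyperbolic in auto)

lemma twisted_flip: "twisted_action K (\<lambda>h. unit_flip (\<alpha> h)) E \<theta> \<theta>' (unit_flip a) (unit_flip a')"
proof -
  interpret F: interval_action K "\<lambda>h. unit_flip (\<alpha> h)" by (rule flip)
  show ?thesis
  proof
    fix x :: real assume x: "x \<in> {0<..<1}" and f: "\<And>h. h \<in> carrier K \<Longrightarrow> unit_flip (\<alpha> h) x = x"
    have "a (1 - x) \<noteq> 1 - x"
    proof (rule no_common_fixed)
      show "1 - x \<in> {0<..<1}" using x by simp
      show "\<alpha> h (1 - x) = 1 - x" if "h \<in> carrier K" for h
        using f[OF that] by (simp add: unit_flip_def)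
    qed
    then show "unit_flip a x \<noteq> x" by (simp add: unit_flip_def)
  next
    fix h and x :: real assume "h \<in> carrier K" "x \<in> {0..1}"
    then show "unit_flip a (unit_flip (\<alpha> h) x) = unit_flip (\<alpha> (\<theta> h)) (unit_flip a x)"
      using equiv[of h "1 - x"] by (simp add: unit_flip_def)
  next
    fix x :: real assume "x \<in> {0..1}"
    then show "unit_flip a x \<in> {0..1}" "unit_flip a' x \<in> {0..1}"
       "unit_flip a (unit_flip a' x) = x" "unit_flip a' (unit_flip a x) = x"
      using a_01[of "1 - x"] a_inv[of "1 - x"] by (simp_all add: unit_flip_def)
  qed (use \<theta>_hom \<theta>_inv a_mono act_deriv a_deriv hyperbolic strict_mono_on_flip in auto)
qed

text \<open>
  The logarithm of the derivative at 0 is a \<open>\<theta>\<close>-invariant homomorphism, hence trivial.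
\<close>
lemma deriv_at_0:
  assumes h: "h \<in> carrier K"
  shows "strict_deriv0 (\<alpha> h) 1"
proof -
  have "\<forall>h\<in>carrier K. \<exists>c>0. strict_deriv0 (\<alpha> h) c" using act_deriv by blast
  then obtain c where c: "\<And>h. h \<in> carrier K \<Longrightarrow> c h > 0 \<and> strict_deriv0 (\<alpha> h) (c h)" by metis
  have mono_on: "mono_on {0..1} (\<alpha> h)" if "h \<in> carrier K" for h
    using mono[OF that] by (rule strict_mono_on_imp_mono_on)
  have c_mult: "c (h \<otimes> k) = c h * c k" if "h \<in> carrier K" "k \<in> carrier K" for h k
  proof -
    have "strict_deriv0 (\<lambda>x. \<alpha> h (\<alpha> k x)) (c h * c k)"
      using c that act_0 mono_on by (intro strict_deriv0_compose) auto
    then have "strict_deriv0 (\<alpha> (h \<otimes> k)) (c h * c k)"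
      by (rule strict_deriv0_cong) (use that in \<open>simp add: act_mult\<close>)
    then show ?thesis using strict_deriv0_unique c that by blast
  qed
  \<comment> \<open>The chain rule on both sides of \<open>equiv\<close>; the derivative of
    \<open>a\<close> at 0 cancels.\<close>
  have c_\<theta>: "c (\<theta> h) = c h" if "h \<in> carrier K" for h
  proof -
    obtain d where d: "d > 0" "strict_deriv0 a d" using a_deriv by blast
    have "strict_deriv0 (\<lambda>x. a (\<alpha> h x)) (d * c h)"
      using c that act_0 mono_on d by (intro strict_deriv0_compose) auto
    then have "strict_deriv0 (\<lambda>x. \<alpha> (\<theta> h) (a x)) (d * c h)"
      by (rule strict_deriv0_cong) (use that in \<open>simp add: equiv\<close>)
    moreover have "strict_deriv0 (\<lambda>x. \<alpha> (\<theta> h) (a x)) (c (\<theta> h) * d)"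
      using c that d a_0 strict_mono_on_imp_mono_on[OF a_mono(1)] by (intro strict_deriv0_compose) auto
    ultimately have "d * c h = c (\<theta> h) * d" by (rule strict_deriv0_unique)
    then show ?thesis using d by simp
  qed
  have c_\<theta>': "c (\<theta>' h) = c h" if "h \<in> carrier K" for h
    using c_\<theta>[of "\<theta>' h"] that by (simp add: \<theta>_inv)
  have inv: "(\<theta> ^^ n) h \<in> carrier K \<and> c ((\<theta> ^^ n) h) = c h \<and>
      (\<theta>' ^^ n) h \<in> carrier K \<and> c ((\<theta>' ^^ n) h) = c h" if "h \<in> carrier K" for h n
    by (induction n) (use that c_\<theta> c_\<theta>' in auto)
  have "ln (c h) = 0"
  proof (rule hyperbolic[of "\<lambda>h. ln (c h)"])
    show "real_hom K (\<lambda>h. ln (c h))"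
      unfolding real_hom_def
    proof (intro ballI)
      fix h k assume "h \<in> carrier K" "k \<in> carrier K"
      then show "ln (c (h \<otimes> k)) = ln (c h) + ln (c k)"
        using c[of h] c[of k] c_mult[of h k] by (simp add: ln_mult_pos)
    qed
    fix h and s :: real assume h: "h \<in> carrier K" and "s > 1"
    then have "\<bar>ln (c h)\<bar> \<le> \<bar>ln (c h)\<bar> * s ^ n" for n
      using mult_left_mono[of 1 "s ^ n" "\<bar>ln (c h)\<bar>"] one_le_power[of s n] by simp
    then show "\<exists>C. \<forall>n. \<bar>ln (c ((\<theta> ^^ n) h))\<bar> \<le> C * s ^ n"
      "\<exists>C. \<forall>n. \<bar>ln (c ((\<theta>' ^^ n) h))\<bar> \<le> C * s ^ n" using inv[OF h] by auto
  qed fact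
  then have "c h = 1" using c[OF h] by simp
  then show ?thesis using c[OF h] by simp
qed

end

sublocale twisted_action \<subseteq> flat_finite_rank_action K \<alpha> E
  by unfold_locales (rule deriv_at_0)

context twisted_action
begin

text \<open>The iterates decrease through fixed points of \<open>K\<close>. Their limit is fixed by
  \<open>K\<close> and by \<open>a\<close>, so it cannot be interior. Monotonicity takes the place
  of continuity in passing to the limit.\<close>

lemma fixed_iterates_tendsto_0:
  assumes p: "p \<in> {0<..<1}" "\<And>h. h \<in> carrier K \<Longrightarrow> \<alpha> h p = p" and ap: "a p < p"
  shows "(\<lambda>n. (a ^^ n) p) \<longlonglongrightarrow> 0"
proof -
  define X where "X n = (a ^^ n) p" for n
  have X: "X n \<in> {0<..<1} \<and> (\<forall>h\<in>carrier K. \<alpha> h (X n) = X n) \<and> X (Suc n) < X n" for n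
  proof (induction n)
    case 0
    then show ?case using p ap by (simp add: X_def)
  next
    case (Suc n)
    have 1: "X (Suc n) \<in> {0<..<1}" using a_interior[of "X n"] Suc by (simp add: X_def)
    have 2: "\<alpha> h (X (Suc n)) = X (Suc n)" if "h \<in> carrier K" for h
      using equiv[of "\<theta>' h" "X n"] Suc that by (simp add: \<theta>_inv X_def)
    have 3: "X (Suc (Suc n)) < X (Suc n)"
      using a_less_iff[of "X (Suc n)" "X n"] Suc 1 by (simp add: X_def)
    show ?case using 1 2 3 by blast
  qed
  have "decseq X" using X by (intro decseq_SucI) (simp add: less_imp_le)
  moreover have "\<forall>n. 0 \<le> X n" using X by (simp add: less_imp_le)
  ultimately obtain L where L: "X \<longlonglongrightarrow> L" "\<forall>n. L \<le> X n"
    using decseq_convergent by blast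
  have LX: "L < X n" for n using L(2)[rule_format, of "Suc n"] X[of n] by simp
  have below: "\<exists>n. X n < z" if "L < z" for z
    using order_tendstoD(2)[OF L(1) that] by (auto simp: eventually_sequentially)
  have L0: "L \<ge> 0" using LIMSEQ_le_const[OF L(1)] X by (meson greaterThanLessThan_iff less_imp_le)
  have L1: "L < 1" using LX[of 0] X[of 0] by simp
  have "L = 0"
  proof (rule ccontr)
    assume "L \<noteq> 0"
    then have Lin: "L \<in> {0<..<1}" using L0 L1 by simp
    have not: "\<not> L < \<alpha> h L" if h: "h \<in> carrier K" for h
    proof
      assume "L < \<alpha> h L"
      then obtain n where "X n < \<alpha> h L" using below by blast
      then have "\<alpha> h (X n) < \<alpha> h L" using X[of n] h by simp
      then have "X n < L" using act_less_iff[of h "X n" L] h X[of n] Lin by simp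
      then show False using LX[of n] by simp
    qed
    have Lfix: "\<alpha> h L = L" if h: "h \<in> carrier K" for h
    proof -
      have "\<not> \<alpha> h L < L" using not[of "inv h"] less_act_inv_iff[of h L L] h Lin by simp
      then show ?thesis using not[OF h] by simp
    qed
    have "\<not> a L < L"
    proof
      assume "a L < L"
      then have "L < a' L"
        using a_less_iff[of L "a' L"] Lin a_01(2)[of L] a_inv(1)[of L] by simp
      then obtain n where n: "X n < a' L" using below by blast
      then have "a (X n) < L"
        using a_less_iff[of "X n" "a' L"] Lin a_01(2)[of L] a_inv(1)[of L] X[of n] by simp
      then show False using LX[of "Suc n"] by (simp add: X_def)
    qed
    moreover have "\<not> L < a L"
    proof
      assume "L < a L"
      then obtain n where n: "X n < a L" using below by blast
      then have "a (X n) < a L" using X[of n] by (simp add: X_def)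
      then have "X n < L" using a_less_iff[of "X n" L] X[of n] Lin by simp
      then show False using LX[of n] by simp
    qed
    ultimately show False using no_common_fixed[OF Lin Lfix] by simp
  qed
  then show ?thesis using L(1) by (simp add: X_def[abs_def])
qed

text \<open>If \<open>x\<close> were moved, its orbit near 0 would bound the growth of its
  functional under \<open>\<theta>'\<close>, and its orbit near 1 the growth under
  \<open>\<theta>\<close>. Together these are the premises of \<open>hyperbolic\<close>.\<close>

lemma trivial_if_contracted_fixed:
  assumes p: "p \<in> {0<..<1}" "\<And>h. h \<in> carrier K \<Longrightarrow> \<alpha> h p = p" and ap: "a p < p"
    and x: "x \<in> {0<..<1}" and h: "h \<in> carrier K"
  shows "\<alpha> h x = x"
proof (rule ccontr)
  assume hx: "\<alpha> h x \<noteq> x"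
  interpret F: twisted_action K "\<lambda>h. unit_flip (\<alpha> h)" E \<theta>' \<theta> "unit_flip a'" "unit_flip a"
    using twisted_action.twisted_flip[OF swap] .
  interpret S: twisted_action K \<alpha> E \<theta>' \<theta> a' a by (rule swap)
  \<comment> \<open>By \<open>equiv\<close> the translates of \<open>p\<close> under
    \<open>a\<close> and \<open>a'\<close> are again fixed by \<open>K\<close>. They tend to 0 and
    to 1, so some of them enclose \<open>x\<close> as required at each end.\<close>
  have up: "(a' ^^ n) p \<in> {0<..<1} \<and> (\<forall>h\<in>carrier K. \<alpha> h ((a' ^^ n) p) = (a' ^^ n) p) \<and>
      a ((a' ^^ n) p) < (a' ^^ n) p" for n
  proof (induction n)
    case 0
    then show ?case using p ap by simp
  next
    case (Suc n)
    let ?y = "(a' ^^ n) p"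
    have y: "?y \<in> {0..1}" using Suc by simp
    have 1: "a' ?y \<in> {0<..<1}" using S.a_interior Suc by blast
    have 2: "\<alpha> h (a' ?y) = a' ?y" if "h \<in> carrier K" for h
      using equiv'[of "\<theta> h" ?y] Suc that by (simp add: \<theta>_inv)
    have "a' (a ?y) < a' ?y" using S.a_less_iff[of "a ?y" ?y] Suc a_01(1)[OF y] y by simp
    then have "a (a' ?y) < a' ?y" using y by (simp add: a_inv)
    then show ?case using 1 2 by simp
  qed
  have down: "(a ^^ n) p \<in> {0<..<1} \<and> (\<forall>h\<in>carrier K. \<alpha> h ((a ^^ n) p) = (a ^^ n) p) \<and>
      a ((a ^^ n) p) < (a ^^ n) p" for n
  proof (induction n)
    case 0
    then show ?case using p ap by simp
  next
    case (Suc n)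
    let ?y = "(a ^^ n) p"
    have y: "?y \<in> {0..1}" using Suc by simp
    have 1: "a ?y \<in> {0<..<1}" using a_interior Suc by blast
    have 2: "\<alpha> h (a ?y) = a ?y" if "h \<in> carrier K" for h
      using equiv[of "\<theta>' h" ?y] Suc that by (simp add: \<theta>_inv)
    have "a (a ?y) < a ?y" using a_less_iff[of "a ?y" ?y] Suc a_01(1)[OF y] y by simp
    then show ?case using 1 2 by simp
  qed
  have flip_contr: "unit_flip a' (1 - y) < 1 - y" if "y \<in> {0<..<1}" "a y < y" for y
    using S.a_less_iff[of "a y" y] that a_01(1)[of y] a_inv(2)[of y] by (simp add: unit_flip_def)
  have lim0: "(\<lambda>n. (a ^^ n) y) \<longlonglongrightarrow> 0"
    if "y \<in> {0<..<1}" "\<And>h. h \<in> carrier K \<Longrightarrow> \<alpha> h y = y" "a y < y" for y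
    using that by (rule fixed_iterates_tendsto_0)
  have lim1: "(\<lambda>n. (unit_flip a' ^^ n) (1 - y)) \<longlonglongrightarrow> 0"
    if "y \<in> {0<..<1}" "\<And>h. h \<in> carrier K \<Longrightarrow> \<alpha> h y = y" "a y < y" for y
    using that flip_contr by (intro F.fixed_iterates_tendsto_0) (auto simp: unit_flip_def)
  obtain m where m: "(unit_flip a' ^^ m) (1 - p) < 1 - x"
    using order_tendstoD(2)[OF lim1[OF p ap], of "1 - x"] x by (auto simp: eventually_sequentially)
  define p1 where "p1 = (a' ^^ m) p"
  have p1: "p1 \<in> {0<..<1}" "\<And>h. h \<in> carrier K \<Longrightarrow> \<alpha> h p1 = p1" "a p1 < p1" "x < p1"
    using up[of m] m by (auto simp: p1_def funpow_flip)
  obtain m' where m': "(a ^^ m') p < x"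
    using order_tendstoD(2)[OF lim0[OF p ap], of x] x by (auto simp: eventually_sequentially)
  define p2 where "p2 = (a ^^ m') p"
  have p2: "p2 \<in> {0<..<1}" "\<And>h. h \<in> carrier K \<Longrightarrow> \<alpha> h p2 = p2" "a p2 < p2" "p2 < x"
    using down[of m'] m' by (auto simp: p2_def)
  obtain \<tau> f where \<tau>: "real_hom K \<tau>" "f \<in> carrier K" "\<tau> f > 0"
    "\<And>h. \<lbrakk>h \<in> carrier K; \<tau> h > 0\<rbrakk> \<Longrightarrow> x < \<alpha> h x"
    using ordering_functional[OF x] h hx by metis
  obtain c where c: "c > 0" "strict_deriv0 a c" using a_deriv by blast
  obtain c' where c': "c' > 0" "strict_deriv0 (unit_flip a') c'" using a_deriv by blast
  have surj: "\<theta> ` carrier K = carrier K" "\<theta>' ` carrier K = carrier K"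
    using bij_betw_imp_surj_on[OF bij_betwI[of \<theta> "carrier K" "carrier K" \<theta>']]
      bij_betw_imp_surj_on[OF bij_betwI[of \<theta>' "carrier K" "carrier K" \<theta>]] \<theta>_inv by simp_all
  \<comment> \<open>\<open>a\<close> conjugates \<open>\<theta>' h\<close> to \<open>h\<close>, so
    the orbit contracted to 0 controls iterates of \<open>\<theta>'\<close>.\<close>
  have "\<exists>C. \<forall>n. \<bar>\<tau> ((\<theta>' ^^ n) k)\<bar> \<le> C * s ^ n" if "k \<in> carrier K" "s > 1" for k s
    by (rule subexponential_growth[where b = a and p = p1 and ?x0.0 = x and ?h1.0 = f and c = c])
      (use that a_mono a_01 a_0 c \<theta>_hom surj p1 x \<tau> lim0[OF p1(1-3)] in
        \<open>auto simp: equiv \<theta>_inv\<close>)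
  \<comment> \<open>Reflection reverses the order, so the ordering functional at
    \<open>1 - x\<close> is \<open>- \<tau>\<close>; the fixed point below \<open>x\<close> becomes
    one above \<open>1 - x\<close>.\<close>
  moreover have "\<exists>C. \<forall>n. \<bar>- \<tau> ((\<theta> ^^ n) k)\<bar> \<le> C * s ^ n" if "k \<in> carrier K" "s > 1" for k s
  proof (rule F.subexponential_growth[where b = "unit_flip a'" and p = "1 - p2" and ?x0.0 = "1 - x"
        and ?h1.0 = f and c = c' and \<tau> = "\<lambda>h. - \<tau> h"])
    show "1 - x < unit_flip (\<alpha> h) (1 - x)" if "h \<in> carrier K" "- \<tau> h > 0" for h
      using \<tau>(4)[of "inv h"] that real_hom_inv[OF \<tau>(1), of h] less_act_inv_iff[of h x x] x
      by (simp add: unit_flip_def)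
    show "unit_flip a' (unit_flip (\<alpha> (\<theta> h)) x) = unit_flip (\<alpha> h) (unit_flip a' x)"
      if "h \<in> carrier K" "x \<in> {0..1}" for h x
      using that F.equiv[of "\<theta> h" x] by (simp add: \<theta>_inv)
  qed (use that F.a_mono F.a_01 F.a_0 c' \<theta>_hom surj p2 x \<tau> lim1[OF p2(1-3)] real_hom_uminus in
        \<open>auto simp: unit_flip_def\<close>)
  ultimately have "\<tau> f = 0" using \<tau>(1,2) by (intro hyperbolic) auto
  then show False using \<tau>(3) by simp
qed

lemma trivial_if_fixed:
  assumes p: "p \<in> {0<..<1}" "\<And>h. h \<in> carrier K \<Longrightarrow> \<alpha> h p = p"
    and x: "x \<in> {0<..<1}" and h: "h \<in> carrier K"
  shows "\<alpha> h x = x"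
proof (cases "a p < p")
  case True
  then show ?thesis using trivial_if_contracted_fixed[OF p _ x h] by simp
next
  case False
  interpret S: twisted_action K \<alpha> E \<theta>' \<theta> a' a by (rule swap)
  have "p < a p" using no_common_fixed[OF p] False by simp
  then have "a' p < p"
    using S.a_less_iff[of p "a p"] p(1) a_01(1)[of p] a_inv(2)[of p] by simp
  then show ?thesis using S.trivial_if_contracted_fixed[OF p _ x h] by simp
qed

text \<open>
  Compare the length of a gap \<open>(u, v)\<close> with the displacement \<open>\<alpha> f u - u \<ge> v - u\<close>.  Applying \<open>a\<close>
  near 0 scales both by \<open>a'(0)\<close>, but replaces \<open>f\<close> by \<open>\<theta>\<^sup>-\<^sup>1 f\<close>, whose displacement is \<open>\<nu>\<close> times
  smaller.  Hence the ratio grows by the factor \<open>\<nu>\<close> under every application of \<open>a\<close>, although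
  it is at most 1.
\<close>
lemma no_gap:
  assumes \<tau>: "real_hom K \<tau>" and f: "f \<in> carrier K" "\<tau> f > 0"
    and pos: "\<And>h x. \<lbrakk>h \<in> carrier K; \<tau> h > 0; x \<in> {0<..<1}\<rbrakk> \<Longrightarrow> x < \<alpha> h x"
    and nofix: "\<And>y. y \<in> {0<..<1} \<Longrightarrow> \<exists>h\<in>carrier K. \<alpha> h y \<noteq> y"
    and \<nu>: "\<nu> > 1" "\<And>h. h \<in> carrier K \<Longrightarrow> \<tau> (\<theta> h) = \<nu> * \<tau> h"
    and uv: "u \<in> {0<..<1}" "v \<in> {0<..<1}" "u < v"
    and gap: "\<And>h. \<lbrakk>h \<in> carrier K; \<tau> h > 0\<rbrakk> \<Longrightarrow> v \<le> \<alpha> h u"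
  shows False
proof -
  note hom_simps = real_hom_mult[OF \<tau>] real_hom_inv[OF \<tau>] real_hom_pow[OF \<tau>]
  have reach0: "\<exists>h\<in>carrier K. \<alpha> h x < y" if "x \<in> {0<..<1}" "y > 0" for x y
    using nofix that by (rule orbit_reaches_0)
  have reach1: "\<exists>h\<in>carrier K. y < \<alpha> h x" if "x \<in> {0<..<1}" "y < 1" for x y
    using nofix that by (rule orbit_reaches_1)
  define is_gap where "is_gap u v \<longleftrightarrow> u \<in> {0<..<1} \<and> v \<in> {0<..<1} \<and> u < v \<and>
    (\<forall>h\<in>carrier K. \<tau> h > 0 \<longrightarrow> v \<le> \<alpha> h u)" for u v
  have \<nu>': "\<tau> (\<theta>' h) = \<tau> h / \<nu>" if "h \<in> carrier K" for h
    using \<nu>(2)[of "\<theta>' h"] \<nu>(1) that by (simp add: \<theta>_inv)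
  have gap_a: "is_gap (a u) (a v)" if g: "is_gap u v" for u v
  proof -
    have "a v \<le> \<alpha> h (a u)" if h: "h \<in> carrier K" "\<tau> h > 0" for h
    proof -
      have "\<tau> (\<theta>' h) > 0" using \<nu>' \<nu>(1) h by simp
      then have "v \<le> \<alpha> (\<theta>' h) u" using g h by (simp add: is_gap_def)
      then have "a v \<le> a (\<alpha> (\<theta>' h) u)"
        using a_less_iff[of "\<alpha> (\<theta>' h) u" v] g h act_closed[of "\<theta>' h" u]
        by (force simp: is_gap_def not_less[symmetric])
      then show ?thesis using equiv[of "\<theta>' h" u] g h by (simp add: is_gap_def \<theta>_inv)
    qed
    then show ?thesis using g a_interior a_less_iff[of u v] by (simp add: is_gap_def)
  qed
  have gap_act: "is_gap (\<alpha> k u) (\<alpha> k v)" if g: "is_gap u v" and k: "k \<in> carrier K" for u v k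
  proof -
    have "\<alpha> k v \<le> \<alpha> h (\<alpha> k u)" if h: "h \<in> carrier K" "\<tau> h > 0" for h
    proof -
      have "\<alpha> k v \<le> \<alpha> k (\<alpha> h u)" using g h k by (simp add: is_gap_def act_le_iff)
      then show ?thesis using g h k by (simp add: is_gap_def act_mult[symmetric] m_comm)
    qed
    then show ?thesis using g k act_interior act_less_iff[of k u v] by (simp add: is_gap_def)
  qed

  \<comment> \<open>\<open>a\<close> carries the displacement of \<open>g\<close> at
    \<open>x\<close> to that of \<open>f\<close> at \<open>a x\<close>.\<close>
  define g where "g = \<theta>' f"
  have g: "g \<in> carrier K" "\<tau> g = \<tau> f / \<nu>" "\<tau> g > 0" "\<theta> g = f"
    using f \<nu>(1) \<nu>' by (simp_all add: g_def \<theta>_inv)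
  \<comment> \<open>Three estimates lose a factor \<open>\<kappa>\<close> each. The cube root leaves
    the net growth \<open>\<mu>\<close>, the midpoint of 1 and \<open>\<nu>\<close>, hence still
    above 1.\<close>
  define \<kappa> where "\<kappa> = root 3 ((1 + 1 / \<nu>) / 2)"
  define \<mu> where "\<mu> = (\<nu> + 1) / 2"
  have \<mu>: "\<mu> > 1" using \<nu>(1) by (simp add: \<mu>_def)
  have base: "0 < (1 + 1 / \<nu>) / 2" "(1 + 1 / \<nu>) / 2 < 1" using \<nu>(1) by (simp_all add: field_simps)
  have \<kappa>: "0 < \<kappa>" "\<kappa> < 1"
    using base real_root_lt_1_iff[of 3 "(1 + 1 / \<nu>) / 2"] by (simp_all add: \<kappa>_def)
  have "\<kappa> ^ 3 = (1 + 1 / \<nu>) / 2" using base by (simp add: \<kappa>_def)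
  then have \<kappa>\<mu>: "\<kappa> ^ 3 * \<nu> = \<mu>" using \<nu>(1) by (simp add: \<mu>_def field_simps)
  obtain c where c: "c > 0" "strict_deriv0 a c" using a_deriv by blast
  \<comment> \<open>One tolerance for both directions: \<open>c - \<epsilon>\<close> equals
    \<open>\<kappa> * c\<close>, and \<open>c + \<epsilon>\<close> is at most
    \<open>c / \<kappa>\<close>.\<close>
  define \<epsilon> where "\<epsilon> = (1 - \<kappa>) * c"
  have \<epsilon>: "\<epsilon> > 0" using \<kappa> c by (simp add: \<epsilon>_def)
  have \<epsilon>_le: "c + \<epsilon> \<le> c / \<kappa>"
  proof -
    have "\<kappa> * (2 - \<kappa>) \<le> 1" using zero_le_power2[of "1 - \<kappa>"] by (simp add: power2_eq_square algebra_simps)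
    then have "c * (\<kappa> * (2 - \<kappa>)) \<le> c * 1" using c by (intro mult_left_mono) auto
    then show ?thesis using \<kappa> by (simp add: \<epsilon>_def field_simps)
  qed
  obtain \<delta>1 where \<delta>1: "\<delta>1 > 0"
    "\<And>x y. \<lbrakk>0 \<le> x; x \<le> \<delta>1; 0 \<le> y; y \<le> \<delta>1\<rbrakk> \<Longrightarrow> \<bar>a y - a x - c * (y - x)\<bar> \<le> \<epsilon> * \<bar>y - x\<bar>"
    using strict_deriv0D[OF c(2) \<epsilon>] by metis
  \<comment> \<open>The interval of ratios degenerates to \<open>\<nu>\<close>, the exact ratio of
    \<open>\<tau> f\<close> to \<open>\<tau> g\<close>.\<close>
  have "\<forall>\<^sub>F x in at_right 0. x < \<delta>1 \<and> \<alpha> g x \<le> \<delta>1 \<and> (\<forall>\<rho>\<in>{\<nu>..\<nu>}.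
    (\<forall>(p::nat) (q::nat). real p < real q * \<rho> \<longrightarrow> \<alpha> (g [^] p) x < \<alpha> (f [^] q) x) \<longrightarrow>
    x \<le> \<alpha> g x \<longrightarrow> x \<le> \<alpha> f x \<longrightarrow> \<kappa> * \<rho> * (\<alpha> g x - x) \<le> \<alpha> f x - x)"
    using \<delta>1(1) \<kappa> \<nu>(1) f g
    by (intro eventually_conj act_small disp_ratio) (auto simp: eventually_at_right_field)
  then obtain \<delta>2 where \<delta>2: "\<delta>2 > 0" and near0: "\<And>x. \<lbrakk>0 < x; x < \<delta>2\<rbrakk> \<Longrightarrow> x < \<delta>1 \<and> \<alpha> g x \<le> \<delta>1 \<and> (
    (\<forall>(p::nat) (q::nat). real p < real q * \<nu> \<longrightarrow> \<alpha> (g [^] p) x < \<alpha> (f [^] q) x) \<longrightarrow>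
    x \<le> \<alpha> g x \<longrightarrow> x \<le> \<alpha> f x \<longrightarrow> \<kappa> * \<nu> * (\<alpha> g x - x) \<le> \<alpha> f x - x)"
    by (auto simp: eventually_at_right_field)
  have iter: "\<alpha> (g [^] p) x < \<alpha> (f [^] q) x" if "real p < real q * \<nu>" "x \<in> {0<..<1}" for p q :: nat and x
  proof -
    have "\<tau> (inv (g [^] p) \<otimes> f [^] q) = (q * \<nu> - p) * \<tau> g"
      using f g \<nu>(1) by (simp add: hom_simps field_simps)
    moreover have "(q * \<nu> - p) * \<tau> g > 0" using that(1) g(3) by (intro mult_pos_pos) auto
    ultimately have "x < \<alpha> (inv (g [^] p) \<otimes> f [^] q) x"
      using that(2) f(1) g(1) by (intro pos) auto
    then have "x < \<alpha> (inv (g [^] p)) (\<alpha> (f [^] q) x)"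
      using that f g by (simp add: act_mult)
    then show ?thesis
      using less_act_inv_iff[of "g [^] p" "\<alpha> (f [^] q) x" x] f g that act_closed[of "f [^] q" x] by simp
  qed
  have disp_gf: "\<kappa> * \<nu> * (\<alpha> g x - x) \<le> \<alpha> f x - x" if "x \<in> {0<..<1}" "x < \<delta>2" for x
    using near0[of x] iter pos[of g x] pos[of f x] f g that by (auto simp: less_imp_le)

  \<comment> \<open>One translate \<open>\<alpha> k v\<close> below \<open>y\<close> bounds all late
    iterates, because \<open>f [^] n \<otimes> k\<close> is positive for \<open>\<tau>\<close> once
    \<open>n\<close> is large.\<close>
  have far: "\<exists>N::nat. \<forall>n\<ge>N. \<alpha> (inv f [^] n) v < y" if y: "y > 0" for y
  proof -
    obtain k where k: "k \<in> carrier K" "\<alpha> k v < y"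
      using reach0[OF uv(2) y] by blast
    obtain N :: nat where N: "N * \<tau> f > - \<tau> k" using ex_less_of_nat_mult[OF f(2)] by blast
    have "\<alpha> (inv f [^] n) v < y" if "n \<ge> N" for n
    proof -
      have "real N * \<tau> f \<le> real n * \<tau> f" using that f by (intro mult_right_mono) auto
      moreover have "\<tau> (f [^] n \<otimes> k) = n * \<tau> f + \<tau> k" using f k by (simp add: hom_simps)
      ultimately have "\<tau> (f [^] n \<otimes> k) > 0" using N by linarith
      then have "v < \<alpha> (f [^] n \<otimes> k) v" using uv f k by (intro pos) auto
      then have "v < \<alpha> (f [^] n) (\<alpha> k v)" using uv f k by (simp add: act_mult)
      then have "\<alpha> (inv (f [^] n)) v < \<alpha> k v"
        using act_inv_less_iff[of "f [^] n" v "\<alpha> k v"] uv f k by simp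
      then show ?thesis using k f by (simp add: nat_pow_inv)
    qed
    then show ?thesis by blast
  qed
  obtain N1 :: nat where N1: "\<And>n. n \<ge> N1 \<Longrightarrow> \<alpha> (inv f [^] n) v < \<delta>2" using far[OF \<delta>2] by blast
  \<comment> \<open>The translated gap must also be moved down by \<open>a\<close>, so that its
    iterates stay where the estimates hold. For \<open>w\<close> a negative power of
    \<open>f\<close>, \<open>a\<close> takes \<open>\<alpha> w v\<close> to
    \<open>\<alpha> (\<theta> w) (a v)\<close>. As \<open>\<tau> (\<theta> w)\<close> is
    \<open>\<nu> > 1\<close> times the negative \<open>\<tau> w\<close>, a high power outweighs the
    fixed discrepancy between \<open>v\<close> and \<open>a v\<close> measured by
    \<open>k\<close>.\<close>
  obtain k where k: "k \<in> carrier K" "a v < \<alpha> k v"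
    using reach1[OF uv(2), of "a v"] a_interior[OF uv(2)] by auto
  obtain N2 :: nat where N2: "N2 * ((\<nu> - 1) * \<tau> f) > \<tau> k"
    using ex_less_of_nat_mult[of "(\<nu> - 1) * \<tau> f"] f \<nu>(1) by auto
  define n where "n = max N1 N2"
  define w where "w = inv f [^] n"
  have w: "w \<in> carrier K" "\<tau> w = - n * \<tau> f" using f by (simp_all add: w_def hom_simps)
  define u0 where "u0 = \<alpha> w u"
  define v0 where "v0 = \<alpha> w v"
  have gap0: "is_gap u0 v0"
    unfolding u0_def v0_def using uv gap w by (intro gap_act) (auto simp: is_gap_def)
  have v0: "v0 < \<delta>2" using N1[of n] by (simp add: v0_def w_def n_def)
  have av0: "a v0 \<le> v0"
  proof -
    have "real N2 * ((\<nu> - 1) * \<tau> f) \<le> real n * ((\<nu> - 1) * \<tau> f)"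
      using f \<nu>(1) by (intro mult_right_mono) (auto simp: n_def)
    moreover have "\<tau> (inv (\<theta> w \<otimes> k) \<otimes> w) = n * ((\<nu> - 1) * \<tau> f) - \<tau> k"
      using w k by (simp add: hom_simps \<nu>(2) algebra_simps del: inv_mult_group)
    ultimately have "\<tau> (inv (\<theta> w \<otimes> k) \<otimes> w) > 0" using N2 by linarith
    then have "v < \<alpha> (inv (\<theta> w \<otimes> k) \<otimes> w) v" using uv w k by (intro pos) auto
    then have "v < \<alpha> (inv (\<theta> w \<otimes> k)) (\<alpha> w v)" using uv w k by (simp add: act_mult del: inv_mult_group)
    then have "\<alpha> (\<theta> w \<otimes> k) v < \<alpha> w v"
      using less_act_inv_iff[of "\<theta> w \<otimes> k" "\<alpha> w v" v] uv w k act_closed[of w v] by simp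
    moreover have "\<alpha> (\<theta> w) (a v) < \<alpha> (\<theta> w) (\<alpha> k v)"
      using k w uv a_01(1)[of v] by (subst act_less_iff) auto
    ultimately show ?thesis using equiv[of w v] uv w k by (simp add: v0_def act_mult)
  qed
  define U where "U m = (a ^^ m) u0" for m
  define V where "V m = (a ^^ m) v0" for m
  have UV: "is_gap (U m) (V m) \<and> V m < \<delta>2 \<and> a (V m) \<le> V m" for m
  proof (induction m)
    case 0
    then show ?case using gap0 v0 av0 by (simp add: U_def V_def)
  next
    case (Suc m)
    have "is_gap (U (Suc m)) (V (Suc m))" using gap_a Suc by (simp add: U_def V_def)
    moreover have "\<not> a (V m) < a (a (V m))"
      using a_less_iff[of "V m" "a (V m)"] Suc a_01(1)[of "V m"] by (simp add: is_gap_def)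
    ultimately show ?case using Suc by (simp add: V_def)
  qed
  define R where "R m = (V m - U m) / (\<alpha> f (U m) - U m)" for m
  have dpos: "\<alpha> f (U m) - U m > 0" for m using pos[OF f, of "U m"] UV[of m] by (simp add: is_gap_def)
  have Rpos: "R m > 0" and R1: "R m \<le> 1" for m
    using dpos[of m] UV[of m] f by (simp_all add: R_def is_gap_def)
  have grow: "\<mu> * R m \<le> R (Suc m)" for m
  proof -
    define x where "x = U m"
    define y where "y = V m"
    have xy: "0 < x" "x < y" "y < \<delta>2" "y < 1" using UV[of m] by (simp_all add: x_def y_def is_gap_def)
    have small: "y < \<delta>1" "\<alpha> g x \<le> \<delta>1" using near0[of x] near0[of y] xy by simp_all
    have gx: "x < \<alpha> g x" using pos[of g x] g xy by simp
    have "\<bar>a y - a x - c * (y - x)\<bar> \<le> \<epsilon> * \<bar>y - x\<bar>" using \<delta>1(2)[of x y] xy small by simp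
    then have len: "a y - a x \<ge> \<kappa> * c * (y - x)"
      using xy by (simp add: abs_le_iff \<epsilon>_def algebra_simps)
    have "\<bar>a (\<alpha> g x) - a x - c * (\<alpha> g x - x)\<bar> \<le> \<epsilon> * \<bar>\<alpha> g x - x\<bar>"
      using \<delta>1(2)[of x "\<alpha> g x"] xy small gx by simp
    then have "a (\<alpha> g x) - a x \<le> (c + \<epsilon>) * (\<alpha> g x - x)"
      using gx by (simp add: abs_le_iff algebra_simps)
    also have "\<dots> \<le> c / \<kappa> * (\<alpha> g x - x)" using \<epsilon>_le gx by (intro mult_right_mono) auto
    also have "a (\<alpha> g x) = \<alpha> f (a x)" using equiv[of g x] g xy by simp
    finally have d1: "\<kappa> * (\<alpha> f (a x) - a x) \<le> c * (\<alpha> g x - x)" using \<kappa> by (simp add: field_simps)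
    have d2: "\<kappa> * \<nu> * (\<alpha> g x - x) \<le> \<alpha> f x - x" using disp_gf[of x] xy by simp
    have "\<kappa> * \<nu> * (\<kappa> * (\<alpha> f (a x) - a x)) \<le> \<kappa> * \<nu> * (c * (\<alpha> g x - x))"
      using d1 \<kappa> \<nu>(1) by (intro mult_left_mono) auto
    also have "\<dots> = c * (\<kappa> * \<nu> * (\<alpha> g x - x))" by simp
    also have "\<dots> \<le> c * (\<alpha> f x - x)" using d2 c by (intro mult_left_mono) auto
    finally have d: "\<kappa> * \<kappa> * \<nu> * (\<alpha> f (a x) - a x) \<le> c * (\<alpha> f x - x)" by (simp add: algebra_simps)
    have D: "\<alpha> f x - x > 0" "\<alpha> f (a x) - a x > 0"
      using dpos[of m] dpos[of "Suc m"] by (simp_all add: x_def U_def)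
    have "(\<kappa> * c * (y - x)) * (\<kappa> * \<kappa> * \<nu> * (\<alpha> f (a x) - a x)) \<le> (a y - a x) * (c * (\<alpha> f x - x))"
    proof (rule mult_mono[OF len d])
      show "0 \<le> a y - a x" using a_less_iff[of x y] xy by simp
      show "0 \<le> \<kappa> * \<kappa> * \<nu> * (\<alpha> f (a x) - a x)" using \<kappa> \<nu>(1) D by simp
    qed
    then have "c * (\<kappa> ^ 3 * \<nu> * (y - x) * (\<alpha> f (a x) - a x)) \<le> c * ((a y - a x) * (\<alpha> f x - x))"
      by (simp add: power3_eq_cube algebra_simps)
    then have "\<mu> * (y - x) * (\<alpha> f (a x) - a x) \<le> (a y - a x) * (\<alpha> f x - x)"
      using c \<kappa>\<mu> by simp
    then have "\<mu> * ((y - x) / (\<alpha> f x - x)) \<le> (a y - a x) / (\<alpha> f (a x) - a x)"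
      using D by (simp add: field_simps)
    then show ?thesis by (simp add: R_def x_def y_def U_def V_def)
  qed
  have "\<mu> ^ m * R 0 \<le> R m" for m
  proof (induction m)
    case (Suc m)
    have "\<mu> * (\<mu> ^ m * R 0) \<le> \<mu> * R m" using Suc \<mu> by (intro mult_left_mono) auto
    then show ?case using grow[of m] by (simp add: mult.assoc)
  qed simp
  then have "\<mu> ^ m \<le> 1 / R 0" for m
    using R1[of m] Rpos[of 0] order_trans by (fastforce simp: field_simps)
  then show False using real_arch_pow[OF \<mu>, of "1 / R 0"] by (meson not_less)
qed

text \<open>Without interior fixed points the functional obtained at \<open>x\<close> orders every
  interior point, in particular \<open>a x\<close>. This makes \<open>\<tau>\<close> and its
  composition with \<open>\<theta>\<close> proportional, and an interval missed by the orbit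
  enlarges to a gap as in \<open>no_gap\<close>.\<close>

lemma orbits_dense_if_no_fixed:
  assumes nofix: "\<And>y. y \<in> {0<..<1} \<Longrightarrow> \<exists>h\<in>carrier K. \<alpha> h y \<noteq> y"
    and x: "x \<in> {0<..<1}" and uv: "0 < u" "u < v" "v < 1"
  shows "\<exists>h\<in>carrier K. u < \<alpha> h x \<and> \<alpha> h x < v"
proof (rule ccontr)
  assume neg: "\<not> ?thesis"
  obtain \<tau> f where \<tau>: "real_hom K \<tau>" and f: "f \<in> carrier K" "\<tau> f > 0"
    and sign: "\<And>h. \<lbrakk>h \<in> carrier K; \<tau> h > 0\<rbrakk> \<Longrightarrow> x < \<alpha> h x"
    using ordering_functional[OF x nofix[OF x]] by metis
  note hom_simps = real_hom_mult[OF \<tau>] real_hom_inv[OF \<tau>] real_hom_pow[OF \<tau>]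
  have reach0: "\<exists>h\<in>carrier K. \<alpha> h x < y" if "x \<in> {0<..<1}" "y > 0" for x y
    using nofix that by (rule orbit_reaches_0)
  have reach1: "\<exists>h\<in>carrier K. y < \<alpha> h x" if "x \<in> {0<..<1}" "y < 1" for x y
    using nofix that by (rule orbit_reaches_1)
  \<comment> \<open>Enclose \<open>y\<close> between \<open>\<alpha> k x\<close> and
    \<open>\<alpha> k' x\<close>. For large \<open>n\<close> the functional forces
    \<open>h [^] n \<otimes> k\<close> to move \<open>x\<close> beyond \<open>\<alpha> k' x\<close>,
    whereas powers of an \<open>h\<close> that does not raise \<open>y\<close> keep
    \<open>\<alpha> k x\<close> below \<open>y\<close>.\<close>
  have pos: "y < \<alpha> h y" if h: "h \<in> carrier K" "\<tau> h > 0" and y: "y \<in> {0<..<1}" for h y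
  proof (rule ccontr)
    assume "\<not> y < \<alpha> h y"
    then have le: "\<alpha> h y \<le> y" by simp
    have pow: "\<alpha> (h [^] n) y \<le> y" for n :: nat
    proof (induction n)
      case (Suc n)
      have "\<alpha> (h [^] Suc n) y = \<alpha> (h [^] n) (\<alpha> h y)" using h y by (simp add: act_mult)
      also have "\<dots> \<le> \<alpha> (h [^] n) y" using h y le by (subst act_le_iff) auto
      finally show ?case using Suc by simp
    qed (use y act_one[of y] in simp)
    obtain k where k: "k \<in> carrier K" "\<alpha> k x < y" using reach0[OF x, of y] y by auto
    obtain k' where k': "k' \<in> carrier K" "y < \<alpha> k' x" using reach1[OF x, of y] y by auto
    obtain n :: nat where n: "n * \<tau> h > \<tau> k' - \<tau> k" using ex_less_of_nat_mult[OF h(2)] by blast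
    have "\<tau> (inv k' \<otimes> (h [^] n \<otimes> k)) > 0" using n h k k' by (simp add: hom_simps)
    then have "x < \<alpha> (inv k' \<otimes> (h [^] n \<otimes> k)) x" using h k k' by (intro sign) auto
    then have "x < \<alpha> (inv k') (\<alpha> (h [^] n) (\<alpha> k x))" using h k k' x by (simp add: act_mult)
    then have "\<alpha> k' x < \<alpha> (h [^] n) (\<alpha> k x)"
      using less_act_inv_iff[of k' "\<alpha> (h [^] n) (\<alpha> k x)" x] h k k' x
        act_interior[of k x] act_closed[of "h [^] n" "\<alpha> k x"] by simp
    also have "\<dots> < \<alpha> (h [^] n) y" using h k x y by (subst act_less_iff) auto
    also have "\<dots> \<le> y" by (rule pow)
    finally show False using k' by simp
  qed
  \<comment> \<open>By \<open>equiv\<close> the sign of \<open>\<tau> h\<close> at \<open>x\<close>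
    is the sign of \<open>\<tau> (\<theta> h)\<close> tested at \<open>a x\<close>.\<close>
  have "\<tau> h \<ge> 0" if h: "h \<in> carrier K" "\<tau> (\<theta> h) > 0" for h
  proof (rule ccontr)
    assume "\<not> \<tau> h \<ge> 0"
    then have "x < \<alpha> (inv h) x" using sign[of "inv h"] h by (simp add: hom_simps)
    then have "\<alpha> h x < x" using less_act_inv_iff[of h x x] h x by simp
    then have "a (\<alpha> h x) < a x" using a_less_iff[of "\<alpha> h x" x] h x by simp
    then have "\<alpha> (\<theta> h) (a x) < a x" using equiv[of h x] h x by simp
    then show False using pos[of "\<theta> h" "a x"] h a_interior[OF x] by simp
  qed
  moreover have "\<theta>' f \<in> carrier K" "\<tau> (\<theta> (\<theta>' f)) > 0" using f by (simp_all add: \<theta>_inv)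
  ultimately obtain \<nu> where \<nu>: "\<nu> > 0" "\<And>h. h \<in> carrier K \<Longrightarrow> \<tau> (\<theta> h) = \<nu> * \<tau> h"
    using real_homs_proportional[OF \<tau> real_hom_compose[OF \<tau> \<theta>_hom(1)] _ f, of "\<theta>' f"] by metis
  have \<nu>': "\<tau> (\<theta>' h) = inverse \<nu> * \<tau> h" if "h \<in> carrier K" for h
    using \<nu>(2)[of "\<theta>' h"] \<nu>(1) that by (simp add: \<theta>_inv field_simps)
  have \<nu>1: "\<nu> \<noteq> 1"
  proof
    assume 1: "\<nu> = 1"
    have inv: "(\<theta> ^^ n) h \<in> carrier K \<and> \<tau> ((\<theta> ^^ n) h) = \<tau> h \<and>
      (\<theta>' ^^ n) h \<in> carrier K \<and> \<tau> ((\<theta>' ^^ n) h) = \<tau> h" if "h \<in> carrier K" for h n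
      by (induction n) (use that \<nu>(2) \<nu>' 1 in auto)
    have bd: "\<bar>\<tau> h\<bar> \<le> \<bar>\<tau> h\<bar> * s ^ n" if "s > 1" for h and s :: real and n
      using that mult_left_mono[of 1 "s ^ n" "\<bar>\<tau> h\<bar>"] one_le_power[of s n] by simp
    have "\<exists>C. \<forall>n. \<bar>\<tau> ((\<theta> ^^ n) h)\<bar> \<le> C * s ^ n" "\<exists>C. \<forall>n. \<bar>\<tau> ((\<theta>' ^^ n) h)\<bar> \<le> C * s ^ n"
      if "h \<in> carrier K" "s > 1" for h and s :: real
      using inv[OF that(1)] bd[OF that(2), of h] by (auto intro!: exI[of _ "\<bar>\<tau> h\<bar>"])
    then have "\<tau> f = 0" using \<tau> f by (intro hyperbolic) auto
    then show False using f by simp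
  qed

  \<comment> \<open>\<open>u'\<close> and \<open>v'\<close> will be the ends of the complementary
    interval of the orbit around \<open>u\<close> and \<open>v\<close>. They need not be orbit
    points.\<close>
  define S1 where "S1 = {y \<in> (\<lambda>h. \<alpha> h x) ` carrier K. y \<le> u}"
  define S2 where "S2 = {y \<in> (\<lambda>h. \<alpha> h x) ` carrier K. v \<le> y}"
  define u' where "u' = Sup S1"
  define v' where "v' = Inf S2"
  obtain y1 where y1: "y1 \<in> S1" "0 < y1"
    using reach0[OF x uv(1)] act_interior x by (fastforce simp: S1_def)
  obtain y2 where y2: "y2 \<in> S2" "y2 < 1"
    using reach1[OF x uv(3)] act_interior x by (fastforce simp: S2_def)
  have S1: "y \<le> u'" if "y \<in> S1" for y
    unfolding u'_def using that by (intro cSup_upper) (auto simp: S1_def intro: bdd_aboveI)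
  have S2: "v' \<le> y" if "y \<in> S2" for y
    unfolding v'_def using that by (intro cInf_lower) (auto simp: S2_def intro: bdd_belowI)
  have "u' \<le> u" unfolding u'_def using y1 by (intro cSup_least) (auto simp: S1_def)
  moreover have "v \<le> v'" unfolding v'_def using y2 by (intro cInf_greatest) (auto simp: S2_def)
  ultimately have u'v': "u' \<in> {0<..<1}" "v' \<in> {0<..<1}" "u' < v'"
    using S1[OF y1(1)] S2[OF y2(1)] y1 y2 uv by auto
  have gap: "v' \<le> \<alpha> h u'" if h: "h \<in> carrier K" "\<tau> h > 0" for h
  proof (rule ccontr)
    assume "\<not> v' \<le> \<alpha> h u'"
    then have lt: "\<alpha> h u' < v'" by simp
    have "\<alpha> (inv h) u' < u'"
      using pos[OF h u'v'(1)] act_inv_less_iff[of h u' u'] h u'v'(1) by simp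
    \<comment> \<open>An orbit point close enough below \<open>u'\<close> substitutes for
      \<open>u'\<close> itself; \<open>h\<close> would carry it strictly between \<open>u'\<close>
      and \<open>v'\<close>, where the orbit has no points.\<close>
    then obtain z where z: "z \<in> S1" "\<alpha> (inv h) u' < z"
      using less_cSupE[of _ S1] y1(1) unfolding u'_def by (metis empty_iff)
    then obtain k where k: "k \<in> carrier K" "z = \<alpha> k x" by (auto simp: S1_def)
    have z01: "z \<in> {0<..<1}" using k x act_interior by simp
    have "u' < \<alpha> h z" using z(2) act_inv_less_iff[of h u' z] h u'v'(1) z01 by simp
    moreover have "\<alpha> h z \<le> \<alpha> h u'" using S1[OF z(1)] h u'v'(1) z01 by (simp add: act_le_iff)
    moreover have hz: "\<alpha> h z = \<alpha> (h \<otimes> k) x" using h k x by (simp add: act_mult)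
    ultimately have "\<alpha> h z \<notin> S1" "\<alpha> h z \<notin> S2" using S1 S2 lt by force+
    then have "u < \<alpha> h z \<and> \<alpha> h z < v" using h k unfolding S1_def S2_def hz by auto
    then show False using neg h k hz by auto
  qed
  show False
  proof (cases "\<nu> > 1")
    case True
    show False by (rule no_gap[OF \<tau> f _ _ True \<nu>(2) u'v']) (use pos nofix gap in auto)
  next
    case False
    \<comment> \<open>Time reversal replaces \<open>\<nu>\<close> by its inverse.\<close>
    interpret S: twisted_action K \<alpha> E \<theta>' \<theta> a' a by (rule swap)
    have inv1: "inverse \<nu> > 1" using False \<nu>1 \<nu>(1) by (simp add: one_less_inverse_iff)
    show False by (rule S.no_gap[OF \<tau> f _ _ inv1 \<nu>' u'v']) (use pos nofix gap in auto)
  qed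
qed

theorem orbits_dense:
  assumes nontrivial: "h \<in> carrier K" "y \<in> {0..1}" "\<alpha> h y \<noteq> y"
    and x: "x \<in> {0<..<1}" and uv: "0 < u" "u < v" "v < 1"
  shows "\<exists>h\<in>carrier K. u < \<alpha> h x \<and> \<alpha> h x < v"
proof (rule orbits_dense_if_no_fixed[OF _ x uv])
  have "y \<noteq> 0" "y \<noteq> 1" using act_0[of h] act_1[of h] nontrivial by auto
  then have "y \<in> {0<..<1}" using nontrivial(2) by auto
  then show "\<exists>k\<in>carrier K. \<alpha> k p \<noteq> p" if "p \<in> {0<..<1}" for p
    using trivial_if_fixed[OF that] nontrivial by blast
qed

end

section \<open>End point derivatives of C^1 diffeomorphisms\<close>

text \<open>The mean value theorem turns continuity of the derivative at 0 into the two-point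
  estimate.\<close>

lemma C1_strict_deriv0:
  assumes "C1_on_unit f"
  obtains c where "strict_deriv0 f c" "(f has_real_derivative c) (at 0 within {0..1})"
proof -
  obtain f' where f': "\<And>x. x \<in> {0..1} \<Longrightarrow> (f has_real_derivative f' x) (at x within {0..1})"
    and cont: "continuous_on {0..1} f'"
    using assms unfolding C1_on_unit_def by blast
  have "strict_deriv0 f (f' 0)"
    unfolding strict_deriv0_def
  proof (intro allI impI)
    fix \<epsilon> :: real assume "\<epsilon> > 0"
    then obtain d where d: "d > 0" "\<And>x. \<lbrakk>x \<in> {0..1}; dist x 0 < d\<rbrakk> \<Longrightarrow> dist (f' x) (f' 0) < \<epsilon>"
      using cont unfolding continuous_on_iff by (metis atLeastAtMost_iff order_refl zero_le_one)
    define \<delta> where "\<delta> = min 1 (d / 2)"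
    have "\<bar>f y - f x - f' 0 * (y - x)\<bar> \<le> \<epsilon> * (y - x)" if xy: "0 \<le> x" "x \<le> y" "y \<le> \<delta>" for x y
    proof (cases "x = y")
      case False
      have "y \<le> 1" using xy by (simp add: \<delta>_def)
      then have "\<exists>z\<in>{x<..<y}. f y - f x = (y - x) * f' z"
        using xy False
        by (intro mvt_simple[where f' = "\<lambda>z t. t * f' z", simplified])
          (auto intro!: has_derivative_subset[OF f'[unfolded has_field_derivative_def, THEN has_derivative_eq_rhs]]
            simp: mult.commute)
      then obtain z where z: "x < z" "z < y" "f y - f x = (y - x) * f' z" by auto
      have "\<bar>f' z - f' 0\<bar> < \<epsilon>" using d z xy by (auto simp: dist_real_def \<delta>_def)
      then have "\<bar>(f' z - f' 0) * (y - x)\<bar> \<le> \<epsilon> * (y - x)"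
        using xy by (simp add: abs_mult mult_right_mono)
      then show ?thesis using z(3) by (simp add: algebra_simps)
    qed simp
    then show "\<exists>\<delta>>0. \<forall>x y. 0 \<le> x \<longrightarrow> x \<le> y \<longrightarrow> y \<le> \<delta> \<longrightarrow>
      \<bar>f y - f x - f' 0 * (y - x)\<bar> \<le> \<epsilon> * (y - x)"
      using d(1) by (intro exI[of _ \<delta>]) (auto simp: \<delta>_def)
  qed
  then show thesis using that f'[of 0] by simp
qed

text \<open>The chain rule for \<open>g\<close> after \<open>f\<close> excludes derivative 0, and a
  negative one would make \<open>f\<close> negative just to the right of 0.\<close>

lemma C1_strict_deriv0_pos:
  assumes f: "C1_on_unit f" and g: "C1_on_unit g"
    and inverse: "\<And>x. x \<in> {0..1} \<Longrightarrow> g (f x) = x" and f_01: "f ` {0..1} \<subseteq> {0..1}"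
    and f0: "f 0 = 0" 
  shows "\<exists>c>0. strict_deriv0 f c"
proof -
  obtain c where c: "strict_deriv0 f c" "(f has_real_derivative c) (at 0 within {0..1})"
    using C1_strict_deriv0[OF f] by blast
  obtain e where e: "(g has_real_derivative e) (at 0 within {0..1})"
    using C1_strict_deriv0[OF g] by blast
  have "(g has_real_derivative e) (at (f 0) within f ` {0..1})"
    using DERIV_subset[OF e f_01] f0 by simp
  then have "(g \<circ> f has_real_derivative e * c) (at 0 within {0..1})"
    using c(2) by (intro DERIV_image_chain)
  then have "((\<lambda>x. x) has_real_derivative e * c) (at 0 within {0..1})"
    by (rule has_field_derivative_transform_within[where d = 1]) (use inverse in auto)
  then have "e * c = 1"
    by (intro vector_derivative_unique_within[of "0::real" "{0..1}" "\<lambda>x. x"])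
      (auto simp: at_within_Icc_at_right DERIV_ident
        simp flip: has_real_derivative_iff_has_vector_derivative)
  then have "c \<noteq> 0" by auto
  moreover have "c \<ge> 0"
  proof (rule ccontr)
    assume "\<not> c \<ge> 0"
    then obtain \<delta> where \<delta>: "\<delta> > 0" "\<delta> \<le> 1"
      "\<And>x y. \<lbrakk>0 \<le> x; x \<le> \<delta>; 0 \<le> y; y \<le> \<delta>\<rbrakk> \<Longrightarrow> \<bar>f y - f x - c * (y - x)\<bar> \<le> - c / 2 * \<bar>y - x\<bar>"
      using strict_deriv0D[OF c(1), of "- c / 2"] by auto
    have "\<bar>f \<delta> - c * \<delta>\<bar> \<le> - c / 2 * \<delta>" using \<delta>(3)[of 0 \<delta>] \<delta>(1) f0 by simp
    moreover have "f \<delta> \<ge> 0" using image_subset_iff[THEN iffD1, OF f_01] \<delta>(1,2) by auto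
    moreover have "c * \<delta> < 0" using \<open>\<not> c \<ge> 0\<close> \<delta>(1) by (simp add: mult_neg_pos)
    ultimately show False by simp
  qed
  ultimately show ?thesis using c(1) by (intro exI[of _ c]) auto
qed

lemma C1_on_unit_flip:
  assumes "C1_on_unit f"
  shows "C1_on_unit (unit_flip f)"
proof -
  obtain f' where f': "\<And>x. x \<in> {0..1} \<Longrightarrow> (f has_real_derivative f' x) (at x within {0..1})"
    and cont: "continuous_on {0..1} f'"
    using assms unfolding C1_on_unit_def by blast
  have im: "(\<lambda>x. 1 - x) ` {0..1} = {0..1::real}"
    by (force simp: image_iff intro: bexI[of _ "1 - x" for x])
  have "(unit_flip f has_real_derivative f' (1 - x)) (at x within {0..1})" if "x \<in> {0..1}" for x
  proof -
    have "(f has_real_derivative f' (1 - x)) (at (1 - x) within (\<lambda>x. 1 - x) ` {0..1})"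
      using f'[of "1 - x"] that by (simp only: im) simp
    then have "(f \<circ> (\<lambda>x. 1 - x) has_real_derivative f' (1 - x) * - 1) (at x within {0..1})"
      by (rule DERIV_image_chain) (auto intro!: derivative_eq_intros)
    from DERIV_diff[OF DERIV_const this, of 1] show ?thesis
      by (simp add: unit_flip_def[abs_def] o_def)
  qed
  moreover have "continuous_on {0..1} (\<lambda>x. f' (1 - x))"
    by (rule continuous_on_compose2[OF cont]) (auto intro!: continuous_intros)
  ultimately show ?thesis unfolding C1_on_unit_def by (intro exI[of _ "\<lambda>x. f' (1 - x)"]) auto
qed

lemma C1_diffeo_plus_strict_deriv0:
  assumes f: "C1_diffeo_plus f"
  shows "\<exists>c>0. strict_deriv0 f c" "\<exists>c>0. strict_deriv0 (unit_flip f) c"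
proof -
  define g where "g = inv_into {0..1} f"
  have bij: "bij_betw f {0..1} {0..1}" and mono: "strict_mono_on {0..1} f"
    and C1: "C1_on_unit f" "C1_on_unit g"
    using f by (simp_all add: C1_diffeo_plus_def g_def)
  have im: "f x \<in> {0..1}" if "x \<in> {0..1}" for x using bij that by (auto simp: bij_betw_def)
  have g: "g (f x) = x" if "x \<in> {0..1}" for x
    using bij that by (simp add: g_def bij_betw_inv_into_left)
  have le: "f x \<le> f y" if "x \<in> {0..1}" "y \<in> {0..1}" "x \<le> y" for x y
    using mono that by (metis strict_mono_on_leD)
  have pre: "\<exists>x\<in>{0..1}. f x = y" if "y \<in> {0..1}" for y
    using bij that unfolding bij_betw_def by (metis imageE)
  have f0: "f 0 = 0"
  proof -
    obtain x where "x \<in> {0..1}" "f x = 0" using pre[of 0] by auto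
    then show ?thesis using le[of 0 x] im[of 0] by auto
  qed
  have f1: "f 1 = 1"
  proof -
    obtain x where "x \<in> {0..1}" "f x = 1" using pre[of 1] by auto
    then show ?thesis using le[of x 1] im[of 1] by auto
  qed
  show "\<exists>c>0. strict_deriv0 f c"
    by (rule C1_strict_deriv0_pos[OF C1]) (use g im f0 in auto)
  show "\<exists>c>0. strict_deriv0 (unit_flip f) c"
    by (rule C1_strict_deriv0_pos[OF C1[THEN C1_on_unit_flip]]) (use g im f1 in \<open>auto simp: unit_flip_def\<close>)
qed

section \<open>Linear forms growing subexponentially under a hyperbolic matrix\<close>

text \<open>For nonzero \<open>l\<close>, \<open>x\<close> is geometric with ratio \<open>l\<close>
  and \<open>y\<close> with the inverse ratio; one of them grows exponentially unless the common
  initial value is 0. For \<open>l = 0\<close> the recursion makes \<open>y\<close> vanish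
  outright.\<close>

lemma two_sided_geometric_zero:
  fixes x y :: "nat \<Rightarrow> complex" and l :: complex
  assumes l: "cmod l \<noteq> 1"
    and x: "\<And>n. x (Suc n) = l * x n" and y: "\<And>n. y n = l * y (Suc n)" and xy: "x 0 = y 0"
    and growth: "\<And>s. s > 1 \<Longrightarrow> \<exists>C. \<forall>n. cmod (x n) \<le> C * s ^ n"
      "\<And>s. s > 1 \<Longrightarrow> \<exists>C. \<forall>n. cmod (y n) \<le> C * s ^ n"
  shows "x n = 0" "y n = 0"
proof -
  have vanish: "z (0::nat) = (0::complex)"
    if r: "r > 1" and z: "\<And>n. cmod (z n) = r ^ n * cmod (z 0)"
      and s: "\<And>s. s > 1 \<Longrightarrow> \<exists>C. \<forall>n. cmod (z n) \<le> C * s ^ n" for z r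
  proof (rule ccontr)
    assume z0: "z 0 \<noteq> 0"
    obtain s where s': "1 < s" "s < r" using dense r by blast
    obtain C where C: "\<And>n. cmod (z n) \<le> C * s ^ n" using s s'(1) by blast
    obtain n where n: "C / cmod (z 0) < (r / s) ^ n"
      using real_arch_pow[of "r / s"] s' by auto
    have "s ^ n > 0" using s' by simp
    then have "C * s ^ n < r ^ n * cmod (z 0)"
      using n z0 by (simp add: power_divide field_simps)
    then show False using C[of n] z[of n] by simp
  qed
  have xn: "x n = l ^ n * x 0" for n by (induction n) (simp_all add: x)
  have yn: "y 0 = l ^ n * y n" for n
  proof (induction n)
    case (Suc n)
    then show ?case using y[of n] by (simp add: mult.assoc)
  qed simp
  have x0: "x 0 = 0"
  proof (cases "cmod l > 1")
    case True
    show ?thesis by (rule vanish[OF True _ growth(1)]) (metis xn norm_mult norm_power)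
  next
    case False
    show ?thesis
    proof (cases "l = 0")
      case False
      have "cmod (y n) = inverse (cmod l) ^ n * cmod (y 0)" for n
        using yn[of n] False by (simp add: norm_mult norm_power field_simps)
      moreover have "inverse (cmod l) > 1"
        using False l \<open>\<not> cmod l > 1\<close> by (simp add: one_less_inverse_iff)
      ultimately show ?thesis using vanish[OF _ _ growth(2)] xy by metis
    qed (use y[of 0] xy in simp)
  qed
  then show "x n = 0" using xn[of n] by simp
  show "y n = 0"
  proof (cases "l = 0")
    case False
    then show ?thesis using yn[of n] x0 xy by simp
  qed (use y[of n] in simp)
qed

lemma scalar_prod_mult_mat_vec:
  fixes t :: "'a :: comm_ring_1 vec"
  assumes "M \<in> carrier_mat d e" "t \<in> carrier_vec d" "w \<in> carrier_vec e"
  shows "t \<bullet> (M *\<^sub>v w) = (\<Sum>i<e. (t \<bullet> col M i) * w $ i)"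
proof -
  have "t \<bullet> (M *\<^sub>v w) = (transpose_mat M *\<^sub>v t) \<bullet> w"
    using assms by (simp add: transpose_vec_mult_scalar)
  also have "\<dots> = (\<Sum>i<e. (col M i \<bullet> t) * w $ i)"
    using assms by (simp add: scalar_prod_def[of _ w] atLeast0LessThan)
  also have "\<dots> = (\<Sum>i<e. (t \<bullet> col M i) * w $ i)"
    using assms comm_scalar_prod[of _ d t] by (intro sum.cong) auto
  finally show ?thesis .
qed

text \<open>In the basis of columns of \<open>P\<close> the matrix becomes upper triangular. The
  value on column \<open>j\<close> then satisfies the scalar recursion of the eigenvalue
  \<open>B $$ (j, j)\<close>, up to columns of smaller index, on which the form already
  vanishes.\<close>

lemma hyperbolic_functional_zero:
  fixes A A' :: "complex mat"
  assumes A: "A \<in> carrier_mat d d" and A': "A' \<in> carrier_mat d d" "A' * A = 1\<^sub>m d"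
    and spec: "\<And>\<mu>. eigenvalue A \<mu> \<Longrightarrow> cmod \<mu> \<noteq> 1" and t: "t \<in> carrier_vec d"
    and growth: "\<And>i s. \<lbrakk>i < d; s > 1\<rbrakk> \<Longrightarrow> \<exists>C. \<forall>n. cmod (t \<bullet> col (A ^\<^sub>m n) i) \<le> C * s ^ n"
      "\<And>i s. \<lbrakk>i < d; s > 1\<rbrakk> \<Longrightarrow> \<exists>C. \<forall>n. cmod (t \<bullet> col (A' ^\<^sub>m n) i) \<le> C * s ^ n"
  shows "t = 0\<^sub>v d"
proof -
  have pow: "A ^\<^sub>m n \<in> carrier_mat d d" "A' ^\<^sub>m n \<in> carrier_mat d d" for n
    using A A' by simp_all
  obtain es where es: "char_poly A = (\<Prod>a\<leftarrow>es. [:- a, 1:])"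
    using char_poly_factorized[OF A] by auto
  obtain B where B: "B \<in> carrier_mat d d" "upper_triangular B" "similar_mat A B"
    using schur_decomposition_exists[OF A es] by blast
  obtain P Q where "similar_mat_wit A B P Q" using B(3) unfolding similar_mat_def by blast
  then have P: "P \<in> carrier_mat d d" and Q: "Q \<in> carrier_mat d d"
    and PQ: "P * Q = 1\<^sub>m d" "Q * P = 1\<^sub>m d" "A = P * B * Q"
    using A unfolding similar_mat_wit_def Let_def by auto
  have AP: "A * P = P * B"
  proof -
    have "A * P = P * B * (Q * P)" unfolding PQ(3) using P Q B by (simp add: assoc_mult_mat[of _ d d _ d _ d])
    then show ?thesis using P B PQ by simp
  qed
  have diag: "cmod (B $$ (j, j)) \<noteq> 1" if j: "j < d" for j
  proof -
    have "char_poly B = (\<Prod>a\<leftarrow>diag_mat B. [:- a, 1:])"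
      by (rule char_poly_upper_triangular[OF B(1,2)])
    moreover have "B $$ (j, j) \<in> set (diag_mat B)"
      using j B(1) by (auto simp: diag_mat_def)
    ultimately have "poly (char_poly B) (B $$ (j, j)) = 0"
      by (simp add: poly_prod_list prod_list_zero_iff image_iff)
    then have "eigenvalue A (B $$ (j, j))"
      using char_poly_similar[OF B(3)] by (simp add: eigenvalue_root_char_poly[OF A])
    then show ?thesis by (rule spec)
  qed
  have grow: "\<exists>C. \<forall>n. cmod (t \<bullet> (M n *\<^sub>v v)) \<le> C * s ^ n"
    if M: "\<And>n. M n \<in> carrier_mat d d" and v: "v \<in> carrier_vec d"
      and C: "\<And>i. i < d \<Longrightarrow> \<exists>C. \<forall>n. cmod (t \<bullet> col (M n) i) \<le> C * s ^ n"
    for M v and s :: real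
  proof -
    obtain C where C: "\<And>i n. i < d \<Longrightarrow> cmod (t \<bullet> col (M n) i) \<le> C i * s ^ n" using C by metis
    have "cmod (t \<bullet> (M n *\<^sub>v v)) \<le> (\<Sum>i<d. C i * cmod (v $ i)) * s ^ n" for n
    proof -
      have "cmod (t \<bullet> (M n *\<^sub>v v)) \<le> (\<Sum>i<d. cmod ((t \<bullet> col (M n) i) * v $ i))"
        unfolding scalar_prod_mult_mat_vec[OF M t v] by (rule norm_sum)
      also have "\<dots> \<le> (\<Sum>i<d. C i * s ^ n * cmod (v $ i))"
        using C by (intro sum_mono) (simp add: norm_mult mult_right_mono)
      also have "\<dots> = (\<Sum>i<d. C i * cmod (v $ i)) * s ^ n" by (simp add: sum_distrib_left mult_ac)
      finally show ?thesis .
    qed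
    then show ?thesis by blast
  qed
  define x where "x n j = t \<bullet> (A ^\<^sub>m n *\<^sub>v col P j)" for n j
  define y where "y n j = t \<bullet> (A' ^\<^sub>m n *\<^sub>v col P j)" for n j
  \<comment> \<open>The left factor is arbitrary so that powers of \<open>A\<close> and of
    \<open>A'\<close> share one recursion.\<close>
  have step: "t \<bullet> (M * A *\<^sub>v col P j) = (\<Sum>i<d. (t \<bullet> (M *\<^sub>v col P i)) * B $$ (i, j))"
    if M: "M \<in> carrier_mat d d" and j: "j < d" for M j
  proof -
    have "M * A *\<^sub>v col P j = col (M * A * P) j"
      using A P M j by (intro col_mult2[symmetric]) auto
    also have "M * A * P = M * P * B" using A P M B AP by (simp add: assoc_mult_mat[of _ d d _ d _ d])
    also have "col \<dots> j = M * P *\<^sub>v col B j" using P M B j by (intro col_mult2) auto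
    also have "t \<bullet> \<dots> = (\<Sum>i<d. (t \<bullet> col (M * P) i) * col B j $ i)"
      using M P B j t by (intro scalar_prod_mult_mat_vec) auto
    also have "\<dots> = (\<Sum>i<d. (t \<bullet> (M *\<^sub>v col P i)) * B $$ (i, j))"
      using M P B j by (intro sum.cong refl) (simp only: col_mult2[OF M P] lessThan_iff index_col carrier_matD)
    finally show ?thesis .
  qed
  have zero: "\<forall>n. x n j = 0 \<and> y n j = 0" if "j < d" for j
    using that
  proof (induction j rule: less_induct)
    case (less j)
    have tri: "(\<Sum>i<d. (t \<bullet> (M *\<^sub>v col P i)) * B $$ (i, j)) = B $$ (j, j) * (t \<bullet> (M *\<^sub>v col P j))"
      if "\<And>i. i < j \<Longrightarrow> t \<bullet> (M *\<^sub>v col P i) = 0" for M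
    proof -
      have "(\<Sum>i<d. (t \<bullet> (M *\<^sub>v col P i)) * B $$ (i, j)) = (\<Sum>i\<in>{j}. (t \<bullet> (M *\<^sub>v col P i)) * B $$ (i, j))"
      proof (intro sum.mono_neutral_right ballI)
        fix i assume "i \<in> {..<d} - {j}"
        then have "i < j \<or> j < i \<and> i < d" by auto
        then show "t \<bullet> (M *\<^sub>v col P i) * B $$ (i, j) = 0"
          using that B(1,2) unfolding upper_triangular_def by auto
      qed (use less.prems in auto)
      then show ?thesis by simp
    qed
    have lo: "i < j \<Longrightarrow> t \<bullet> (A ^\<^sub>m n *\<^sub>v col P i) = 0" "i < j \<Longrightarrow> t \<bullet> (A' ^\<^sub>m n *\<^sub>v col P i) = 0" for i n
      using less.IH[of i] less.prems by (auto simp: x_def y_def)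
    \<comment> \<open>Applying \<open>step\<close> to a power of \<open>A'\<close> runs the
      recursion backwards, so \<open>B\<close> need not be inverted.\<close>
    have A'_Suc: "A' ^\<^sub>m Suc n * A = A' ^\<^sub>m n" for n
      using A A' pow by (simp add: assoc_mult_mat[of _ d d _ d _ d])
    have x: "x (Suc n) j = B $$ (j, j) * x n j" for n
      using step[OF pow(1) less.prems, of n] tri[OF lo(1)] by (simp add: x_def)
    have y: "y n j = B $$ (j, j) * y (Suc n) j" for n
      using step[OF pow(2) less.prems, of "Suc n"] tri[OF lo(2)] unfolding A'_Suc y_def by metis
    have "x 0 j = y 0 j" using A A' by (simp add: x_def y_def)
    moreover have "\<exists>C. \<forall>n. cmod (x n j) \<le> C * s ^ n" "\<exists>C. \<forall>n. cmod (y n j) \<le> C * s ^ n"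
      if "s > 1" for s
      unfolding x_def y_def using P less.prems growth that by (intro grow pow; simp)+
    ultimately show ?case
      using two_sided_geometric_zero[of "B $$ (j, j)" "\<lambda>n. x n j" "\<lambda>n. y n j"]
        diag[OF less.prems] x y by blast
  qed
  have "t \<bullet> unit_vec d k = 0" if k: "k < d" for k
  proof -
    have "unit_vec d k = P *\<^sub>v col Q k" using PQ(1) P Q k by (metis col_mult2 col_one)
    then have "t \<bullet> unit_vec d k = (\<Sum>i<d. (t \<bullet> col P i) * col Q k $ i)"
      using scalar_prod_mult_mat_vec[OF P t, of "col Q k"] Q k by simp
    also have "\<dots> = 0"
    proof (intro sum.neutral ballI)
      fix i assume "i \<in> {..<d}"
      moreover have "A ^\<^sub>m 0 *\<^sub>v col P i = col P i" using A P by (simp add: carrier_vecI)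
      ultimately show "(t \<bullet> col P i) * col Q k $ i = 0" using zero[of i] unfolding x_def by (metis lessThan_iff mult_zero_left)
    qed
    finally show ?thesis .
  qed
  then show ?thesis using t by (intro eq_vecI) auto
qed

section \<open>Full-rank subgroups of rational vector spaces\<close>

lemma Q_space_comm_group: "comm_group (Q_space d)"
proof (rule comm_groupI)
  fix x assume "x \<in> carrier (Q_space d)"
  then show "\<exists>y\<in>carrier (Q_space d). y \<otimes>\<^bsub>Q_space d\<^esub> x = \<one>\<^bsub>Q_space d\<^esub>"
    by (intro bexI[of _ "- x"]) auto
qed (auto simp: comm_add_vec[of _ d] assoc_add_vec[of _ d])

interpretation Q_space: comm_group "Q_space d" for d
  by (rule Q_space_comm_group)

lemma Q_space_inv: "h \<in> carrier_vec d \<Longrightarrow> inv\<^bsub>Q_space d\<^esub> h = - h"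
  by (rule Q_space.inv_equality) auto

lemma Q_subgroup_comm_group:
  assumes "subgroup H (Q_space d)"
  shows "comm_group (Q_subgroup d H)"
  using assms subgroup.subset[OF assms]
  by (intro group.group_comm_groupI Q_space.subgroup_imp_group) (auto intro!: comm_add_vec)

lemma Q_subgroup_uminus:
  assumes "subgroup H (Q_space d)" "h \<in> H"
  shows "- h \<in> H"
  using subgroup.m_inv_closed[OF assms] subgroup.mem_carrier[OF assms] by (simp add: Q_space_inv)

lemma common_denominator:
  fixes f :: "nat \<Rightarrow> rat"
  shows "\<exists>q>0::nat. \<forall>i<d. \<exists>m::int. of_nat q * f i = of_int m"
proof (induction d)
  case 0
  show ?case by (intro exI[of _ 1]) simp
next
  case (Suc d)
  then obtain q :: nat where q: "q > 0" "\<And>i. i < d \<Longrightarrow> \<exists>m::int. of_nat q * f i = of_int m" by blast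
  obtain a b :: int where ab: "b > 0" "f d = of_int a / of_int b"
    by (metis Fract_of_int_quotient Rat_cases)
  have "\<exists>m::int. of_nat (q * nat b) * f i = of_int m" if "i < Suc d" for i
  proof (cases "i < d")
    case True
    then obtain m :: int where "of_nat q * f i = of_int m" using q by blast
    then have "of_nat (q * nat b) * f i = of_int (b * m)" using ab(1) by (simp add: mult_ac)
    then show ?thesis by blast
  next
    case False
    then have "of_nat (q * nat b) * f i = of_int (int q * a)" using ab that by (simp add: less_Suc_eq)
    then show ?thesis by blast
  qed
  then show ?case using q(1) ab(1) by (intro exI[of _ "q * nat b"]) auto
qed

lemma complex_of_real_of_rat: "complex_of_real (of_rat q) = of_rat q"
  by (cases q) (simp add: of_rat_rat)

text \<open>Otherwise two elements of \<open>H\<close> differing only in coordinate \<open>i\<close>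
  would coincide, and deleting that coordinate would embed \<open>H\<close> in dimension
  \<open>d - 1\<close>.\<close>

lemma full_rank_meets_axis:
  assumes H: "subgroup H (Q_space d)" and rank: "rank_Q (Q_subgroup d H) = d" and i: "i < d"
  shows "\<exists>r. r \<noteq> 0 \<and> r \<cdot>\<^sub>v unit_vec d i \<in> H"
proof (rule ccontr)
  assume neg: "\<not> ?thesis"
  have car: "h \<in> carrier_vec d" if "h \<in> H" for h using subgroup.mem_carrier[OF H that] by simp
  \<comment> \<open>Enumerates the coordinates other than \<open>i\<close> in order.\<close>
  define skip where "skip k = (if k < i then k else Suc k)" for k
  define f where "f h = vec (d - 1) (\<lambda>k. h $ skip k)" for h :: "rat vec"
  have skip: "skip k < d" if "k < d - 1" for k using that i by (auto simp: skip_def)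
  have "f \<in> hom (Q_subgroup d H) (Q_space (d - 1))"
  proof (rule homI)
    fix x y assume "x \<in> carrier (Q_subgroup d H)" "y \<in> carrier (Q_subgroup d H)"
    then have "y \<in> carrier_vec d" using car by simp
    then show "f (x \<otimes>\<^bsub>Q_subgroup d H\<^esub> y) = f x \<otimes>\<^bsub>Q_space (d - 1)\<^esub> f y"
      using skip by (intro eq_vecI) (auto simp: f_def)
  qed (simp add: f_def)
  moreover have "inj_on f H"
  proof (rule inj_onI, rule ccontr)
    fix x y assume xy: "x \<in> H" "y \<in> H" "f x = f y" "x \<noteq> y"
    have xy_car: "x \<in> carrier_vec d" "y \<in> carrier_vec d" using xy car by blast+
    have eq: "x $ j = y $ j" if j: "j < d" "j \<noteq> i" for j
    proof -
      define k where "k = (if j < i then j else j - 1)"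
      have "k < d - 1" "skip k = j" using j i by (auto simp: k_def skip_def)
      then show ?thesis using arg_cong[OF xy(3), of "\<lambda>v. v $ k"] by (simp add: f_def)
    qed
    have "x + - y \<in> H"
      using subgroup.m_closed[OF H xy(1) Q_subgroup_uminus[OF H xy(2)]] by simp
    also have "x + - y = (x $ i - y $ i) \<cdot>\<^sub>v unit_vec d i"
      using eq xy_car i by (intro eq_vecI) auto
    finally have "x $ i = y $ i" using neg[unfolded not_ex, rule_format, of "x $ i - y $ i"] by auto
    then have "x $ j = y $ j" if "j < d" for j using eq that by (cases "j = i") auto
    then have "x = y" using xy_car by (intro eq_vecI) auto
    then show False using xy(4) by simp
  qed
  ultimately have "mon (Q_subgroup d H) (Q_space (d - 1)) \<noteq> {}" by (auto simp: mon_def)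
  then have "rank_Q (Q_subgroup d H) \<le> d - 1" unfolding rank_Q_def by (rule Least_le)
  then show False using rank i by simp
qed

text \<open>Full rank is kept as witnesses \<open>r i\<close>. The multiples of the unit vectors
  that they give span a lattice with torsion quotient in \<open>H\<close>.\<close>

locale full_rank_subgroup =
  fixes d :: nat and H :: "rat vec set" and r :: "nat \<Rightarrow> rat"
  assumes H: "subgroup H (Q_space d)"
    and r_nonzero: "i < d \<Longrightarrow> r i \<noteq> 0" and r_axis: "i < d \<Longrightarrow> r i \<cdot>\<^sub>v unit_vec d i \<in> H"
begin

abbreviation "K \<equiv> Q_subgroup d H"

definition "w i = r i \<cdot>\<^sub>v unit_vec d i"

definition "E = w ` {..<d} \<union> (\<lambda>i. - w i) ` {..<d}"

sublocale K: comm_group K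
  by (rule Q_subgroup_comm_group[OF H])

lemma H_carrier: "h \<in> H \<Longrightarrow> h \<in> carrier_vec d"
  using subgroup.mem_carrier[OF H] by simp

lemma w_H: "i < d \<Longrightarrow> w i \<in> H"
  by (simp add: w_def r_axis)

lemma K_inv: "h \<in> H \<Longrightarrow> inv\<^bsub>K\<^esub> h = - h"
  using H_carrier[of h] Q_subgroup_uminus[OF H, of h] by (intro K.inv_equality) auto

lemma K_pow: "h \<in> H \<Longrightarrow> h [^]\<^bsub>K\<^esub> (n::nat) = of_nat n \<cdot>\<^sub>v h"
proof (induction n)
  case 0
  then show ?case using H_carrier[of h] by (intro eq_vecI) auto
next
  case (Suc n)
  then show ?case using H_carrier[of h] by (intro eq_vecI) (auto simp: algebra_simps)
qed

lemma K_int_pow: 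
  assumes h: "h \<in> H"
  shows "h [^]\<^bsub>K\<^esub> (m::int) = of_int m \<cdot>\<^sub>v h"
proof (cases m rule: int_cases2)
  case (nonneg n)
  then show ?thesis using K_pow[OF h, of n] by (simp add: int_pow_int)
next
  case (nonpos n)
  have "of_nat n \<cdot>\<^sub>v h \<in> H" using K.nat_pow_closed[of h n] h K_pow[OF h, of n] by simp
  then have "h [^]\<^bsub>K\<^esub> m = - (of_nat n \<cdot>\<^sub>v h)"
    using nonpos h K.int_pow_neg[of h "int n"] K_pow[OF h, of n] K_inv[of "of_nat n \<cdot>\<^sub>v h"]
    by (simp add: int_pow_int)
  then show ?thesis using nonpos by auto
qed

lemma E_H: "E \<subseteq> H"
  using w_H Q_subgroup_uminus[OF H] by (auto simp: E_def)

text \<open>The truncation at \<open>k\<close> serves the induction over coordinates; the lemma is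
  applied with \<open>k = d\<close>.\<close>

lemma integer_combination:
  fixes m :: "nat \<Rightarrow> int"
  assumes "k \<le> d"
  defines "v \<equiv> vec d (\<lambda>i. if i < k then of_int (m i) * r i else 0)"
  shows "v \<in> generate K E" "\<And>\<tau>. real_hom K \<tau> \<Longrightarrow> \<tau> v = (\<Sum>i<k. of_int (m i) * \<tau> (w i))"
proof -
  have "vec d (\<lambda>i. if i < k then of_int (m i) * r i else 0) \<in> generate K E \<and>
    (\<forall>\<tau>. real_hom K \<tau> \<longrightarrow> \<tau> (vec d (\<lambda>i. if i < k then of_int (m i) * r i else 0))
      = (\<Sum>i<k. of_int (m i) * \<tau> (w i)))"
    using assms(1)
  proof (induction k)
    case 0
    have "vec d (\<lambda>i. 0) = \<one>\<^bsub>K\<^esub>" by (auto intro!: eq_vecI)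
    then show ?case using generate.one[of K E] K.real_hom_one by simp
  next
    case (Suc k)
    define u where "u = vec d (\<lambda>i. if i < k then of_int (m i) * r i else 0)"
    have u: "u \<in> generate K E" "\<And>\<tau>. real_hom K \<tau> \<Longrightarrow> \<tau> u = (\<Sum>i<k. of_int (m i) * \<tau> (w i))"
      using Suc by (auto simp: u_def)
    have wk: "w k \<in> H" using w_H Suc.prems by simp
    have mw: "w k [^]\<^bsub>K\<^esub> m k = of_int (m k) \<cdot>\<^sub>v w k" using wk by (rule K_int_pow)
    have gen: "subgroup (generate K E) K" using E_H by (intro K.generate_is_subgroup) simp
    have uH: "u \<in> carrier K" using subgroup.mem_carrier[OF gen u(1)] .
    have "w k \<in> generate K E" using Suc.prems by (intro generate.incl) (auto simp: E_def)
    then have mg: "of_int (m k) \<cdot>\<^sub>v w k \<in> generate K E"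
      using K.subgroup_int_pow_closed[OF gen, of "w k" "m k"] mw by simp
    have "vec d (\<lambda>i. if i < Suc k then of_int (m i) * r i else 0) = u \<otimes>\<^bsub>K\<^esub> (of_int (m k) \<cdot>\<^sub>v w k)"
      using Suc.prems by (intro eq_vecI) (auto simp: u_def w_def less_Suc_eq)
    moreover have "\<tau> (u \<otimes>\<^bsub>K\<^esub> (of_int (m k) \<cdot>\<^sub>v w k)) = (\<Sum>i<Suc k. of_int (m i) * \<tau> (w i))"
      if "real_hom K \<tau>" for \<tau>
      using K.real_hom_mult[OF that uH subgroup.mem_carrier[OF gen mg]] u(2)[OF that] mw
        K.real_hom_int_pow[OF that, of "w k" "m k"] wk by simp
    ultimately show ?case using generate.eng[OF u(1) mg] by simp
  qed
  then show "v \<in> generate K E" "\<And>\<tau>. real_hom K \<tau> \<Longrightarrow> \<tau> v = (\<Sum>i<k. of_int (m i) * \<tau> (w i))"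
    by (auto simp: v_def)
qed

lemma integer_multiple:
  assumes h: "h \<in> H"
  obtains q :: nat and m :: "nat \<Rightarrow> int" where "q > 0" "\<And>i. i < d \<Longrightarrow> of_nat q * (h $ i / r i) = of_int (m i)"
    "h [^]\<^bsub>K\<^esub> q = vec d (\<lambda>i. if i < d then of_int (m i) * r i else 0)"
proof -
  obtain q :: nat where q: "q > 0" "\<And>i. i < d \<Longrightarrow> \<exists>m::int. of_nat q * (h $ i / r i) = of_int m"
    using common_denominator[of d "\<lambda>i. h $ i / r i"] by blast
  then obtain m :: "nat \<Rightarrow> int" where m: "\<And>i. i < d \<Longrightarrow> of_nat q * (h $ i / r i) = of_int (m i)" by metis
  have "h [^]\<^bsub>K\<^esub> q = vec d (\<lambda>i. if i < d then of_int (m i) * r i else 0)"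
    unfolding K_pow[OF h]
    using H_carrier[OF h] m[symmetric] r_nonzero by (intro eq_vecI) (auto simp: field_simps)
  then show thesis using that q(1) m by blast
qed

sublocale finite_rank_group K E
proof
  show "inv\<^bsub>K\<^esub> e \<in> E" if "e \<in> E" for e
  proof -
    have "inv\<^bsub>K\<^esub> e = - e" using that E_H by (intro K_inv) auto
    moreover have "- e \<in> E" using that by (auto simp: E_def)
    ultimately show ?thesis by simp
  qed
  show "\<exists>q::nat. q > 0 \<and> h [^]\<^bsub>K\<^esub> q \<in> generate K E" if "h \<in> carrier K" for h
    using that integer_multiple[of h] integer_combination(1)[OF order_refl] by (metis partial_object.select_convs(1) partial_object.surjective partial_object.update_convs(1))
qed (use E_H in \<open>auto simp: E_def\<close>)

text \<open>Some multiple of \<open>h\<close> is an integer combination of the \<open>w i\<close>,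
  and the multiplier cancels in the reals. So additivity alone yields rational linearity, although
  the \<open>w i\<close> need not generate \<open>H\<close>.\<close>

lemma real_hom_coordinates:
  assumes \<tau>: "real_hom K \<tau>" and h: "h \<in> H"
  shows "\<tau> h = (\<Sum>i<d. of_rat (h $ i / r i) * \<tau> (w i))"
proof -
  obtain q :: nat and m :: "nat \<Rightarrow> int" where q: "q > 0"
    and m: "\<And>i. i < d \<Longrightarrow> of_nat q * (h $ i / r i) = of_int (m i)"
    and hq: "h [^]\<^bsub>K\<^esub> q = vec d (\<lambda>i. if i < d then of_int (m i) * r i else 0)"
    using integer_multiple[OF h] by blast
  have "real q * \<tau> h = (\<Sum>i<d. of_int (m i) * \<tau> (w i))"
    using integer_combination(2)[OF order_refl \<tau>, of m] K.real_hom_pow[OF \<tau>, of h q] h hq by simp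
  also have "\<dots> = (\<Sum>i<d. real q * (of_rat (h $ i / r i) * \<tau> (w i)))"
  proof (intro sum.cong refl)
    fix i assume "i \<in> {..<d}"
    then have "real_of_rat (of_int (m i)) = of_rat (of_nat q * (h $ i / r i))" using m by simp
    then have "of_int (m i) = real q * of_rat (h $ i / r i)" by (simp only: of_rat_mult of_rat_of_int_eq of_rat_of_nat_eq)
    then show "of_int (m i) * \<tau> (w i) = real q * (of_rat (h $ i / r i) * \<tau> (w i))" by simp
  qed
  also have "\<dots> = real q * (\<Sum>i<d. of_rat (h $ i / r i) * \<tau> (w i))" by (simp add: sum_distrib_left)
  finally show ?thesis using q by simp
qed

lemma funpow_mult_mat_vec:
  assumes "A \<in> carrier_mat d d" "v \<in> carrier_vec d"
  shows "((\<lambda>v. A *\<^sub>v v) ^^ n) v = A ^\<^sub>m n *\<^sub>v v"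
  using assms(2)
proof (induction n arbitrary: v)
  case (Suc n)
  have "((\<lambda>v. A *\<^sub>v v) ^^ Suc n) v = A ^\<^sub>m n *\<^sub>v (A *\<^sub>v v)"
    using Suc assms(1) by (simp add: funpow_Suc_right del: funpow.simps)
  then show ?case using assms(1) Suc.prems by (simp add: assoc_mult_mat_vec[of _ d d _ d])
qed (use assms(1) in simp)

lemma hyperbolic_real_hom_zero:
  assumes A: "A \<in> carrier_mat d d" and A': "A' \<in> carrier_mat d d" "A' * A = 1\<^sub>m d"
    and inv: "\<And>h. h \<in> H \<Longrightarrow> A *\<^sub>v h \<in> H" "\<And>h. h \<in> H \<Longrightarrow> A' *\<^sub>v h \<in> H"
    and spec: "\<And>\<mu>. eigenvalue (map_mat of_rat A :: complex mat) \<mu> \<Longrightarrow> cmod \<mu> \<noteq> 1"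
    and \<tau>: "real_hom K \<tau>"
    and growth: "\<And>h s. \<lbrakk>h \<in> H; s > 1\<rbrakk> \<Longrightarrow> \<exists>C. \<forall>n. \<bar>\<tau> (((\<lambda>v. A *\<^sub>v v) ^^ n) h)\<bar> \<le> C * s ^ n"
      "\<And>h s. \<lbrakk>h \<in> H; s > 1\<rbrakk> \<Longrightarrow> \<exists>C. \<forall>n. \<bar>\<tau> (((\<lambda>v. A' *\<^sub>v v) ^^ n) h)\<bar> \<le> C * s ^ n"
    and h: "h \<in> H"
  shows "\<tau> h = 0"
proof -
  \<comment> \<open>The coordinate \<open>i\<close> is the value of the linear extension of
    \<open>\<tau>\<close> at the unit vector, which itself may lie outside \<open>H\<close>. Pairing
    \<open>t\<close> with column \<open>i\<close> of a matrix power thus gives \<open>\<tau>\<close>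
    of the iterate of \<open>w i\<close>, divided by \<open>r i\<close>.\<close>
  define t :: "complex vec" where "t = vec d (\<lambda>i. of_real (\<tau> (w i) / of_rat (r i)))"
  define C where "C M = (map_mat of_rat M :: complex mat)" for M :: "rat mat"
  have C_pow: "C M ^\<^sub>m n = C (M ^\<^sub>m n)" if "M \<in> carrier_mat d d" for M n
    unfolding C_def using of_rat_hom.mat_hom_pow[OF that] by metis
  have grow: "\<exists>B. \<forall>n. cmod (t \<bullet> col (C M ^\<^sub>m n) i) \<le> B * s ^ n"
    if M: "M \<in> carrier_mat d d" and MH: "\<And>h. h \<in> H \<Longrightarrow> M *\<^sub>v h \<in> H"
      and g: "\<exists>B. \<forall>n. \<bar>\<tau> (((\<lambda>v. M *\<^sub>v v) ^^ n) (w i))\<bar> \<le> B * s ^ n"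
      and i: "i < d" for M i and s :: real
  proof -
    have "t \<bullet> col (C M ^\<^sub>m n) i = of_real (\<tau> (((\<lambda>v. M *\<^sub>v v) ^^ n) (w i)) / of_rat (r i))" for n
    proof -
      have Mn: "M ^\<^sub>m n \<in> carrier_mat d d" using M by simp
      define u where "u = ((\<lambda>v. M *\<^sub>v v) ^^ n) (w i)"
      have "u \<in> H" unfolding u_def using w_H[OF i] MH by (induction n) auto
      have "M ^\<^sub>m n *\<^sub>v unit_vec d i = col (M ^\<^sub>m n) i"
        using Mn i by (intro eq_vecI) auto
      then have "u = r i \<cdot>\<^sub>v col (M ^\<^sub>m n) i"
        unfolding u_def using funpow_mult_mat_vec[OF M H_carrier[OF w_H[OF i]], of n] Mn i
        by (simp add: w_def mult_mat_vec[of _ d d])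
      then have u: "u $ k = r i * (M ^\<^sub>m n) $$ (k, i)" if "k < d" for k using that Mn M i by simp
      have "\<tau> u / of_rat (r i) = (\<Sum>k<d. of_rat (u $ k / r k) * \<tau> (w k)) / of_rat (r i)"
        by (simp add: real_hom_coordinates[OF \<tau> \<open>u \<in> H\<close>])
      also have "\<dots> = (\<Sum>k<d. of_rat ((M ^\<^sub>m n) $$ (k, i)) * (\<tau> (w k) / of_rat (r k)))"
        unfolding sum_divide_distrib using u r_nonzero[OF i]
        by (intro sum.cong) (auto simp: of_rat_mult of_rat_divide)
      finally have "of_real (\<tau> u / of_rat (r i))
          = (\<Sum>k<d. of_rat ((M ^\<^sub>m n) $$ (k, i)) * complex_of_real (\<tau> (w k) / of_rat (r k)))"
        by (simp add: complex_of_real_of_rat)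
      then show ?thesis
        unfolding C_pow[OF M]
        using Mn i M by (simp add: scalar_prod_def t_def C_def u_def atLeast0LessThan mult.commute)
    qed
    then have "cmod (t \<bullet> col (C M ^\<^sub>m n) i) = \<bar>\<tau> (((\<lambda>v. M *\<^sub>v v) ^^ n) (w i))\<bar> / \<bar>of_rat (r i)\<bar>" for n
      by (simp add: norm_divide)
    moreover obtain B where "\<And>n. \<bar>\<tau> (((\<lambda>v. M *\<^sub>v v) ^^ n) (w i))\<bar> \<le> B * s ^ n" using g by blast
    ultimately have "cmod (t \<bullet> col (C M ^\<^sub>m n) i) \<le> B / \<bar>of_rat (r i)\<bar> * s ^ n" for n
      by (simp add: divide_right_mono)
    then show ?thesis by blast
  qed
  have "t = 0\<^sub>v d"
  proof (rule hyperbolic_functional_zero[of "C A" d "C A'"])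
    show "C A' * C A = 1\<^sub>m d"
      unfolding C_def using of_rat_hom.mat_hom_mult[OF A'(1) A] A'(2) of_rat_hom.mat_hom_one by metis
    show "\<exists>B. \<forall>n. cmod (t \<bullet> col (C A ^\<^sub>m n) i) \<le> B * s ^ n" if "i < d" "s > 1" for i s
      using A inv(1) growth(1)[OF w_H that(2)] that(1) by (intro grow) auto
    show "\<exists>B. \<forall>n. cmod (t \<bullet> col (C A' ^\<^sub>m n) i) \<le> B * s ^ n" if "i < d" "s > 1" for i s
      using A' inv(2) growth(2)[OF w_H that(2)] that(1) by (intro grow) auto
  qed (use A A' spec in \<open>auto simp: C_def t_def\<close>)
  then have t0: "t $ i = 0" if "i < d" for i using that by simp
  have "\<tau> (w i) = 0" if "i < d" for i using t0[OF that] that r_nonzero[OF that] by (simp add: t_def)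
  then show ?thesis using real_hom_coordinates[OF \<tau> h] by simp
qed

end

section \<open>Actions of the semidirect product\<close>

lemma C1_action_interval_action:
  assumes "C1_action G \<phi>"
  shows "interval_action G \<phi>"
proof -
  interpret group_action G "{0..1}" \<phi> using assms by (simp add: C1_action_def)
  show ?thesis
    using assms group_hom composition_rule
    by (auto simp: interval_action_def interval_action_axioms_def C1_action_def C1_diffeo_plus_def
        group_hom_def)
qed

locale semidirect_action = K: group K for K :: "('h, 'b) monoid_scheme" (structure) +
  fixes \<theta> :: "'h \<Rightarrow> 'h" and \<phi> :: "int \<times> 'h \<Rightarrow> real \<Rightarrow> real"
  assumes \<theta>_hom: "\<theta> \<in> hom K K" and \<theta>_bij: "bij_betw \<theta> (carrier K) (carrier K)"
    and C1: "C1_action (int_semidirect K \<theta>) \<phi>"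
begin

abbreviation "G \<equiv> int_semidirect K \<theta>"

sublocale act: interval_action G \<phi>
  by (rule C1_action_interval_action[OF C1])

lemma carrier_G: "carrier G = UNIV \<times> carrier K"
  by (simp add: int_semidirect_def)

text \<open>Only left multiplication by kernel elements and by the generator is ever evaluated, so
  of the powers of \<open>\<theta>\<close> only those with exponents 0 and 1 have to be
  computed.\<close>

lemma mult_0: "k \<in> carrier K \<Longrightarrow> (0, h) \<otimes>\<^bsub>G\<^esub> (n, k) = (n, h \<otimes> k)"
  by (simp add: int_semidirect_def BijGroup_def)

lemma mult_1:
  assumes "k \<in> carrier K"
  shows "(1, h) \<otimes>\<^bsub>G\<^esub> (n, k) = (1 + n, h \<otimes> \<theta> k)"
proof -
  have "restrict \<theta> (carrier K) \<in> carrier (BijGroup (carrier K))"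
    using \<theta>_bij by (auto simp: BijGroup_def Bij_def)
  then have "restrict \<theta> (carrier K) [^]\<^bsub>BijGroup (carrier K)\<^esub> (1::int) = restrict \<theta> (carrier K)"
    by (intro group.int_pow_1 group_BijGroup)
  then show ?thesis using assms by (simp add: int_semidirect_def)
qed

lemma \<theta>_closed: "h \<in> carrier K \<Longrightarrow> \<theta> h \<in> carrier K"
  using \<theta>_hom by (auto simp: hom_def)

lemma act_kernel_mult:
  assumes "h \<in> carrier K" "k \<in> carrier K" "x \<in> {0..1}"
  shows "\<phi> (0, h) (\<phi> (n, k) x) = \<phi> (n, h \<otimes> k) x"
  using act.act_mult[of "(0, h)" "(n, k)" x] assms by (simp add: mult_0 carrier_G)

lemma act_generator_mult:
  assumes "k \<in> carrier K" "x \<in> {0..1}"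
  shows "\<phi> (1, \<one>) (\<phi> (n, k) x) = \<phi> (1 + n, \<theta> k) x"
  using act.act_mult[of "(1, \<one>)" "(n, k)" x] assms by (simp add: mult_1 carrier_G \<theta>_closed)

text \<open>The generator takes \<open>(m, h)\<close> to \<open>(1 + m, \<theta> h)\<close>. As
  \<open>\<theta>\<close> permutes the carrier, the claim for all \<open>h\<close> simultaneously
  passes between neighbouring \<open>m\<close> in both directions.\<close>

lemma global_fixed_point_if_fixed:
  assumes x: "x \<in> {0..1}" and a: "\<phi> (1, \<one>) x = x"
    and h: "\<And>h. h \<in> carrier K \<Longrightarrow> \<phi> (0, h) x = x"
  shows "global_fixed_point G \<phi> x"
proof -
  have step: "\<phi> (1 + m, \<theta> h) x = x \<longleftrightarrow> \<phi> (m, h) x = x" if h: "h \<in> carrier K" for m h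
  proof -
    have "\<phi> (m, h) x \<in> {0..1}" using act.act_closed[of "(m, h)" x] x h by (simp add: carrier_G)
    then have "\<phi> (1, \<one>) (\<phi> (m, h) x) = \<phi> (1, \<one>) x \<longleftrightarrow> \<phi> (m, h) x = x"
      using act.bij[of "(1, \<one>)"] x by (auto simp: carrier_G bij_betw_def inj_on_eq_iff)
    then show ?thesis using act_generator_mult[OF h x, of m] a by simp
  qed
  have "\<forall>h\<in>carrier K. \<phi> (m, h) x = x" for m
  proof (induction m rule: int_induct[of _ 0])
    case base
    show ?case using h by blast
  next
    case (step1 m)
    have "\<phi> (m + 1, h) x = x" if "h \<in> carrier K" for h
    proof -
      have "h \<in> \<theta> ` carrier K" using \<theta>_bij that by (simp add: bij_betw_def)
      then obtain k where k: "k \<in> carrier K" "h = \<theta> k" by blast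
      then have "\<phi> (1 + m, h) x = x" using step[OF k(1), of m] step1.IH by simp
      then show ?thesis by (simp add: add.commute)
    qed
    then show ?case by blast
  next
    case (step2 m)
    have "\<phi> (m - 1, h) x = x" if "h \<in> carrier K" for h
      using step[OF that, of "m - 1"] step2.IH \<theta>_closed[OF that] by simp
    then show ?case by blast
  qed
  then show ?thesis by (auto simp: global_fixed_point_def carrier_G)
qed

text \<open>With the kernel acting trivially, \<open>\<phi> g\<close> depends only on the integer
  component of \<open>g\<close>, and these components commute.\<close>

lemma comm_group_action_image:
  assumes trivial: "\<And>h x. \<lbrakk>h \<in> carrier K; x \<in> {0..1}\<rbrakk> \<Longrightarrow> \<phi> (0, h) x = x"
  shows "comm_group (action_image G \<phi>)"
proof -
  interpret \<phi>: group_hom G "BijGroup {0..1}" \<phi>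
    using C1 by (simp add: C1_action_def group_action_def)
  have eq: "\<phi> (m, h) = \<phi> (m, k)" if hk: "h \<in> carrier K" "k \<in> carrier K" for m h k
  proof
    fix x
    show "\<phi> (m, h) x = \<phi> (m, k) x"
    proof (cases "x \<in> {0..1}")
      case True
      have "\<phi> (m, h) x = \<phi> (0, h \<otimes> inv k) (\<phi> (m, k) x)"
        using act_kernel_mult[of "h \<otimes> inv k" k x m] hk True by (simp add: K.m_assoc)
      then show ?thesis
        using trivial[of "h \<otimes> inv k" "\<phi> (m, k) x"] act.act_closed[of "(m, k)" x] hk True
        by (simp add: carrier_G)
    next
      case False
      \<comment> \<open>Equality in the group of bijections is equality of functions on all reals;
        outside the interval both take the default value.\<close>
      have "\<phi> (m, h) \<in> extensional {0..1}" "\<phi> (m, k) \<in> extensional {0..1}"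
        using \<phi>.hom_closed hk by (auto simp: carrier_G BijGroup_def Bij_def)
      then show ?thesis using False by (simp add: extensional_def)
    qed
  qed
  have "subgroup (\<phi> ` carrier G) (BijGroup {0..1})" by (rule \<phi>.img_is_subgroup)
  then have "group (action_image G \<phi>)"
    unfolding action_image_def by (rule \<phi>.H.subgroup_imp_group)
  moreover have "\<phi> g \<otimes>\<^bsub>BijGroup {0..1}\<^esub> \<phi> g' = \<phi> g' \<otimes>\<^bsub>BijGroup {0..1}\<^esub> \<phi> g"
    if g: "g \<in> carrier G" "g' \<in> carrier G" for g g'
  proof -
    have "fst (g \<otimes>\<^bsub>G\<^esub> g') = fst (g' \<otimes>\<^bsub>G\<^esub> g)"
      by (simp add: int_semidirect_def case_prod_beta)
    moreover have "g \<otimes>\<^bsub>G\<^esub> g' \<in> carrier G" "g' \<otimes>\<^bsub>G\<^esub> g \<in> carrier G" using g by simp_all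
    ultimately have "\<phi> (g \<otimes>\<^bsub>G\<^esub> g') = \<phi> (g' \<otimes>\<^bsub>G\<^esub> g)"
      using eq unfolding carrier_G by (metis mem_Times_iff prod.collapse)
    then show ?thesis using g by simp
  qed
  ultimately show ?thesis
    by (intro group.group_comm_groupI) (auto simp: action_image_def)
qed

lemma minimal_if_orbits_dense:
  assumes "\<And>x u v. \<lbrakk>x \<in> {0<..<1}; 0 < u; u < v; v < 1\<rbrakk> \<Longrightarrow> \<exists>h\<in>carrier K. u < \<phi> (0, h) x \<and> \<phi> (0, h) x < v"
  shows "minimal_on G \<phi> {0<..<1}"
  unfolding minimal_on_def
proof (intro ballI conjI subsetI)
  fix x y :: real assume x: "x \<in> {0<..<1}"
  show "y \<in> {0<..<1}" if "y \<in> orbit G \<phi> x" using that act.act_interior x by (auto simp: orbit_def)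
  assume y: "y \<in> {0<..<1}"
  show "y \<in> closure (orbit G \<phi> x)"
    unfolding closure_approachable
  proof (intro allI impI)
    fix e :: real assume "e > 0"
    \<comment> \<open>The midpoint of \<open>y\<close> and \<open>min 1 (y + e)\<close> is an upper
      bound strictly below 1, as required of the target interval.\<close>
    then obtain h where h: "h \<in> carrier K" "y < \<phi> (0, h) x" "\<phi> (0, h) x < min 1 (y + e)"
      using assms[OF x, of y "(y + min 1 (y + e)) / 2"] y by fastforce
    then show "\<exists>z\<in>orbit G \<phi> x. dist z y < e"
      by (intro bexI[of _ "\<phi> (0, h) x"]) (auto simp: orbit_def carrier_G dist_real_def)
  qed
qed

end

section \<open>The semidirect product as a twisted action\<close>

theorem proposition1p6:
  fixes d :: nat and A :: "rat mat" and H :: "rat vec set"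
    and \<phi> :: "int \<times> rat vec \<Rightarrow> real \<Rightarrow> real"
  defines "G \<equiv> int_semidirect (Q_subgroup d H) (\<lambda>v. A *\<^sub>v v)"
  assumes "d \<ge> 1"
    and "A \<in> carrier_mat d d" and "invertible_mat A"
    and "\<And>\<mu>. eigenvalue (map_mat of_rat A :: complex mat) \<mu> \<Longrightarrow> cmod \<mu> \<noteq> 1"
    and "subgroup H (Q_space d)"
    and "(\<lambda>v. A *\<^sub>v v) ` H = H"
    and "rank_Q (Q_subgroup d H) = d"
    and "C1_action G \<phi>"
    and "\<not> (\<exists>x\<in>{0<..<1}. global_fixed_point G \<phi> x)"
    and "\<not> comm_group (action_image G \<phi>)"
  shows "minimal_on G \<phi> {0<..<1}"
proof -
  have A: "A \<in> carrier_mat d d" and spec: "\<And>\<mu>. eigenvalue (map_mat of_rat A :: complex mat) \<mu> \<Longrightarrow> cmod \<mu> \<noteq> 1"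
    and H: "subgroup H (Q_space d)" and AH: "(\<lambda>v. A *\<^sub>v v) ` H = H"
    using assms by blast+
  obtain A' where A': "A' \<in> carrier_mat d d" "A' * A = 1\<^sub>m d" "A * A' = 1\<^sub>m d"
  proof -
    obtain B where B: "A * B = 1\<^sub>m (dim_row A)" "B * A = 1\<^sub>m (dim_row B)"
      using assms(4) unfolding invertible_mat_def inverts_mat_def by blast
    have "B \<in> carrier_mat d d"
      \<comment> \<open>Comparing column counts in the two products fixes both dimensions of
        \<open>B\<close>.\<close>
      using arg_cong[OF B(1), of dim_col] arg_cong[OF B(2), of dim_col] A by auto
    then show thesis using that B A by auto
  qed
  obtain r where "\<And>i. i < d \<Longrightarrow> r i \<noteq> 0 \<and> r i \<cdot>\<^sub>v unit_vec d i \<in> H"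
    using full_rank_meets_axis[OF H assms(8)] by metis
  then interpret F: full_rank_subgroup d H r
    using H by (simp add: full_rank_subgroup_def)
  define K where "K = Q_subgroup d H"
  have K [simp]: "carrier K = H" "\<one>\<^bsub>K\<^esub> = 0\<^sub>v d" "h \<otimes>\<^bsub>K\<^esub> k = h + k" for h k
    by (simp_all add: K_def)
  interpret K: finite_rank_group K F.E
    unfolding K_def by (rule F.finite_rank_group_axioms)
  have G: "G = int_semidirect K (\<lambda>v. A *\<^sub>v v)" by (simp add: G_def K_def)
  note hyps = assms(9-11)[unfolded G]
  have AA': "A *\<^sub>v (A' *\<^sub>v h) = h" "A' *\<^sub>v (A *\<^sub>v h) = h" if "h \<in> H" for h
    using A A' F.H_carrier[OF that] by (simp_all flip: assoc_mult_mat_vec[of _ d d _ d])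
  have closed: "A *\<^sub>v h \<in> H" "A' *\<^sub>v h \<in> H" if h: "h \<in> H" for h
  proof -
    show "A *\<^sub>v h \<in> H" using AH h by blast
    obtain k where "k \<in> H" "h = A *\<^sub>v k" using AH h by blast
    then show "A' *\<^sub>v h \<in> H" using AA' by simp
  qed
  have hom: "(\<lambda>v. M *\<^sub>v v) \<in> hom K K" if "M \<in> carrier_mat d d" "\<And>h. h \<in> H \<Longrightarrow> M *\<^sub>v h \<in> H" for M
    using that F.H_carrier by (auto intro!: homI mult_add_distrib_mat_vec[of _ d d])
  interpret S: semidirect_action K "\<lambda>v. A *\<^sub>v v" \<phi>
  proof
    show "bij_betw (\<lambda>v. A *\<^sub>v v) (carrier K) (carrier K)"
      using AH AA' by (auto simp: bij_betw_def intro: inj_on_inverseI[where g = "\<lambda>v. A' *\<^sub>v v"])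
  qed (use hom A closed hyps in auto)
  define a where "a = \<phi> (1, 0\<^sub>v d)"
  \<comment> \<open>Taken from the group inverse, so that the inverse map is again one of the given
    diffeomorphisms.\<close>
  define a' where "a' = \<phi> (inv\<^bsub>S.G\<^esub> (1, 0\<^sub>v d))"
  have z: "0\<^sub>v d \<in> H" using subgroup.one_closed[OF H] by simp
  have gen: "(1, 0\<^sub>v d) \<in> carrier S.G" using z by (simp add: S.carrier_G)
  have diffeo: "C1_diffeo_plus (\<phi> g)" if "g \<in> carrier S.G" for g
    using S.C1 that by (simp add: C1_action_def)
  note deriv = C1_diffeo_plus_strict_deriv0[OF diffeo]
  \<comment> \<open>A trivially acting \<open>H\<close> would leave a cyclic, hence commutative,
    image.\<close>
  have moved: "\<exists>h\<in>carrier K. \<exists>y\<in>{0..1}. \<phi> (0, h) y \<noteq> y"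
    using S.comm_group_action_image hyps(3) by blast
  interpret T: twisted_action K "\<lambda>h. \<phi> (0, h)" F.E "\<lambda>v. A *\<^sub>v v" "\<lambda>v. A' *\<^sub>v v" a a'
  proof
    show "\<phi> (0, h \<otimes>\<^bsub>K\<^esub> k) x = \<phi> (0, h) (\<phi> (0, k) x)"
      if "h \<in> carrier K" "k \<in> carrier K" "x \<in> {0..1}" for h k x
      using S.act_kernel_mult[OF that, of 0] by simp
    show "a (\<phi> (0, h) x) = \<phi> (0, A *\<^sub>v h) (a x)" if h: "h \<in> carrier K" "x \<in> {0..1}" for h x
      using S.act_generator_mult[OF h, of 0] S.act_kernel_mult[of "A *\<^sub>v h" "0\<^sub>v d" x 1] h z closed
        F.H_carrier[OF closed(1)] by (simp add: a_def)
    show "a x \<noteq> x" if x: "x \<in> {0<..<1}" and fixed: "\<And>h. h \<in> carrier K \<Longrightarrow> \<phi> (0, h) x = x" for x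
    proof
      assume "a x = x"
      then have "global_fixed_point S.G \<phi> x"
        using x fixed by (intro S.global_fixed_point_if_fixed) (auto simp: a_def)
      then show False using hyps(2) x by blast
    qed
    show "\<tau> h = 0" if "real_hom K \<tau>" "h \<in> carrier K"
      "\<And>h s. \<lbrakk>h \<in> carrier K; s > 1\<rbrakk> \<Longrightarrow> \<exists>C. \<forall>n. \<bar>\<tau> (((\<lambda>v. A *\<^sub>v v) ^^ n) h)\<bar> \<le> C * s ^ n"
      "\<And>h s. \<lbrakk>h \<in> carrier K; s > 1\<rbrakk> \<Longrightarrow> \<exists>C. \<forall>n. \<bar>\<tau> (((\<lambda>v. A' *\<^sub>v v) ^^ n) h)\<bar> \<le> C * s ^ n" for \<tau> h
      using that by (intro F.hyperbolic_real_hom_zero[OF A A'(1,2) closed spec, folded K_def]) auto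
    show "bij_betw (\<phi> (0, h)) {0..1} {0..1}" "strict_mono_on {0..1} (\<phi> (0, h))"
      "\<exists>c>0. strict_deriv0 (\<phi> (0, h)) c" "\<exists>c>0. strict_deriv0 (unit_flip (\<phi> (0, h))) c"
      if "h \<in> carrier K" for h
      using that S.act.bij S.act.mono deriv by (auto simp: S.carrier_G)
    show "(\<lambda>v. A *\<^sub>v v) \<in> hom K K" "(\<lambda>v. A' *\<^sub>v v) \<in> hom K K"
      using hom A A' closed by blast+
    show "strict_mono_on {0..1} a" "strict_mono_on {0..1} a'"
      using S.act.mono gen by (auto simp: a_def a'_def)
    show "a x \<in> {0..1}" "a' x \<in> {0..1}" "a (a' x) = x" "a' (a x) = x" if "x \<in> {0..1}" for x
      using that gen S.act.act_closed S.act.act_inv S.act.act_inv' by (auto simp: a_def a'_def)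
    show "\<exists>c>0. strict_deriv0 a c" "\<exists>c>0. strict_deriv0 (unit_flip a) c"
      "\<exists>c>0. strict_deriv0 a' c" "\<exists>c>0. strict_deriv0 (unit_flip a') c"
      using gen deriv by (auto simp: a_def a'_def)
  qed (use AA' in auto)
  show ?thesis
    unfolding G using moved T.orbits_dense by (intro S.minimal_if_orbits_dense) blast
qed

end
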